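(* Let $\mu$ be a probability measure with finite entropy $H(\mu)=-\sum_g\mu(g)\log\mu(g)$ on a countable group $G$, and let $(B,\lambda)=\Pi(G^{\mathbb{Z}_+},\mathbf{P})$ be a $\mu$-boundary, with $\Pi$ the projection from the path space. If there exist a temperate gauge $\mathcal{G}$ on $G$ and a sequence of measurable maps $\pi_n:B\to G$ such that $$\frac1n\left|\bigl(\pi_n(\Pi\boldsymbol{x})\bigr)^{-1}x_n\right|_{\mathcal{G}}\to 0$$ for $\mathbf{P}$-a.e. sample path $\boldsymbol{x}=\{x_n\}$, then $(B,\lambda)$ is the Poisson boundary of the pair $(G,\mu)$.
   Context: Random walks. The (right) random walk $(G,\mu)$ is the Markov chain on $G$ with transition probabilities $p(x,y)=\mu(x^{-1}y)$; thus $x_n=x_0h_1h_2\cdots h_n$ with independent $\mu$-distributed increments $h_i$. $G^{\mathbb{Z}_+}$ is the space of sample paths $\boldsymbol{x}=\{x_n\}_{n\ge 0}$, on which $G$ acts coordinatewise from the left. $\mathbf{P}_\theta$ is the Markov measure on $G^{\mathbb{Z}_+}$ with initial distribution $\theta$; $\mathbf{P}=\mathbf{P}_{\delta_e}$; $m$ is the counting measure on $G$; $T$ is the time shift $\{x_n\}\mapsto\{x_{n+1}\}$. The Poisson boundary $\Gamma$ is the space of ergodic components of $T$ in the Lebesgue space $(G^{\mathbb{Z}_+},\mathbf{P}_m)$: there is a projection $\mathrm{bnd}:G^{\mathbb{Z}_+}\to\Gamma$ such that the $\sigma$-algebra of $T$-invariant measurable sets coincides (mod 0) with the $\sigma$-algebra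 of $\mathrm{bnd}$-preimages of measurable subsets of $\Gamma$. The $G$-action descends to $\Gamma$, and $\Gamma$ is endowed with the harmonic measure $\nu=\mathrm{bnd}(\mathbf{P})$. A $\mu$-boundary $(B,\lambda)\cong(\Gamma_\xi,\nu_\xi)$ is the quotient of $(\Gamma,\nu)$ by a $G$-invariant measurable partition $\xi$; $\Pi=\mathrm{bnd}_\xi:(G^{\mathbb{Z}_+},\mathbf{P})\to(\Gamma,\nu)\to(B,\lambda)$ is the canonical projection. A $\mu$-boundary "is the Poisson boundary" (is maximal) if the quotient map $(\Gamma,\nu)\to(B,\lambda)$ is an isomorphism mod 0. Gauges. A gauge on $G$ is an increasing sequence $\mathcal{G}=(\mathcal{G}_k)_{k\ge1}$ of subsets exhausting $G$; its gauge function is $|g|_{\mathcal{G}}=\min\{k:g\in\mathcal{G}_k\}$. A gauge is finite if all $\mathcal{G}_k$ are finite, and temperate if it is finite and $\sup_k\frac1k\log\operatorname{card}\mathcal{G}_k<\infty$. *)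

theory Defs
  imports "HOL-Probability.Probability" "HOL-Algebra.Group_Action"
begin

section \<open>Random walks on a countable group\<close>

text \<open>
  A probability measure on a countable group \<open>G\<close> is a probability space \<open>\<mu>\<close> with
  \<open>sets \<mu> = Pow (carrier G)\<close>.
\<close>

definition finite_entropy :: "'a measure \<Rightarrow> bool" where
  "finite_entropy \<mu> \<longleftrightarrow>
     (\<lambda>g. - (measure \<mu> {g} * ln (measure \<mu> {g}))) summable_on space \<mu>"

definition path_space :: "('a, 'm) monoid_scheme \<Rightarrow> (nat \<Rightarrow> 'a) measure" where
  "path_space G = (\<Pi>\<^sub>M n\<in>UNIV. count_space (carrier G))"

text \<open>The increment \<open>h\<^sub>n\<close> of the walk, \<open>n \<ge> 1\<close>, is stored as \<open>h (n - 1)\<close>.\<close>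

primrec walk :: "('a, 'm) monoid_scheme \<Rightarrow> 'a \<Rightarrow> (nat \<Rightarrow> 'a) \<Rightarrow> nat \<Rightarrow> 'a" where
  "walk G x h 0 = x"
| "walk G x h (Suc n) = walk G x h n \<otimes>\<^bsub>G\<^esub> h n"

text \<open>The initial distribution \<open>\<theta>\<close> need not be finite.\<close>

definition markov_measure ::
    "('a, 'm) monoid_scheme \<Rightarrow> 'a measure \<Rightarrow> 'a measure \<Rightarrow> (nat \<Rightarrow> 'a) measure" where
  "markov_measure G \<mu> \<theta> =
     distr (\<theta> \<Otimes>\<^sub>M (\<Pi>\<^sub>M n\<in>(UNIV :: nat set). \<mu>)) (path_space G) (\<lambda>(x, h). walk G x h)"

definition path_measure :: "('a, 'm) monoid_scheme \<Rightarrow> 'a measure \<Rightarrow> (nat \<Rightarrow> 'a) measure" where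
  "path_measure G \<mu> = markov_measure G \<mu> (return (count_space (carrier G)) \<one>\<^bsub>G\<^esub>)"

definition path_measure_counting ::
    "('a, 'm) monoid_scheme \<Rightarrow> 'a measure \<Rightarrow> (nat \<Rightarrow> 'a) measure" where
  "path_measure_counting G \<mu> = markov_measure G \<mu> (count_space (carrier G))"

definition time_shift :: "(nat \<Rightarrow> 'a) \<Rightarrow> nat \<Rightarrow> 'a" where
  "time_shift x = (\<lambda>n. x (Suc n))"

definition translate :: "('a, 'm) monoid_scheme \<Rightarrow> 'a \<Rightarrow> (nat \<Rightarrow> 'a) \<Rightarrow> nat \<Rightarrow> 'a" where
  "translate G g x = (\<lambda>n. g \<otimes>\<^bsub>G\<^esub> x n)"

definition shift_invariant_sets :: "('a, 'm) monoid_scheme \<Rightarrow> (nat \<Rightarrow> 'a) set set" where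
  "shift_invariant_sets G =
     {A \<in> sets (path_space G). time_shift -` A \<inter> space (path_space G) = A}"


section \<open>Lebesgue spaces\<close>

text \<open>
  Isomorphism mod 0: a bijection between conull subsets which, together with its inverse, is
  measurable and measure preserving. As usual for Lebesgue spaces, measurability refers to the
  completed \<open>\<sigma>\<close>-algebras, so it does not matter whether \<open>M\<close> and \<open>N\<close> are complete. The values
  of \<open>f\<close> outside the conull set \<open>M\<^sub>0\<close> are irrelevant.
\<close>

definition iso_mod0 :: "'a measure \<Rightarrow> 'b measure \<Rightarrow> ('a \<Rightarrow> 'b) \<Rightarrow> bool" where
  "iso_mod0 M N f \<longleftrightarrow>
     (\<exists>M\<^sub>0 N\<^sub>0. M\<^sub>0 \<subseteq> space M \<and> space M - M\<^sub>0 \<in> null_sets (completion M) \<and>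
              N\<^sub>0 \<subseteq> space N \<and> space N - N\<^sub>0 \<in> null_sets (completion N) \<and>
              bij_betw f M\<^sub>0 N\<^sub>0 \<and>
              f \<in> restrict_space (completion M) M\<^sub>0 \<rightarrow>\<^sub>M restrict_space (completion N) N\<^sub>0 \<and>
              inv_into M\<^sub>0 f \<in> restrict_space (completion N) N\<^sub>0 \<rightarrow>\<^sub>M restrict_space (completion M) M\<^sub>0 \<and>
              distr (restrict_space (completion M) M\<^sub>0) (restrict_space (completion N) N\<^sub>0) f
                = restrict_space (completion N) N\<^sub>0)"

text \<open>Standard Borel spaces, as the Borel subsets of the real line up to Borel isomorphism.\<close>

definition standard_borel :: "'a measure \<Rightarrow> bool" where
  "standard_borel M \<longleftrightarrow>
     (\<exists>A \<in> sets (borel :: real measure). \<exists>f g.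
        f \<in> M \<rightarrow>\<^sub>M restrict_space borel A \<and> g \<in> restrict_space borel A \<rightarrow>\<^sub>M M \<and>
        (\<forall>x \<in> space M. g (f x) = x) \<and> (\<forall>y \<in> A. f (g y) = y))"

text \<open>
  Measurable partitions in the sense of Rokhlin: there is a countable basis, i.e. a sequence of
  measurable unions of elements of the partition separating any two of its elements.
\<close>

definition measurable_partition :: "'a measure \<Rightarrow> 'a set set \<Rightarrow> bool" where
  "measurable_partition M \<xi> \<longleftrightarrow> partition_on (space M) \<xi> \<and>
     (\<exists>A :: nat \<Rightarrow> 'a set.
        (\<forall>i. A i \<in> sets M \<and> (\<exists>U \<subseteq> \<xi>. A i = \<Union>U)) \<and>
        (\<forall>C \<in> \<xi>. \<forall>D \<in> \<xi>. C \<noteq> D \<longrightarrow>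
           (\<exists>i. (C \<subseteq> A i \<and> \<not> D \<subseteq> A i) \<or> (\<not> C \<subseteq> A i \<and> D \<subseteq> A i))))"

definition quotient_map :: "'a set set \<Rightarrow> 'a \<Rightarrow> 'a set" where
  "quotient_map \<xi> x = (THE C. C \<in> \<xi> \<and> x \<in> C)"

definition quotient_measure :: "'a measure \<Rightarrow> 'a set set \<Rightarrow> 'a set measure" where
  "quotient_measure M \<xi> =
     distr M (sigma \<xi> {U. U \<subseteq> \<xi> \<and> \<Union>U \<in> sets M}) (quotient_map \<xi>)"


section \<open>The Poisson boundary and its quotients\<close>

text \<open>
  The space of ergodic components of the time shift is determined only mod 0, by the property
  that its measurable sets correspond to the shift-invariant ones. It is represented
  here by an arbitrary standard Borel model \<open>\<Gamma>\<close> with an action of the countable group \<open>G\<close>.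
  Only the \<open>\<sigma>\<close>-algebra of \<open>\<Gamma>\<close> is used, not its measure; ``mod 0'' refers to the counting
  initial distribution.
\<close>

definition poisson_boundary ::
    "('a, 'm) monoid_scheme \<Rightarrow> 'a measure \<Rightarrow> 'c measure \<Rightarrow> ('a \<Rightarrow> 'c \<Rightarrow> 'c) \<Rightarrow>
     ((nat \<Rightarrow> 'a) \<Rightarrow> 'c) \<Rightarrow> bool" where
  "poisson_boundary G \<mu> \<Gamma> act bnd \<longleftrightarrow>
     standard_borel \<Gamma> \<and>
     bnd \<in> path_space G \<rightarrow>\<^sub>M \<Gamma> \<and>
     (\<forall>A \<in> shift_invariant_sets G. \<exists>C \<in> sets \<Gamma>.
        sym_diff A (bnd -` C \<inter> space (path_space G)) \<in> null_sets (path_measure_counting G \<mu>)) \<and>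
     (\<forall>C \<in> sets \<Gamma>. \<exists>A \<in> shift_invariant_sets G.
        sym_diff A (bnd -` C \<inter> space (path_space G)) \<in> null_sets (path_measure_counting G \<mu>)) \<and>
     group_action G (space \<Gamma>) act \<and>
     (\<forall>g \<in> carrier G. act g \<in> \<Gamma> \<rightarrow>\<^sub>M \<Gamma> \<and>
        (AE x in path_measure_counting G \<mu>. bnd (translate G g x) = act g (bnd x)))"

definition harmonic_measure ::
    "('a, 'm) monoid_scheme \<Rightarrow> 'a measure \<Rightarrow> 'c measure \<Rightarrow> ((nat \<Rightarrow> 'a) \<Rightarrow> 'c) \<Rightarrow> 'c measure" where
  "harmonic_measure G \<mu> \<Gamma> bnd = distr (path_measure G \<mu>) \<Gamma> bnd"

definition invariant_partition ::
    "('a, 'm) monoid_scheme \<Rightarrow> ('a \<Rightarrow> 'c \<Rightarrow> 'c) \<Rightarrow> 'c set set \<Rightarrow> bool" where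
  "invariant_partition G act \<xi> \<longleftrightarrow> (\<forall>g \<in> carrier G. \<forall>C \<in> \<xi>. act g ` C \<in> \<xi>)"

text \<open>
  A \<open>\<mu>\<close>-boundary \<open>B\<close> (including its measure \<open>\<lambda>\<close>) is identified by the isomorphism mod 0 \<open>\<phi>\<close>
  with the quotient of the Poisson boundary by \<open>\<xi>\<close>. Asking for a Borel partition that is
  invariant everywhere is no restriction: since \<open>G\<close> is countable, a partition which has these
  properties only mod 0 acquires them after a change on a \<open>G\<close>-invariant null set, and this does
  not affect the quotient mod 0.
\<close>

definition mu_boundary ::
    "('a, 'm) monoid_scheme \<Rightarrow> 'a measure \<Rightarrow> 'c measure \<Rightarrow> ('a \<Rightarrow> 'c \<Rightarrow> 'c) \<Rightarrow>
     ((nat \<Rightarrow> 'a) \<Rightarrow> 'c) \<Rightarrow> 'c set set \<Rightarrow> ('c set \<Rightarrow> 'b) \<Rightarrow> 'b measure \<Rightarrow> bool" where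
  "mu_boundary G \<mu> \<Gamma> act bnd \<xi> \<phi> B \<longleftrightarrow>
     measurable_partition \<Gamma> \<xi> \<and> invariant_partition G act \<xi> \<and>
     iso_mod0 (quotient_measure (harmonic_measure G \<mu> \<Gamma> bnd) \<xi>) B \<phi>"

definition boundary_quotient :: "'c set set \<Rightarrow> ('c set \<Rightarrow> 'b) \<Rightarrow> 'c \<Rightarrow> 'b" where
  "boundary_quotient \<xi> \<phi> = \<phi> \<circ> quotient_map \<xi>"

definition boundary_projection ::
    "((nat \<Rightarrow> 'a) \<Rightarrow> 'c) \<Rightarrow> 'c set set \<Rightarrow> ('c set \<Rightarrow> 'b) \<Rightarrow> (nat \<Rightarrow> 'a) \<Rightarrow> 'b" where
  "boundary_projection bnd \<xi> \<phi> = boundary_quotient \<xi> \<phi> \<circ> bnd"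

definition is_the_poisson_boundary ::
    "('a, 'm) monoid_scheme \<Rightarrow> 'a measure \<Rightarrow> 'c measure \<Rightarrow> ((nat \<Rightarrow> 'a) \<Rightarrow> 'c) \<Rightarrow>
     'c set set \<Rightarrow> ('c set \<Rightarrow> 'b) \<Rightarrow> 'b measure \<Rightarrow> bool" where
  "is_the_poisson_boundary G \<mu> \<Gamma> bnd \<xi> \<phi> B \<longleftrightarrow>
     iso_mod0 (harmonic_measure G \<mu> \<Gamma> bnd) B (boundary_quotient \<xi> \<phi>)"


section \<open>Gauges\<close>

text \<open>Gauges are indexed by \<open>k \<ge> 1\<close>; the set \<open>\<G> 0\<close> plays no role.\<close>

definition gauge_on :: "('a, 'm) monoid_scheme \<Rightarrow> (nat \<Rightarrow> 'a set) \<Rightarrow> bool" where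
  "gauge_on G \<G> \<longleftrightarrow> mono_on {1..} \<G> \<and> (\<Union>k\<in>{1..}. \<G> k) = carrier G"

definition gauge_function :: "(nat \<Rightarrow> 'a set) \<Rightarrow> 'a \<Rightarrow> nat" where
  "gauge_function \<G> g = (LEAST k. 1 \<le> k \<and> g \<in> \<G> k)"

definition finite_gauge :: "('a, 'm) monoid_scheme \<Rightarrow> (nat \<Rightarrow> 'a set) \<Rightarrow> bool" where
  "finite_gauge G \<G> \<longleftrightarrow> gauge_on G \<G> \<and> (\<forall>k\<ge>1. finite (\<G> k))"

definition temperate_gauge :: "('a, 'm) monoid_scheme \<Rightarrow> (nat \<Rightarrow> 'a set) \<Rightarrow> bool" where
  "temperate_gauge G \<G> \<longleftrightarrow> finite_gauge G \<G> \<and>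
     bdd_above ((\<lambda>k. ln (real (card (\<G> k))) / real k) ` {1..})"

end

theory Submission
  imports Defs
begin

text \<open>
  Write \<open>x\<^sub>n\<close> for the walk, \<open>\<nu>\<close> for the harmonic measure on \<open>\<Gamma>\<close>, and let \<open>q\<close> map \<open>\<Gamma>\<close> to its
  quotient by \<open>\<xi>\<close>. The translate \<open>g\<nu>\<close> of \<open>\<nu>\<close> by a reachable \<open>g\<close> has a density \<open>u\<^sub>g\<close> with respect to
  \<open>\<nu>\<close>, and its image in the quotient has a density \<open>v\<^sub>g\<close>. By Bayes' rule \<open>\<mu>\<^sup>n(g) u\<^sub>g\<close> and \<open>\<mu>\<^sup>n(g) v\<^sub>g\<close> are
  the conditional probabilities of \<open>x\<^sub>n = g\<close> given the limit point of the walk in \<open>\<Gamma>\<close>, respectively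
  in the quotient. The proof compares the two through \<open>L\<^sub>n = ln (u / v)\<close>, taken at \<open>x\<^sub>n\<close> and the limit
  point.

  The chain rule for the densities makes \<open>L\<^sub>n\<close> a sum of \<open>n\<close> terms of a stationary sequence, so its mean
  is \<open>n\<close> times the mean of \<open>L\<^sub>1\<close>, the entropy gap (\<open>log_ratio_integral\<close>). On the other hand
  \<open>\<mu>\<^sup>n(g) u\<^sub>g \<le> 1\<close>, so \<open>L\<^sub>n\<close> is at most minus the logarithm of the conditional probability of \<open>x\<^sub>n\<close>
  given the point of the quotient, and by Gibbs' inequality the mean of the latter only grows when this
  conditional probability is replaced by any other kernel from the quotient to \<open>G\<close>
  (\<open>entropy_gap_le\<close>). The kernel to take is half the uniform distribution on the
  gauge ball of radius \<open>\<epsilon>n\<close> around the point predicted by \<open>\<pi>\<^sub>n\<close>, plus half of \<open>\<mu>\<^sup>n\<close>. If the ball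
  contains \<open>x\<^sub>n\<close>, the cost is at most \<open>ln 2\<close> plus the logarithm of the size of the ball, which is of order
  \<open>\<epsilon>n\<close> because the gauge is temperate. Otherwise it is at most \<open>ln 2\<close> plus the information contained
  in the first \<open>n\<close> steps, which is a sum of \<open>n\<close> integrable terms with the same law. As the
  probability of the second case tends to \<open>0\<close>, its contribution is \<open>o(n)\<close>. Hence the entropy gap is at most
  \<open>0\<close> (\<open>entropy_gap_nonpos\<close>).

  The equality case of \<open>ln t \<le> t - 1\<close> then gives \<open>u\<^sub>g = v\<^sub>g \<circ> q\<close> for all reachable \<open>g\<close>. So the
  conditional probability, given the limit point in \<open>\<Gamma>\<close>, of an event that depends on finitely many increments is
  a function of the point of the quotient alone. This extends to all events by the \<open>\<pi>\<close>-\<open>\<lambda>\<close> theorem, in particular to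
  the events determined by the limit point itself, whose conditional probabilities are their indicators:
  every measurable subset of \<open>\<Gamma>\<close> agrees mod 0 with a union of elements of \<open>\<xi>\<close>
  (\<open>boundary_event_is_factor_event\<close>). For a standard Borel space and a measurable
  partition this means that \<open>q\<close> is an isomorphism mod 0 (\<open>iso_mod0_quotient_map\<close>), and it remains to
  compose it with \<open>\<phi>\<close>.
\<close>

section \<open>The increments of a random walk\<close>

lemma funpow_time_shift: "(time_shift ^^ n) h = (\<lambda>i. h (i + n))"
  by (induction n arbitrary: h) (auto simp: time_shift_def)

locale random_walk = group G for G :: "('a, 'm) monoid_scheme" (structure) +
  fixes \<mu> :: "'a measure"
  assumes countable_carrier: "countable (carrier G)"
    and prob_space_step: "prob_space \<mu>"
    and sets_step: "sets \<mu> = Pow (carrier G)"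
begin

definition increments :: "(nat \<Rightarrow> 'a) measure" where
  "increments = (\<Pi>\<^sub>M n\<in>UNIV. \<mu>)"

definition position :: "nat \<Rightarrow> (nat \<Rightarrow> 'a) \<Rightarrow> 'a" where
  "position n h = walk G \<one> h n"

sublocale step: prob_space \<mu> by (rule prob_space_step)

sublocale incr: prob_space increments
  unfolding increments_def by (rule prob_space_PiM) (rule prob_space_step)

lemma space_step [simp]: "space \<mu> = carrier G"
  using sets_eq_imp_space_eq[of \<mu> "count_space (carrier G)"] sets_step by simp

lemma space_increments: "space increments = {h. \<forall>n. h n \<in> carrier G}"
  by (auto simp: increments_def space_PiM)

lemma measurable_into_step: "measurable M \<mu> = measurable M (count_space (carrier G))"
  by (rule measurable_cong_sets) (simp_all add: sets_step)

lemma measurable_increment [measurable]: "(\<lambda>h. h n) \<in> increments \<rightarrow>\<^sub>M count_space (carrier G)"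
  unfolding increments_def measurable_into_step[symmetric] by measurable

lemma increment_in_carrier [simp]: "h \<in> space increments \<Longrightarrow> h n \<in> carrier G"
  by (auto simp: space_increments)

lemma walk_in_carrier: "x \<in> carrier G \<Longrightarrow> h \<in> space increments \<Longrightarrow> walk G x h n \<in> carrier G"
  by (induction n) auto

lemma position_in_carrier [simp]: "h \<in> space increments \<Longrightarrow> position n h \<in> carrier G"
  by (simp add: position_def walk_in_carrier)

lemma walk_eq_position:
  assumes "x \<in> carrier G" "h \<in> space increments"
  shows "walk G x h n = x \<otimes> position n h"
  using assms unfolding position_def
  by (induction n) (auto simp: m_assoc walk_in_carrier)

lemma walk_Suc_shift: "walk G x h (Suc n) = walk G (x \<otimes> h 0) (time_shift h) n"
  by (induction n) (auto simp: time_shift_def)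

lemma time_shift_in_space [simp]: "h \<in> space increments \<Longrightarrow> time_shift h \<in> space increments"
  by (auto simp: space_increments time_shift_def simp del: increment_in_carrier)

lemma funpow_time_shift_in_space [simp]:
  "h \<in> space increments \<Longrightarrow> (time_shift ^^ n) h \<in> space increments"
  by (auto simp: space_increments funpow_time_shift simp del: increment_in_carrier)

lemma position_0 [simp]: "position 0 h = \<one>"
  by (simp add: position_def)

lemma position_1 [simp]: "h \<in> space increments \<Longrightarrow> position (Suc 0) h = h 0"
  by (simp add: position_def)

lemma position_Suc:
  assumes "h \<in> space increments"
  shows "position (Suc n) h = h 0 \<otimes> position n (time_shift h)"
  using assms walk_Suc_shift[of \<one> h n] walk_eq_position[of "h 0" "time_shift h" n]
  by (simp add: position_def)

lemma position_cong: "(\<And>i. i < n \<Longrightarrow> h i = h' i) \<Longrightarrow> position n h = position n h'"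
  unfolding position_def by (induction n) auto

lemma measurable_mult_count_space:
  "(\<lambda>(g, h). g \<otimes> h) \<in> count_space (carrier G) \<Otimes>\<^sub>M count_space (carrier G) \<rightarrow>\<^sub>M count_space (carrier G)"
  by (simp add: pair_measure_countable countable_carrier) auto

lemma measurable_mult [measurable (raw)]:
  assumes "f \<in> M \<rightarrow>\<^sub>M count_space (carrier G)" "g \<in> M \<rightarrow>\<^sub>M count_space (carrier G)"
  shows "(\<lambda>x. f x \<otimes> g x) \<in> M \<rightarrow>\<^sub>M count_space (carrier G)"
  using measurable_compose[OF measurable_Pair[OF assms] measurable_mult_count_space] by simp

lemma measurable_inv [measurable (raw)]:
  assumes [measurable]: "f \<in> M \<rightarrow>\<^sub>M count_space (carrier G)"
  shows "(\<lambda>x. inv (f x)) \<in> M \<rightarrow>\<^sub>M count_space (carrier G)"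
proof -
  have [measurable]: "m_inv G \<in> count_space (carrier G) \<rightarrow>\<^sub>M count_space (carrier G)" by simp
  show ?thesis by measurable
qed

lemma measurable_position [measurable]: "position n \<in> increments \<rightarrow>\<^sub>M count_space (carrier G)"
proof (induction n)
  case (Suc n)
  have "position (Suc n) = (\<lambda>h. position n h \<otimes> h n)" by (simp add: position_def fun_eq_iff)
  with Suc show ?case by simp
qed (simp add: position_0[abs_def])

lemma measurable_time_shift [measurable]: "time_shift \<in> increments \<rightarrow>\<^sub>M increments"
  unfolding time_shift_def increments_def by (rule measurable_PiM_single') (auto simp: space_PiM)

lemma measurable_funpow_time_shift [measurable]: "time_shift ^^ n \<in> increments \<rightarrow>\<^sub>M increments"
  by (induction n) (auto simp: o_def)

lemma measurable_comb_seq_increments [measurable]: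
  "(\<lambda>(h, h'). comb_seq n h h') \<in> increments \<Otimes>\<^sub>M increments \<rightarrow>\<^sub>M increments"
  unfolding increments_def by (rule measurable_comb_seq)

lemma distr_comb_seq:
  "distr (increments \<Otimes>\<^sub>M increments) increments (\<lambda>(h, h'). comb_seq n h h') = increments"
proof -
  interpret sequence_space \<mu> by unfold_locales
  show ?thesis unfolding increments_def by (rule PiM_comb_seq)
qed

lemma funpow_time_shift_comb_seq: "(time_shift ^^ n) (comb_seq n h h') = h'"
  by (simp add: funpow_time_shift comb_seq_def)

lemma position_comb_seq: "position n (comb_seq n h h') = position n h"
  by (rule position_cong) (simp add: comb_seq_def)

text \<open>
  Splicing the first \<open>n\<close> increments of one path to an independent path does not change the law of
  the path. In this form the independence of past and future is used below.
\<close>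

lemma nn_integral_comb_seq:
  assumes "F \<in> borel_measurable increments"
  shows "(\<integral>\<^sup>+ h. F h \<partial>increments) =
    (\<integral>\<^sup>+ h. \<integral>\<^sup>+ h'. F (comb_seq n h h') \<partial>increments \<partial>increments)"
proof -
  note assms [measurable]
  have "(\<integral>\<^sup>+ h. F h \<partial>increments) = (\<integral>\<^sup>+ h. F h \<partial>distr (increments \<Otimes>\<^sub>M increments) increments (\<lambda>(h, h'). comb_seq n h h'))"
    by (simp only: distr_comb_seq)
  also have "\<dots> = (\<integral>\<^sup>+ p. F (comb_seq n (fst p) (snd p)) \<partial>(increments \<Otimes>\<^sub>M increments))"
    by (subst nn_integral_distr) (auto simp: case_prod_beta)
  also have "\<dots> = (\<integral>\<^sup>+ h. \<integral>\<^sup>+ h'. F (comb_seq n h h') \<partial>increments \<partial>increments)"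
    by (subst incr.nn_integral_fst[symmetric]) (auto simp: case_prod_beta)
  finally show ?thesis .
qed

lemma distr_funpow_time_shift: "distr increments increments (time_shift ^^ n) = increments"
proof (rule measure_eqI)
  fix A assume "A \<in> sets (distr increments increments (time_shift ^^ n))"
  then have [measurable]: "A \<in> sets increments" by simp
  have "emeasure (distr increments increments (time_shift ^^ n)) A =
      (\<integral>\<^sup>+ h. indicator A h \<partial>distr increments increments (time_shift ^^ n))"
    by simp
  also have "\<dots> = (\<integral>\<^sup>+ h. indicator A ((time_shift ^^ n) h) \<partial>increments)"
    by (rule nn_integral_distr) auto
  also have "\<dots> = (\<integral>\<^sup>+ h. \<integral>\<^sup>+ h'. indicator A ((time_shift ^^ n) (comb_seq n h h')) \<partial>increments \<partial>increments)"
    by (subst nn_integral_comb_seq) auto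
  also have "\<dots> = emeasure increments A"
    by (simp add: funpow_time_shift_comb_seq incr.emeasure_space_1)
  finally show "emeasure (distr increments increments (time_shift ^^ n)) A = emeasure increments A" .
qed simp

lemma distr_time_shift: "distr increments increments time_shift = increments"
  using distr_funpow_time_shift[of 1] by simp

lemma AE_funpow_time_shift: "AE h in increments. P h \<Longrightarrow> AE h in increments. P ((time_shift ^^ n) h)"
  by (rule AE_distrD[of "time_shift ^^ n" increments increments])
     (simp, simp only: distr_funpow_time_shift)

lemma AE_time_shift: "AE h in increments. P h \<Longrightarrow> AE h in increments. P (time_shift h)"
  using AE_funpow_time_shift[of P 1] by simp

lemma distr_increment: "distr increments \<mu> (\<lambda>h. h n) = \<mu>"
  unfolding increments_def by (rule distr_PiM_component) (auto simp: prob_space_step)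

lemma AE_step_positive: "AE g in \<mu>. 0 < measure \<mu> {g}"
proof -
  have "AE g in \<mu>. \<forall>g'\<in>{g\<in>carrier G. measure \<mu> {g} = 0}. g \<noteq> g'"
  proof (subst AE_ball_countable)
    show "countable {g\<in>carrier G. measure \<mu> {g} = 0}"
      using countable_carrier by (rule countable_subset[rotated]) auto
    show "\<forall>g'\<in>{g\<in>carrier G. measure \<mu> {g} = 0}. AE g in \<mu>. g \<noteq> g'"
    proof safe
      fix g' assume "g' \<in> carrier G" "measure \<mu> {g'} = 0"
      then have "{g'} \<in> null_sets \<mu>" by (auto simp: null_sets_def sets_step step.emeasure_eq_measure)
      then show "AE g in \<mu>. g \<noteq> g'" by (auto dest: AE_not_in)
    qed
  qed
  then show ?thesis
    by (rule AE_mp) (auto intro!: AE_I2 simp: zero_less_measure_iff)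
qed

lemma AE_increment_positive: "AE h in increments. \<forall>n. 0 < measure \<mu> {h n}"
proof (subst AE_all_countable, rule allI)
  fix n
  show "AE h in increments. 0 < measure \<mu> {h n}"
    by (rule AE_distrD[of "\<lambda>h. h n" increments \<mu>])
       (simp add: measurable_into_step, simp only: distr_increment AE_step_positive)
qed

text \<open>
  The \<open>n\<close>-fold convolution power of \<open>\<mu>\<close>.
\<close>

definition step_power :: "nat \<Rightarrow> 'a \<Rightarrow> real" where
  "step_power n g = measure increments {h \<in> space increments. position n h = g}"

lemma measure_cylinder:
  assumes "h0 \<in> space increments"
  shows "measure increments {h \<in> space increments. \<forall>i<n. h i = h0 i} = (\<Prod>i<n. measure \<mu> {h0 i})"
proof -
  interpret sequence_space \<mu> by unfold_locales
  have "{h \<in> space increments. \<forall>i<n. h i = h0 i} = prod_emb UNIV (\<lambda>_. \<mu>) {..<n} (Pi\<^sub>E {..<n} (\<lambda>i. {h0 i}))"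
    by (auto simp: increments_def space_PiM prod_emb_def PiE_def Pi_iff simp del: increment_in_carrier)
  moreover have "h0 i \<in> carrier G" for i using assms by simp
  ultimately show ?thesis
    by (simp add: increments_def measure_PiM_emb sets_step del: increment_in_carrier)
qed

lemma prod_le_step_power:
  assumes "h \<in> space increments"
  shows "(\<Prod>i<n. measure \<mu> {h i}) \<le> step_power n (position n h)"
  unfolding measure_cylinder[OF assms, symmetric] step_power_def
  by (rule incr.finite_measure_mono) (auto intro: position_cong)

lemma AE_step_power_positive: "AE h in increments. 0 < step_power n (position n h)"
  using AE_increment_positive AE_space
proof eventually_elim
  case (elim h)
  then show ?case
    using prod_le_step_power[of h n] prod_pos[of "{..<n}" "\<lambda>i. measure \<mu> {h i}"] by force
qed

text \<open>
  The walk can reach its position along other paths as well, so the position carries at most the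
  information of the increments.
\<close>

lemma minus_ln_step_power_le:
  assumes "h \<in> space increments" "\<forall>n. 0 < measure \<mu> {h n}"
  shows "- ln (step_power n (position n h)) \<le> (\<Sum>i<n. - ln (measure \<mu> {h i}))"
proof -
  have "ln (\<Prod>i<n. measure \<mu> {h i}) \<le> ln (step_power n (position n h))"
    using assms prod_le_step_power[of h n] prod_pos[of "{..<n}" "\<lambda>i. measure \<mu> {h i}"]
    by (subst ln_le_cancel_iff) (auto intro: less_le_trans)
  moreover have "ln (\<Prod>i<n. measure \<mu> {h i}) = (\<Sum>i<n. ln (measure \<mu> {h i}))"
    using assms by (subst ln_prod) (auto simp: less_le)
  ultimately show ?thesis by (simp add: sum_negf)
qed

text \<open>
  Weighing each position by the inverse of its probability turns the law of the walk at time \<open>n\<close> into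
  the counting measure on its support.
\<close>

lemma nn_integral_inverse_step_power_le:
  assumes "finite A" "A \<subseteq> carrier G"
  shows "(\<integral>\<^sup>+ h. ennreal (indicator A (position n h) / step_power n (position n h)) \<partial>increments)
    \<le> of_nat (card A)"
proof -
  have "(\<integral>\<^sup>+ h. ennreal (indicator A (position n h) / step_power n (position n h)) \<partial>increments)
      = (\<integral>\<^sup>+ h. (\<Sum>g\<in>A. ennreal (1 / step_power n g) * indicator {h \<in> space increments. position n h = g} h) \<partial>increments)"
  proof (rule nn_integral_cong)
    fix h assume h: "h \<in> space increments"
    have "(\<Sum>g\<in>A. ennreal (1 / step_power n g) * indicator {h \<in> space increments. position n h = g} h)
       = (\<Sum>g\<in>A. if g = position n h then ennreal (1 / step_power n g) else 0)"
      using h by (intro sum.cong) auto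
    also have "\<dots> = ennreal (indicator A (position n h) / step_power n (position n h))"
      using assms by (simp add: indicator_def)
    finally show "ennreal (indicator A (position n h) / step_power n (position n h)) =
      (\<Sum>g\<in>A. ennreal (1 / step_power n g) * indicator {h \<in> space increments. position n h = g} h)" by simp
  qed
  also have "\<dots> = (\<Sum>g\<in>A. ennreal (1 / step_power n g) * ennreal (step_power n g))"
  proof (subst nn_integral_sum)
    fix g assume "g \<in> A"
    then have [measurable]: "{h \<in> space increments. position n h = g} \<in> sets increments"
      using assms by measurable
    show "(\<lambda>h. ennreal (1 / step_power n g) * indicator {h \<in> space increments. position n h = g} h) \<in> borel_measurable increments"
      by measurable
  next
    show "(\<Sum>g\<in>A. \<integral>\<^sup>+ h. ennreal (1 / step_power n g) * indicator {h \<in> space increments. position n h = g} h \<partial>increments)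
     = (\<Sum>g\<in>A. ennreal (1 / step_power n g) * ennreal (step_power n g))"
    proof (intro sum.cong refl)
      fix g assume "g \<in> A"
      then have [measurable]: "{h \<in> space increments. position n h = g} \<in> sets increments"
        using assms by measurable
      show "(\<integral>\<^sup>+ h. ennreal (1 / step_power n g) * indicator {h \<in> space increments. position n h = g} h \<partial>increments)
         = ennreal (1 / step_power n g) * ennreal (step_power n g)"
        by (subst nn_integral_cmult_indicator) (auto simp: step_power_def incr.emeasure_eq_measure)
    qed
  qed
  also have "\<dots> \<le> (\<Sum>g\<in>A. 1)"
    by (intro sum_mono) (simp add: ennreal_mult'[symmetric] step_power_def)
  finally show ?thesis by simp
qed

end

section \<open>Harmonic measures and their translates\<close>

text \<open>
  What is used of the Poisson boundary and of its quotients: a measurable \<open>G\<close>-space together with a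
  limit map \<open>\<beta>\<close>. The last assumption says that the walk which starts after the first step has, up to translation by
  that step, the same limit; it combines the shift invariance and the equivariance of the limit map.
\<close>

locale walk_boundary = random_walk G \<mu>
  for G :: "('a, 'm) monoid_scheme" (structure) and \<mu> +
  fixes M :: "'c measure" and act :: "'a \<Rightarrow> 'c \<Rightarrow> 'c" and \<beta> :: "(nat \<Rightarrow> 'a) \<Rightarrow> 'c"
  assumes measurable_boundary [measurable]: "\<beta> \<in> increments \<rightarrow>\<^sub>M M"
    and measurable_act: "g \<in> carrier G \<Longrightarrow> act g \<in> M \<rightarrow>\<^sub>M M"
    and act_one: "c \<in> space M \<Longrightarrow> act \<one> c = c"
    and act_mult: "g \<in> carrier G \<Longrightarrow> k \<in> carrier G \<Longrightarrow> c \<in> space M \<Longrightarrow> act (g \<otimes> k) c = act g (act k c)"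
    and boundary_shift: "AE h in increments. \<beta> h = act (h 0) (\<beta> (time_shift h))"
begin

definition harmonic :: "'c measure" where
  "harmonic = distr increments M \<beta>"

lemma sets_harmonic [measurable_cong, simp]: "sets harmonic = sets M"
  by (simp add: harmonic_def)

lemma space_harmonic [simp]: "space harmonic = space M"
  by (simp add: harmonic_def)

sublocale harm: prob_space harmonic
  unfolding harmonic_def by (rule incr.prob_space_distr) simp

lemma boundary_in_space [simp]: "h \<in> space increments \<Longrightarrow> \<beta> h \<in> space M"
  using measurable_space[OF measurable_boundary] .

lemma act_in_space: "g \<in> carrier G \<Longrightarrow> c \<in> space M \<Longrightarrow> act g c \<in> space M"
  using measurable_space[OF measurable_act] .

lemma act_inv_act: "g \<in> carrier G \<Longrightarrow> c \<in> space M \<Longrightarrow> act (inv g) (act g c) = c"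
  by (simp flip: act_mult add: act_one)

lemma measurable_act_pair [measurable]: "(\<lambda>(g, c). act g c) \<in> count_space (carrier G) \<Otimes>\<^sub>M M \<rightarrow>\<^sub>M M"
  by (rule measurable_pair_measure_countable1) (auto simp: countable_carrier measurable_act)

lemma boundary_funpow_shift:
  "AE h in increments. \<beta> h = act (position n h) (\<beta> ((time_shift ^^ n) h))"
proof (induction n)
  case 0
  show ?case using AE_space by eventually_elim (simp add: act_one)
next
  case (Suc n)
  show ?case using Suc AE_funpow_time_shift[OF boundary_shift, of n] AE_space
  proof eventually_elim
    case (elim h)
    have "position (Suc n) h = position n h \<otimes> h n" by (simp add: position_def)
    moreover have "(time_shift ^^ n) h 0 = h n" by (simp add: funpow_time_shift)
    ultimately show ?case
      using elim by (simp add: act_mult)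
  qed
qed

lemma AE_boundary: "AE c in harmonic. P c \<Longrightarrow> AE h in increments. P (\<beta> h)"
  unfolding harmonic_def by (rule AE_distrD[OF measurable_boundary])

text \<open>
  The limit point is the translate, by the position at time \<open>n\<close>, of the limit point of the walk that
  starts afresh at that time; the latter does not depend on the first \<open>n\<close> increments and is distributed
  according to the harmonic measure.
\<close>

lemma nn_integral_past_boundary:
  assumes F [measurable]: "case_prod F \<in> borel_measurable (increments \<Otimes>\<^sub>M M)"
    and past: "\<And>h h' c. (\<And>i. i < n \<Longrightarrow> h i = h' i) \<Longrightarrow> F h c = F h' c"
  shows "(\<integral>\<^sup>+ h. F h (\<beta> h) \<partial>increments) =
    (\<integral>\<^sup>+ h. \<integral>\<^sup>+ c. F h (act (position n h) c) \<partial>harmonic \<partial>increments)"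
proof -
  have "(\<integral>\<^sup>+ h. F h (\<beta> h) \<partial>increments) =
      (\<integral>\<^sup>+ h. F h (act (position n h) (\<beta> ((time_shift ^^ n) h))) \<partial>increments)"
    by (rule nn_integral_cong_AE) (use boundary_funpow_shift[of n] in eventually_elim, simp)
  also have "\<dots> = (\<integral>\<^sup>+ h. \<integral>\<^sup>+ h'. F (comb_seq n h h') (act (position n (comb_seq n h h'))
      (\<beta> ((time_shift ^^ n) (comb_seq n h h')))) \<partial>increments \<partial>increments)"
    by (rule nn_integral_comb_seq) measurable
  also have "\<dots> = (\<integral>\<^sup>+ h. \<integral>\<^sup>+ h'. F h (act (position n h) (\<beta> h')) \<partial>increments \<partial>increments)"
    by (intro nn_integral_cong, subst past)
       (auto simp: comb_seq_def funpow_time_shift_comb_seq position_comb_seq)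
  also have "\<dots> = (\<integral>\<^sup>+ h. \<integral>\<^sup>+ c. F h (act (position n h) c) \<partial>harmonic \<partial>increments)"
    unfolding harmonic_def by (intro nn_integral_cong, subst nn_integral_distr) measurable
  finally show ?thesis .
qed

text \<open>
  The elements of \<open>G\<close> whose translation of the harmonic measure is given by a density. They form a
  submonoid which the walk almost surely never leaves.
\<close>

definition quasi_invariant :: "'a \<Rightarrow> bool" where
  "quasi_invariant g \<longleftrightarrow> g \<in> carrier G \<and>
     absolutely_continuous harmonic (distr harmonic M (act g))"

lemma quasi_invariant_carrier: "quasi_invariant g \<Longrightarrow> g \<in> carrier G"
  by (simp add: quasi_invariant_def)

lemma measurable_act_harmonic: "g \<in> carrier G \<Longrightarrow> act g \<in> harmonic \<rightarrow>\<^sub>M M"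
  using measurable_act by simp

lemma quasi_invariant_AE:
  assumes "quasi_invariant g" "AE c in harmonic. P c"
  shows "AE c in harmonic. P (act g c)"
proof (rule AE_distrD[where M = harmonic and M' = M])
  show "act g \<in> harmonic \<rightarrow>\<^sub>M M"
    using assms by (simp add: measurable_act quasi_invariant_carrier)
  show "AE c in distr harmonic M (act g). P c"
    using assms by (intro absolutely_continuous_AE[of "distr harmonic M (act g)" harmonic])
      (auto simp: quasi_invariant_def)
qed

lemma quasi_invariantI:
  assumes g: "g \<in> carrier G"
    and null: "\<And>A. A \<in> null_sets harmonic \<Longrightarrow> AE c in harmonic. act g c \<notin> A"
  shows "quasi_invariant g"
  unfolding quasi_invariant_def absolutely_continuous_def
proof (intro conjI subsetI g)
  fix A assume A: "A \<in> null_sets harmonic"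
  then have [measurable]: "A \<in> sets M" by auto
  have [measurable]: "act g \<in> harmonic \<rightarrow>\<^sub>M M" using g by (simp add: measurable_act)
  have "AE c in distr harmonic M (act g). c \<notin> A"
    by (subst AE_distr_iff) (use null[OF A] in auto)
  then show "A \<in> null_sets (distr harmonic M (act g))"
    by (subst AE_iff_null_sets) auto
qed

lemma quasi_invariant_mult:
  assumes "quasi_invariant g" "quasi_invariant k"
  shows "quasi_invariant (g \<otimes> k)"
proof (rule quasi_invariantI)
  show gk: "g \<otimes> k \<in> carrier G" using assms by (simp add: quasi_invariant_carrier)
  fix A assume A: "A \<in> null_sets harmonic"
  have "AE c in harmonic. act g (act k c) \<notin> A"
    by (intro quasi_invariant_AE[OF assms(2)] quasi_invariant_AE[OF assms(1)] AE_not_in A)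
  then show "AE c in harmonic. act (g \<otimes> k) c \<notin> A"
    using AE_space by eventually_elim (use assms in \<open>simp add: act_mult quasi_invariant_carrier\<close>)
qed

lemma quasi_invariant_one: "quasi_invariant \<one>"
proof (rule quasi_invariantI)
  fix A assume "A \<in> null_sets harmonic"
  then have "AE c in harmonic. c \<notin> A" by (rule AE_not_in)
  then show "AE c in harmonic. act \<one> c \<notin> A"
    using AE_space by eventually_elim (simp add: act_one)
qed simp

text \<open>
  The harmonic measure is stationary, that is, the \<open>\<mu>\<close>-average of its translates. So a null set is null
  for every translate that has positive weight in this average.
\<close>

lemma quasi_invariant_step:
  assumes g: "g \<in> carrier G" "0 < measure \<mu> {g}"
  shows "quasi_invariant g"
proof (rule quasi_invariantI)
  fix A assume A: "A \<in> null_sets harmonic"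
  then have [measurable]: "A \<in> sets M" by auto
  have "(\<integral>\<^sup>+ h. indicator A (\<beta> h) \<partial>increments) = 0"
  proof (subst nn_integral_0_iff_AE)
    show "AE h in increments. indicator A (\<beta> h) = (0::ennreal)"
      using AE_boundary[OF AE_not_in[OF A]] by eventually_elim simp
  qed measurable
  then have "(\<integral>\<^sup>+ h. \<integral>\<^sup>+ c. indicator A (act (position 1 h) c) \<partial>harmonic \<partial>increments) = 0"
    by (subst (asm) nn_integral_past_boundary[where n = 1]) (simp_all add: case_prod_beta)
  then have "AE h in increments. (\<integral>\<^sup>+ c. indicator A (act (position 1 h) c) \<partial>harmonic) = 0"
    by (subst (asm) nn_integral_0_iff_AE) measurable
  then have ae: "AE h in increments. AE c in harmonic. act (position 1 h) c \<notin> A"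
    using AE_space
  proof eventually_elim
    case (elim h)
    have [measurable]: "act (position 1 h) \<in> harmonic \<rightarrow>\<^sub>M M"
      using elim by (intro measurable_act_harmonic) simp
    have "(\<lambda>c. indicator A (act (position 1 h) c) :: ennreal) \<in> borel_measurable harmonic"
      by measurable
    then show ?case using elim(1)
      by (subst (asm) nn_integral_0_iff_AE) (auto simp: indicator_def split: if_splits)
  qed
  have not_null: "{h \<in> space increments. h 0 = g} \<notin> null_sets increments"
  proof -
    have "emeasure increments {h \<in> space increments. h 0 = g} = emeasure (distr increments \<mu> (\<lambda>h. h 0)) {g}"
      using g by (subst emeasure_distr) (auto simp: measurable_into_step sets_step vimage_def Int_def conj_commute)
    then show ?thesis
      using g by (simp add: distr_increment null_sets_def step.emeasure_eq_measure)
  qed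
  show "AE c in harmonic. act g c \<notin> A"
  proof (rule ccontr)
    assume not_ae: "\<not> (AE c in harmonic. act g c \<notin> A)"
    have "AE h in increments. h 0 \<noteq> g"
      using ae AE_space by eventually_elim (use not_ae in auto)
    then have "{h \<in> space increments. h 0 = g} \<in> null_sets increments"
      using g by (subst AE_iff_null_sets) auto
    with not_null show False by simp
  qed
qed (use g in simp)

lemma AE_quasi_invariant_position: "AE h in increments. \<forall>n. quasi_invariant (position n h)"
  using AE_increment_positive AE_space
proof eventually_elim
  case (elim h)
  show ?case
  proof
    fix n show "quasi_invariant (position n h)"
    proof (induction n)
      case 0
      show ?case by (simp add: quasi_invariant_one)
    next
      case (Suc n)
      have "position (Suc n) h = position n h \<otimes> h n" by (simp add: position_def)
      then show ?case using Suc elim by (simp add: quasi_invariant_mult quasi_invariant_step)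
    qed
  qed
qed

text \<open>
  The Radon--Nikodym derivative of the translated harmonic measure. The value \<open>0\<close> for the other elements
  makes measurability and nonnegativity unconditional.
\<close>

definition translate_density :: "'a \<Rightarrow> 'c \<Rightarrow> real" where
  "translate_density g = (if quasi_invariant g
     then SOME u. u \<in> borel_measurable M \<and> (\<forall>c. 0 \<le> u c) \<and>
            distr harmonic M (act g) = density harmonic (\<lambda>c. ennreal (u c))
     else (\<lambda>_. 0))"

lemma translate_density_ex:
  assumes "quasi_invariant g"
  shows "\<exists>u. u \<in> borel_measurable M \<and> (\<forall>c. 0 \<le> u c) \<and>
            distr harmonic M (act g) = density harmonic (\<lambda>c. ennreal (u c))"
proof -
  have ac: "absolutely_continuous harmonic (distr harmonic M (act g))"
    using assms by (simp add: quasi_invariant_def)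
  have [measurable]: "act g \<in> harmonic \<rightarrow>\<^sub>M M"
    using assms by (simp add: measurable_act quasi_invariant_carrier)
  have "finite_measure (distr harmonic M (act g))"
    by (intro prob_space.finite_measure harm.prob_space_distr) simp
  then obtain u where u: "u \<in> borel_measurable harmonic"
    "AE c in harmonic. RN_deriv harmonic (distr harmonic M (act g)) c = ennreal (u c)" "\<And>c. 0 \<le> u c"
    using harm.real_RN_deriv[OF _ ac] by auto
  note u(1)[measurable]
  have "distr harmonic M (act g) = density harmonic (RN_deriv harmonic (distr harmonic M (act g)))"
    using ac by (simp add: harm.density_RN_deriv)
  also have "\<dots> = density harmonic (\<lambda>c. ennreal (u c))"
    using u by (intro density_cong) auto
  finally have "distr harmonic M (act g) = density harmonic (\<lambda>c. ennreal (u c))" .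
  moreover have "u \<in> borel_measurable M" using u(1) by simp
  ultimately show ?thesis using u(3) by blast
qed

lemma measurable_translate_density [measurable]: "translate_density g \<in> borel_measurable M"
  using someI_ex[OF translate_density_ex] by (auto simp: translate_density_def)

lemma translate_density_nonneg [simp]: "0 \<le> translate_density g c"
  using someI_ex[OF translate_density_ex] by (auto simp: translate_density_def)

lemma distr_act: "quasi_invariant g \<Longrightarrow>
    distr harmonic M (act g) = density harmonic (\<lambda>c. ennreal (translate_density g c))"
  using someI_ex[OF translate_density_ex] by (auto simp: translate_density_def)

lemma nn_integral_act:
  assumes "quasi_invariant g" and [measurable]: "F \<in> borel_measurable M"
  shows "(\<integral>\<^sup>+ c. F (act g c) \<partial>harmonic) = (\<integral>\<^sup>+ c. ennreal (translate_density g c) * F c \<partial>harmonic)"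
proof -
  have "act g \<in> harmonic \<rightarrow>\<^sub>M M"
    using assms by (simp add: measurable_act quasi_invariant_carrier)
  then have "(\<integral>\<^sup>+ c. F (act g c) \<partial>harmonic) = (\<integral>\<^sup>+ c. F c \<partial>distr harmonic M (act g))"
    by (simp add: nn_integral_distr)
  also have "\<dots> = (\<integral>\<^sup>+ c. ennreal (translate_density g c) * F c \<partial>harmonic)"
    unfolding distr_act[OF assms(1)] by (subst nn_integral_density) auto
  finally show ?thesis .
qed

lemma nn_integral_translate_density:
  "quasi_invariant g \<Longrightarrow> (\<integral>\<^sup>+ c. ennreal (translate_density g c) \<partial>harmonic) = 1"
  using nn_integral_act[of g "\<lambda>_. 1"] by (simp add: harm.emeasure_space_1[simplified])

lemma measurable_translate_density_pair [measurable]: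
  "(\<lambda>(g, c). translate_density g c) \<in> borel_measurable (count_space (carrier G) \<Otimes>\<^sub>M M)"
  by (rule measurable_pair_measure_countable1) (auto simp: countable_carrier)

text \<open>
  The chain rule for Radon--Nikodym derivatives. It is stated at translated points, so that both sides are evaluated where the
  limit point of a walk through \<open>g\<close> lies.
\<close>

lemma translate_density_mult:
  assumes g: "quasi_invariant g" and k: "quasi_invariant k"
  shows "AE c in harmonic. translate_density (g \<otimes> k) (act g c) =
    translate_density g (act g c) * translate_density k c"
proof -
  have G [simp]: "g \<in> carrier G" "k \<in> carrier G" using g k by (simp_all add: quasi_invariant_carrier)
  have [measurable]: "act g \<in> M \<rightarrow>\<^sub>M M" "act k \<in> M \<rightarrow>\<^sub>M M" "act (inv g) \<in> M \<rightarrow>\<^sub>M M"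
    by (simp_all add: measurable_act)
  \<comment> \<open>The density of the translate by \<open>g \<otimes> k\<close>, obtained by translating in two steps.\<close>
  let ?w = "\<lambda>c. ennreal (translate_density g c * translate_density k (act (inv g) c))"
  have "density harmonic (\<lambda>c. ennreal (translate_density (g \<otimes> k) c)) = density harmonic ?w"
  proof (rule measure_eqI)
    fix A assume "A \<in> sets (density harmonic (\<lambda>c. ennreal (translate_density (g \<otimes> k) c)))"
    then have [measurable]: "A \<in> sets M" by simp
    have "emeasure (density harmonic (\<lambda>c. ennreal (translate_density (g \<otimes> k) c))) A
        = (\<integral>\<^sup>+ c. indicator A (act (g \<otimes> k) c) \<partial>harmonic)"
      by (subst nn_integral_act) (auto simp: quasi_invariant_mult g k emeasure_density)
    also have "\<dots> = (\<integral>\<^sup>+ c. indicator A (act g (act k c)) \<partial>harmonic)"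
      by (intro nn_integral_cong) (simp add: act_mult)
    also have "\<dots> = (\<integral>\<^sup>+ c. ennreal (translate_density k c) * indicator A (act g c) \<partial>harmonic)"
      by (rule nn_integral_act[OF k]) measurable
    also have "\<dots> = (\<integral>\<^sup>+ c. ennreal (translate_density k (act (inv g) (act g c))) * indicator A (act g c) \<partial>harmonic)"
      by (intro nn_integral_cong) (simp add: act_inv_act)
    also have "\<dots> = (\<integral>\<^sup>+ c. ennreal (translate_density g c) *
        (ennreal (translate_density k (act (inv g) c)) * indicator A c) \<partial>harmonic)"
      by (rule nn_integral_act[OF g]) measurable
    also have "\<dots> = emeasure (density harmonic ?w) A"
      by (simp add: emeasure_density ennreal_mult mult.assoc)
    finally show "emeasure (density harmonic (\<lambda>c. ennreal (translate_density (g \<otimes> k) c))) A =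
      emeasure (density harmonic ?w) A" .
  qed simp
  then have "AE c in harmonic. ennreal (translate_density (g \<otimes> k) c) = ?w c"
    by (subst (asm) harm.density_unique_iff) auto
  then have "AE c in harmonic. ennreal (translate_density (g \<otimes> k) (act g c)) = ?w (act g c)"
    by (rule quasi_invariant_AE[OF g])
  then show ?thesis using AE_space
    by eventually_elim (simp add: act_inv_act)
qed

text \<open>
  The factor by which knowing the limit point changes the probability of the position at time \<open>n\<close>:
  the joint law of position and limit point has this density with respect to the product of its marginals.
\<close>

definition likelihood :: "nat \<Rightarrow> (nat \<Rightarrow> 'a) \<Rightarrow> real" where
  "likelihood n h = translate_density (position n h) (\<beta> h)"

lemma measurable_likelihood [measurable]: "likelihood n \<in> borel_measurable increments"
  unfolding likelihood_def[abs_def] by measurable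

lemma nn_integral_position_boundary:
  assumes [measurable]: "case_prod F \<in> borel_measurable (count_space (carrier G) \<Otimes>\<^sub>M M)"
  shows "(\<integral>\<^sup>+ h. F (position n h) (\<beta> h) \<partial>increments) =
    (\<integral>\<^sup>+ h. \<integral>\<^sup>+ c. ennreal (translate_density (position n h) c) * F (position n h) c \<partial>harmonic \<partial>increments)"
proof -
  have "(\<integral>\<^sup>+ h. F (position n h) (\<beta> h) \<partial>increments) =
      (\<integral>\<^sup>+ h. \<integral>\<^sup>+ c. F (position n h) (act (position n h) c) \<partial>harmonic \<partial>increments)"
  proof (rule nn_integral_past_boundary)
    show "(\<lambda>(h, c). F (position n h) c) \<in> borel_measurable (increments \<Otimes>\<^sub>M M)"
      by measurable
  next
    fix h h' :: "nat \<Rightarrow> 'a" and c assume "\<And>i. i < n \<Longrightarrow> h i = h' i"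
    then have "position n h = position n h'" by (rule position_cong)
    then show "F (position n h) c = F (position n h') c" by simp
  qed
  also have "\<dots> = (\<integral>\<^sup>+ h. \<integral>\<^sup>+ c. ennreal (translate_density (position n h) c) * F (position n h) c \<partial>harmonic \<partial>increments)"
  proof (rule nn_integral_cong_AE)
    show "AE h in increments. (\<integral>\<^sup>+ c. F (position n h) (act (position n h) c) \<partial>harmonic) =
      (\<integral>\<^sup>+ c. ennreal (translate_density (position n h) c) * F (position n h) c \<partial>harmonic)"
      using AE_quasi_invariant_position AE_space
    proof eventually_elim
      case (elim h)
      then have "position n h \<in> space (count_space (carrier G))" by simp
      then have "F (position n h) \<in> borel_measurable M"
        using measurable_Pair2[OF assms] by simp
      then show ?case using elim by (intro nn_integral_act) auto
    qed
  qed
  finally show ?thesis .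
qed

lemma AE_likelihood_positive: "AE h in increments. 0 < likelihood n h"
proof -
  have "(\<integral>\<^sup>+ h. (if translate_density (position n h) (\<beta> h) = 0 then 1 else 0) \<partial>increments) = 0"
    by (subst nn_integral_position_boundary[where F = "\<lambda>g c. if translate_density g c = 0 then 1 else 0"])
       (measurable, simp add: if_distrib cong: if_cong)
  then have "AE h in increments. translate_density (position n h) (\<beta> h) \<noteq> 0"
    by (subst (asm) nn_integral_0_iff_AE) (measurable, auto split: if_splits)
  then show ?thesis
    by eventually_elim (simp add: likelihood_def less_le)
qed

text \<open>
  Dividing by the density of the joint law replaces it by the product of the marginals. Only an
  inequality holds, because the density may vanish on a set that has positive measure for the product.
\<close>

lemma nn_integral_divide_likelihood_le:
  assumes [measurable]: "case_prod F \<in> borel_measurable (count_space (carrier G) \<Otimes>\<^sub>M M)"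
  shows "(\<integral>\<^sup>+ h. F (position n h) (\<beta> h) * ennreal (1 / likelihood n h) \<partial>increments)
    \<le> (\<integral>\<^sup>+ h. \<integral>\<^sup>+ c. F (position n h) c \<partial>harmonic \<partial>increments)"
proof -
  have "(\<integral>\<^sup>+ h. F (position n h) (\<beta> h) * ennreal (1 / likelihood n h) \<partial>increments)
     = (\<integral>\<^sup>+ h. \<integral>\<^sup>+ c. ennreal (translate_density (position n h) c) *
         (F (position n h) c * ennreal (1 / translate_density (position n h) c)) \<partial>harmonic \<partial>increments)"
    unfolding likelihood_def
    by (rule nn_integral_position_boundary[where F = "\<lambda>g c. F g c * ennreal (1 / translate_density g c)"])
       measurable
  also have "\<dots> \<le> (\<integral>\<^sup>+ h. \<integral>\<^sup>+ c. F (position n h) c \<partial>harmonic \<partial>increments)"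
  proof (intro nn_integral_mono)
    fix h c
    have "ennreal (translate_density (position n h) c) * (F (position n h) c * ennreal (1 / translate_density (position n h) c))
      = ennreal (translate_density (position n h) c * (1 / translate_density (position n h) c)) * F (position n h) c"
      by (subst ennreal_mult) (simp_all add: ac_simps)
    also have "\<dots> \<le> 1 * F (position n h) c"
      by (intro mult_right_mono) auto
    finally show "ennreal (translate_density (position n h) c) * (F (position n h) c * ennreal (1 / translate_density (position n h) c))
      \<le> F (position n h) c" by simp
  qed
  finally show ?thesis .
qed

text \<open>
  The first step and the walk that starts after it contribute separate factors; this is what makes
  the logarithm of the likelihood a sum along a stationary sequence.
\<close>

lemma likelihood_Suc:
  "AE h in increments. likelihood (Suc n) h = likelihood (Suc 0) h * likelihood n (time_shift h)"
proof -
  let ?Q = "Collect quasi_invariant"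
  have Q: "countable ?Q"
    using countable_carrier by (rule countable_subset[rotated]) (auto simp: quasi_invariant_carrier)
  have "AE c in harmonic. \<forall>g\<in>?Q. \<forall>k\<in>?Q. translate_density (g \<otimes> k) (act g c) =
    translate_density g (act g c) * translate_density k c"
    by (intro AE_ball_countable' Q translate_density_mult) auto
  from AE_time_shift[OF AE_boundary[OF this]] boundary_shift
    AE_quasi_invariant_position AE_time_shift[OF AE_quasi_invariant_position] AE_space
  show ?thesis
  proof eventually_elim
    case (elim h)
    have "quasi_invariant (h 0)" using elim(3)[rule_format, of "Suc 0"] elim(5) by simp
    then show ?case
      using elim by (simp add: likelihood_def position_Suc[of h n])
  qed
qed

text \<open>
  By Bayes' rule the product is the conditional probability of the position \<open>g\<close> given the limit point.
\<close>

lemma step_power_translate_density_le: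
  assumes g: "quasi_invariant g"
  shows "AE c in harmonic. step_power n g * translate_density g c \<le> 1"
proof -
  have G: "g \<in> carrier G" using g by (rule quasi_invariant_carrier)
  have [measurable]: "{h \<in> space increments. position n h = g} \<in> sets increments"
    using G by measurable
  have int: "integrable harmonic (translate_density g)"
    by (rule integrableI_nonneg) (auto simp: nn_integral_translate_density[OF g])
  have "AE c in harmonic. 0 \<le> 1 - step_power n g * translate_density g c"
  proof (rule harm.density_nonneg)
    show "integrable harmonic (\<lambda>c. 1 - step_power n g * translate_density g c)"
      using int by simp
    fix A assume "A \<in> sets harmonic"
    then have A [measurable]: "A \<in> sets M" by simp
    have "ennreal (step_power n g) * (\<integral>\<^sup>+ c. ennreal (translate_density g c) * indicator A c \<partial>harmonic)
      = ennreal (step_power n g) * (\<integral>\<^sup>+ c. indicator A (act g c) \<partial>harmonic)"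
      by (subst nn_integral_act[OF g]) auto
    also have "\<dots> = (\<integral>\<^sup>+ h. indicator {h \<in> space increments. position n h = g} h *
       (\<integral>\<^sup>+ c. indicator A (act g c) \<partial>harmonic) \<partial>increments)"
      by (subst nn_integral_multc) (auto simp: step_power_def incr.emeasure_eq_measure)
    also have "\<dots> = (\<integral>\<^sup>+ h. (\<integral>\<^sup>+ c. (if position n h = g then indicator A (act (position n h) c) else 0) \<partial>harmonic) \<partial>increments)"
      by (intro nn_integral_cong) (auto simp: indicator_def)
    also have "\<dots> = (\<integral>\<^sup>+ h. (if position n h = g then indicator A (\<beta> h) else 0) \<partial>increments)"
    proof (rule nn_integral_past_boundary[symmetric, where F = "\<lambda>h c. if position n h = g then indicator A c else 0"])
      show "(\<lambda>(h, c). if position n h = g then indicator A c else 0 :: ennreal)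
          \<in> borel_measurable (increments \<Otimes>\<^sub>M M)"
        using G by measurable
    next
      fix h h' :: "nat \<Rightarrow> 'a" and c assume "\<And>i. i < n \<Longrightarrow> h i = h' i"
      then have "position n h = position n h'" by (rule position_cong)
      then show "(if position n h = g then indicator A c else 0) =
          (if position n h' = g then indicator A c else 0 :: ennreal)"
        by simp
    qed
    also have "\<dots> \<le> (\<integral>\<^sup>+ h. indicator A (\<beta> h) \<partial>increments)"
      by (intro nn_integral_mono) (auto simp: indicator_def)
    also have "\<dots> = (\<integral>\<^sup>+ c. indicator A c \<partial>harmonic)"
      unfolding harmonic_def by (rule nn_integral_distr[symmetric]) measurable
    also have "\<dots> = emeasure harmonic A"
      by simp
    finally have le: "ennreal (step_power n g) * (\<integral>\<^sup>+ c. ennreal (translate_density g c) * indicator A c \<partial>harmonic)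
      \<le> ennreal (measure harmonic A)"
      by (simp add: harm.emeasure_eq_measure)
    have "(\<integral>\<^sup>+ c. ennreal (translate_density g c) * indicator A c \<partial>harmonic)
      = (\<integral>\<^sup>+ c. ennreal (indicator A c * translate_density g c) \<partial>harmonic)"
      by (intro nn_integral_cong) (auto simp: indicator_def)
    also have "\<dots> = ennreal (\<integral> c. indicator A c * translate_density g c \<partial>harmonic)"
      using integrable_real_mult_indicator[OF _ int, of A]
      by (intro nn_integral_eq_integral) (auto simp: mult.commute)
    finally have "step_power n g * (\<integral> c. indicator A c * translate_density g c \<partial>harmonic) \<le> measure harmonic A"
      using le by (simp add: ennreal_mult'[symmetric] step_power_def)
    moreover have "set_lebesgue_integral harmonic A (\<lambda>c. 1 - step_power n g * translate_density g c)
      = measure harmonic A - step_power n g * (\<integral> c. indicator A c * translate_density g c \<partial>harmonic)"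
    proof -
      have "set_lebesgue_integral harmonic A (\<lambda>c. 1 - step_power n g * translate_density g c)
        = (\<integral> c. indicator A c - step_power n g * (indicator A c * translate_density g c) \<partial>harmonic)"
        unfolding set_lebesgue_integral_def by (intro Bochner_Integration.integral_cong) (auto simp: algebra_simps)
      also have "\<dots> = (\<integral> c. indicator A c \<partial>harmonic) - (\<integral> c. step_power n g * (indicator A c * translate_density g c) \<partial>harmonic)"
        using integrable_real_mult_indicator[OF _ int, of A]
        by (intro Bochner_Integration.integral_diff) (auto simp: mult.commute harm.emeasure_eq_measure)
      finally show ?thesis by simp
    qed
    ultimately show "0 \<le> set_lebesgue_integral harmonic A (\<lambda>c. 1 - step_power n g * translate_density g c)"
      by simp
  qed
  then show ?thesis by simp
qed

lemma AE_step_power_likelihood_le: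
  "AE h in increments. step_power n (position n h) * likelihood n h \<le> 1"
proof -
  have "countable (Collect quasi_invariant)"
    using countable_carrier by (rule countable_subset[rotated]) (auto simp: quasi_invariant_carrier)
  then have "AE c in harmonic. \<forall>g\<in>Collect quasi_invariant. step_power n g * translate_density g c \<le> 1"
    by (intro AE_ball_countable' step_power_translate_density_le) auto
  from AE_boundary[OF this] AE_quasi_invariant_position
  show ?thesis by eventually_elim (auto simp: likelihood_def)
qed

end

section \<open>The entropy gap between a boundary and a factor\<close>

text \<open>
  A boundary and a quotient of it, as limit maps of the same walk. Finite entropy enters as the
  integrability of the information of a step, the form in which it dominates the logarithms of likelihoods.
\<close>

locale boundary_factor = random_walk G \<mu> +
  whole: walk_boundary G \<mu> M act \<beta> +
  factor: walk_boundary G \<mu> N act' "\<lambda>h. p (\<beta> h)"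
  for G :: "('a, 'm) monoid_scheme" (structure) and \<mu>
    and M :: "'c measure" and act and \<beta> and N :: "'d measure" and act' and p :: "'c \<Rightarrow> 'd" +
  assumes measurable_factor_map [measurable]: "p \<in> M \<rightarrow>\<^sub>M N"
    and integrable_information: "integrable \<mu> (\<lambda>g. - ln (measure \<mu> {g}))"
begin

lemma factor_harmonic: "factor.harmonic = distr whole.harmonic N p"
  unfolding factor.harmonic_def whole.harmonic_def by (subst distr_distr) (auto simp: o_def)

definition log_ratio :: "nat \<Rightarrow> (nat \<Rightarrow> 'a) \<Rightarrow> real" where
  "log_ratio n h = ln (whole.likelihood n h / factor.likelihood n h)"

lemma measurable_log_ratio [measurable]: "log_ratio n \<in> borel_measurable increments"
  unfolding log_ratio_def[abs_def] by measurable

lemma log_ratio_Suc: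
  "AE h in increments. log_ratio (Suc n) h = log_ratio (Suc 0) h + log_ratio n (time_shift h)"
  using whole.likelihood_Suc[of n] factor.likelihood_Suc[of n]
    whole.AE_likelihood_positive[of "Suc 0"] factor.AE_likelihood_positive[of "Suc 0"]
    AE_time_shift[OF whole.AE_likelihood_positive[of n]] AE_time_shift[OF factor.AE_likelihood_positive[of n]]
proof eventually_elim
  case (elim h)
  then show ?case by (simp add: log_ratio_def ln_div ln_mult)
qed

lemma nn_integral_likelihood_ratio_le:
  "(\<integral>\<^sup>+ h. ennreal (factor.likelihood n h / whole.likelihood n h) \<partial>increments) \<le> 1"
proof -
  have "(\<integral>\<^sup>+ h. ennreal (factor.likelihood n h / whole.likelihood n h) \<partial>increments)
    = (\<integral>\<^sup>+ h. ennreal (factor.translate_density (position n h) (p (\<beta> h))) * ennreal (1 / whole.likelihood n h) \<partial>increments)"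
    by (intro nn_integral_cong) (simp add: factor.likelihood_def flip: ennreal_mult')
  also have "\<dots> \<le> (\<integral>\<^sup>+ h. \<integral>\<^sup>+ c. ennreal (factor.translate_density (position n h) (p c)) \<partial>whole.harmonic \<partial>increments)"
    by (rule whole.nn_integral_divide_likelihood_le[where F = "\<lambda>g c. ennreal (factor.translate_density g (p c))"])
       measurable
  also have "\<dots> = (\<integral>\<^sup>+ h. 1 \<partial>increments)"
  proof (rule nn_integral_cong_AE)
    show "AE h in increments. (\<integral>\<^sup>+ c. ennreal (factor.translate_density (position n h) (p c)) \<partial>whole.harmonic) = 1"
      using factor.AE_quasi_invariant_position
    proof eventually_elim
      case (elim h)
      have "(\<integral>\<^sup>+ c. ennreal (factor.translate_density (position n h) (p c)) \<partial>whole.harmonic)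
        = (\<integral>\<^sup>+ c. ennreal (factor.translate_density (position n h) c) \<partial>factor.harmonic)"
        unfolding factor_harmonic by (subst nn_integral_distr) auto
      then show ?case using elim by (simp add: factor.nn_integral_translate_density)
    qed
  qed
  finally show ?thesis by (simp add: incr.emeasure_space_1)
qed

lemma integrable_likelihood_ratio:
  "integrable increments (\<lambda>h. factor.likelihood n h / whole.likelihood n h)"
  and integral_likelihood_ratio_le:
  "(\<integral> h. factor.likelihood n h / whole.likelihood n h \<partial>increments) \<le> 1"
proof -
  have nonneg: "0 \<le> factor.likelihood n h / whole.likelihood n h" for h
    by (simp add: factor.likelihood_def whole.likelihood_def)
  show int: "integrable increments (\<lambda>h. factor.likelihood n h / whole.likelihood n h)"
    using nn_integral_likelihood_ratio_le[of n] nonneg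
    by (intro integrableI_nonneg) (auto intro: le_less_trans)
  show "(\<integral> h. factor.likelihood n h / whole.likelihood n h \<partial>increments) \<le> 1"
    using nn_integral_likelihood_ratio_le[of n] nonneg
    by (simp add: nn_integral_eq_integral[OF int] ennreal_le_1)
qed

text \<open>
  The term \<open>ln (w * step_power n (position n h))\<close> stands for the logarithm of a kernel from the factor
  to \<open>G\<close>. The bound is a pointwise form of Gibbs' inequality, which follows from \<open>ln t \<le> t - 1\<close>; the likelihood
  for the whole boundary disappears because its product with the probability of the position is at most \<open>1\<close>.
\<close>

lemma log_ratio_le:
  "AE h in increments. \<forall>w>0. log_ratio n h \<le>
     w / factor.likelihood n h - 1 - ln (w * step_power n (position n h))"
  using whole.AE_likelihood_positive[of n] factor.AE_likelihood_positive[of n]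
    AE_step_power_positive[of n] whole.AE_step_power_likelihood_le[of n]
proof eventually_elim
  case (elim h)
  let ?u = "whole.likelihood n h" and ?v = "factor.likelihood n h" and ?m = "step_power n (position n h)"
  show ?case
  proof (intro allI impI)
    fix w :: real assume w: "0 < w"
    \<comment> \<open>Split off the conditional probability of the position given the limit point.\<close>
    have "log_ratio n h = ln (?m * ?u) + ln (w / ?v) - ln (w * ?m)"
      using elim w by (simp add: log_ratio_def ln_mult ln_div)
    moreover have "ln (?m * ?u) \<le> 0" using elim by simp
    moreover have "ln (w / ?v) \<le> w / ?v - 1" using elim w by (intro ln_le_minus_one) simp
    ultimately show "log_ratio n h \<le> w / ?v - 1 - ln (w * ?m)" by linarith
  qed
qed

lemma integrable_information_increment:
  "integrable increments (\<lambda>h. - ln (measure \<mu> {h i}))"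
proof -
  have "integrable (distr increments \<mu> (\<lambda>h. h i)) (\<lambda>g. - ln (measure \<mu> {g}))"
    by (subst distr_increment) (rule integrable_information)
  then show ?thesis
    by (rule integrable_distr[rotated]) (simp add: measurable_into_step)
qed

lemma information_nonneg: "0 \<le> - ln (measure \<mu> {g})"
  using step.prob_le_1[of "{g}"] measure_nonneg[of \<mu> "{g}"]
  by (cases "measure \<mu> {g} = 0") (auto simp: less_le)

text \<open>
  For a kernel from the factor to \<open>G\<close> with density \<open>W\<close> with respect to the law of the position, the first term
  of the bound above has mean at most \<open>1\<close>.
\<close>

lemma weight_divide_likelihood:
  assumes [measurable]: "case_prod W \<in> borel_measurable (count_space (carrier G) \<Otimes>\<^sub>M N)"
    and nonneg: "\<And>g c. 0 \<le> W g c"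
    and le: "(\<integral>\<^sup>+ h. \<integral>\<^sup>+ c. ennreal (W (position n h) c) \<partial>factor.harmonic \<partial>increments) \<le> 1"
  shows "integrable increments (\<lambda>h. W (position n h) (p (\<beta> h)) / factor.likelihood n h)"
    and "(\<integral> h. W (position n h) (p (\<beta> h)) / factor.likelihood n h \<partial>increments) \<le> 1"
proof -
  have nonneg': "0 \<le> W (position n h) (p (\<beta> h)) / factor.likelihood n h" for h
    by (simp add: factor.likelihood_def nonneg)
  have "(\<integral>\<^sup>+ h. ennreal (W (position n h) (p (\<beta> h)) / factor.likelihood n h) \<partial>increments)
    = (\<integral>\<^sup>+ h. ennreal (W (position n h) (p (\<beta> h))) * ennreal (1 / factor.likelihood n h) \<partial>increments)"
    by (intro nn_integral_cong) (simp add: nonneg flip: ennreal_mult')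
  also have "\<dots> \<le> (\<integral>\<^sup>+ h. \<integral>\<^sup>+ c. ennreal (W (position n h) c) \<partial>factor.harmonic \<partial>increments)"
    by (rule factor.nn_integral_divide_likelihood_le[where F = "\<lambda>g c. ennreal (W g c)"]) measurable
  finally have le1: "(\<integral>\<^sup>+ h. ennreal (W (position n h) (p (\<beta> h)) / factor.likelihood n h) \<partial>increments) \<le> 1"
    using le by (rule order_trans)
  show int: "integrable increments (\<lambda>h. W (position n h) (p (\<beta> h)) / factor.likelihood n h)"
    using le1 nonneg' by (intro integrableI_nonneg) (auto intro: le_less_trans)
  show "(\<integral> h. W (position n h) (p (\<beta> h)) / factor.likelihood n h \<partial>increments) \<le> 1"
    using le1 nonneg' by (simp add: nn_integral_eq_integral[OF int] ennreal_le_1)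
qed

text \<open>
  From below the logarithm is controlled by the inverse ratio, which has mean at most \<open>1\<close>; from above by
  the pointwise bound with \<open>w = 1\<close>, whose terms are integrable because a step has finite entropy.
\<close>

lemma integrable_log_ratio_1: "integrable increments (log_ratio (Suc 0))"
proof (rule Bochner_Integration.integrable_bound)
  have "integrable increments (\<lambda>h. 1 / factor.likelihood (Suc 0) h)"
    by (rule weight_divide_likelihood(1)[where W = "\<lambda>_ _. 1"])
       (auto simp: factor.harm.emeasure_space_1[simplified] incr.emeasure_space_1)
  then show "integrable increments (\<lambda>h. factor.likelihood (Suc 0) h / whole.likelihood (Suc 0) h
      + 1 / factor.likelihood (Suc 0) h + (- ln (measure \<mu> {h 0})))"
    by (intro Bochner_Integration.integrable_add integrable_likelihood_ratio integrable_information_increment)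
  show "AE h in increments. norm (log_ratio (Suc 0) h) \<le> norm (factor.likelihood (Suc 0) h / whole.likelihood (Suc 0) h
      + 1 / factor.likelihood (Suc 0) h + (- ln (measure \<mu> {h 0})))"
    using log_ratio_le[of "Suc 0"] whole.AE_likelihood_positive[of "Suc 0"] factor.AE_likelihood_positive[of "Suc 0"]
      AE_increment_positive AE_space
  proof eventually_elim
    case (elim h)
    let ?u = "whole.likelihood (Suc 0) h" and ?v = "factor.likelihood (Suc 0) h"
    have "log_ratio (Suc 0) h \<le> 1 / ?v - 1 - ln (step_power (Suc 0) (position (Suc 0) h))"
      using elim(1)[rule_format, of 1] by simp
    moreover have "- ln (step_power (Suc 0) (position (Suc 0) h)) \<le> - ln (measure \<mu> {h 0})"
      using minus_ln_step_power_le[of h "Suc 0"] elim by simp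
    moreover have "- log_ratio (Suc 0) h = ln (?v / ?u)"
      using elim by (simp add: log_ratio_def ln_div)
    moreover have "ln (?v / ?u) \<le> ?v / ?u - 1"
      using elim by (intro ln_le_minus_one) simp
    moreover have "0 < ?v / ?u" "0 < 1 / ?v" using elim by simp_all
    moreover have "0 \<le> - ln (measure \<mu> {h 0})" by (rule information_nonneg)
    ultimately show ?case by (simp only: real_norm_def)
  qed
qed simp

text \<open>
  The conditional mutual information of the first step and the limit point, given the image of
  the latter in the factor.
\<close>

definition entropy_gap :: real where
  "entropy_gap = (\<integral> h. log_ratio (Suc 0) h \<partial>increments)"

text \<open>
  The shift preserves the law of the increments, so each step contributes the same mean.
\<close>

lemma log_ratio_integral:
  "integrable increments (log_ratio (Suc n)) \<and>
   (\<integral> h. log_ratio (Suc n) h \<partial>increments) = real (Suc n) * entropy_gap"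
proof (induction n)
  case 0
  show ?case by (simp add: integrable_log_ratio_1 entropy_gap_def)
next
  case (Suc n)
  have shift: "integrable increments (\<lambda>h. log_ratio (Suc n) (time_shift h))"
    "(\<integral> h. log_ratio (Suc n) (time_shift h) \<partial>increments) = real (Suc n) * entropy_gap"
    using Suc integrable_distr[of time_shift increments increments "log_ratio (Suc n)"]
      integral_distr[of time_shift increments increments "log_ratio (Suc n)"]
    by (simp_all add: distr_time_shift)
  have "integrable increments (\<lambda>h. log_ratio (Suc 0) h + log_ratio (Suc n) (time_shift h))"
    by (intro Bochner_Integration.integrable_add integrable_log_ratio_1 shift)
  moreover have "(\<integral> h. log_ratio (Suc 0) h + log_ratio (Suc n) (time_shift h) \<partial>increments)
      = real (Suc (Suc n)) * entropy_gap"
    by (subst Bochner_Integration.integral_add)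
       (auto simp: integrable_log_ratio_1 shift entropy_gap_def[symmetric] algebra_simps)
  moreover have "integrable increments (log_ratio (Suc (Suc n))) \<longleftrightarrow>
      integrable increments (\<lambda>h. log_ratio (Suc 0) h + log_ratio (Suc n) (time_shift h))"
    by (intro integrable_cong_AE log_ratio_Suc) measurable
  moreover have "(\<integral> h. log_ratio (Suc (Suc n)) h \<partial>increments) =
      (\<integral> h. log_ratio (Suc 0) h + log_ratio (Suc n) (time_shift h) \<partial>increments)"
    by (intro integral_cong_AE log_ratio_Suc) measurable
  ultimately show ?case by simp
qed

text \<open>
  The mean of the logarithmic ratio at time \<open>n\<close> is at most the conditional entropy of the position
  given the point of the factor. By Gibbs' inequality this entropy is at most the mean of minus the logarithm
  of any kernel, here \<open>W\<close> times the law of the position.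
\<close>

lemma entropy_gap_le:
  assumes W [measurable]: "case_prod W \<in> borel_measurable (count_space (carrier G) \<Otimes>\<^sub>M N)"
    and pos: "\<And>g c. 0 < W g c"
    and le: "(\<integral>\<^sup>+ h. \<integral>\<^sup>+ c. ennreal (W (position n h) c) \<partial>factor.harmonic \<partial>increments) \<le> 1"
    and n: "0 < n"
    and b: "integrable increments b"
    and b_le: "AE h in increments. - ln (W (position n h) (p (\<beta> h)) * step_power n (position n h)) \<le> b h"
  shows "real n * entropy_gap \<le> (\<integral> h. b h \<partial>increments)"
proof -
  obtain m where m: "n = Suc m" using n by (cases n) auto
  note W_int = weight_divide_likelihood[OF W less_imp_le[OF pos] le]
  have "real n * entropy_gap = (\<integral> h. log_ratio n h \<partial>increments)"
    using log_ratio_integral[of m] m by simp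
  also have "\<dots> \<le> (\<integral> h. W (position n h) (p (\<beta> h)) / factor.likelihood n h - 1 + b h \<partial>increments)"
  proof (rule integral_mono_AE)
    show "integrable increments (log_ratio n)" using log_ratio_integral[of m] m by simp
    show "integrable increments (\<lambda>h. W (position n h) (p (\<beta> h)) / factor.likelihood n h - 1 + b h)"
      using W_int b by simp
    show "AE h in increments. log_ratio n h \<le> W (position n h) (p (\<beta> h)) / factor.likelihood n h - 1 + b h"
      using log_ratio_le[of n] b_le
    proof eventually_elim
      case (elim h)
      then show ?case using elim(1)[rule_format, OF pos, of "position n h" "p (\<beta> h)"] by linarith
    qed
  qed
  also have "\<dots> = (\<integral> h. W (position n h) (p (\<beta> h)) / factor.likelihood n h \<partial>increments) - 1 + (\<integral> h. b h \<partial>increments)"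
    using W_int b by (simp add: incr.prob_space)
  finally show ?thesis using W_int(2) by linarith
qed

end

section \<open>Gauges and the entropy gap\<close>

lemma gauge_function_le_imp_mem:
  assumes "gauge_on G \<G>" "g \<in> carrier G" "gauge_function \<G> g \<le> k" "1 \<le> k"
  shows "g \<in> \<G> k"
proof -
  obtain j where "1 \<le> j \<and> g \<in> \<G> j" using assms(1,2) by (auto simp: gauge_on_def)
  then have "1 \<le> gauge_function \<G> g \<and> g \<in> \<G> (gauge_function \<G> g)"
    unfolding gauge_function_def by (rule LeastI)
  moreover have "\<G> (gauge_function \<G> g) \<subseteq> \<G> k"
    using assms(1,3,4) calculation by (intro mono_onD[of "{1..}" \<G>]) (auto simp: gauge_on_def)
  ultimately show ?thesis by auto
qed

context boundary_factor begin

definition information_tail :: "real \<Rightarrow> real" where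
  "information_tail K = (\<integral> g. max 0 (- ln (measure \<mu> {g}) - K) \<partial>\<mu>)"

lemma measurable_on_step [measurable]: "f \<in> \<mu> \<rightarrow>\<^sub>M borel"
  by (simp add: measurable_def sets_step)

lemma integrable_information_tail:
  assumes "0 \<le> K"
  shows "integrable \<mu> (\<lambda>g. max 0 (- ln (measure \<mu> {g}) - K))"
proof (rule Bochner_Integration.integrable_bound[OF integrable_information])
  have "max 0 (- ln (measure \<mu> {g}) - K) \<le> - ln (measure \<mu> {g})" for g
    using information_nonneg[of g] assms by (simp add: max_def)
  then show "AE g in \<mu>. norm (max 0 (- ln (measure \<mu> {g}) - K)) \<le> norm (- ln (measure \<mu> {g}))"
    using information_nonneg by (intro AE_I2) (simp add: max_def)
qed measurable

lemma information_tail_tendsto: "(\<lambda>K. information_tail (real K)) \<longlonglongrightarrow> 0"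
proof -
  have "(\<lambda>K. information_tail (real K)) \<longlonglongrightarrow> (\<integral> g. 0 \<partial>\<mu>)"
    unfolding information_tail_def
  proof (rule integral_dominated_convergence[where w = "\<lambda>g. - ln (measure \<mu> {g})"])
    show "AE g in \<mu>. (\<lambda>K. max 0 (- ln (measure \<mu> {g}) - real K)) \<longlonglongrightarrow> 0"
    proof (rule AE_I2)
      fix g
      obtain K0 where K0: "- ln (measure \<mu> {g}) \<le> real K0" using real_arch_simple by blast
      show "(\<lambda>K. max 0 (- ln (measure \<mu> {g}) - real K)) \<longlonglongrightarrow> 0"
        by (rule tendsto_eventually, rule eventually_sequentiallyI[of K0]) (use K0 in auto)
    qed
    show "AE g in \<mu>. norm (max 0 (- ln (measure \<mu> {g}) - real K)) \<le> - ln (measure \<mu> {g})" for K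
      using information_nonneg by (intro AE_I2) (simp add: max_def)
  qed (measurable, rule integrable_information)
  then show ?thesis by simp
qed

text \<open>
  The uniform integrability of the averaged information of the first \<open>n\<close> steps: up to the level
  \<open>K\<close> the information is bounded on the event by \<open>K\<close>, and above it by the tail.
\<close>

lemma integral_information_on_event_le:
  assumes [measurable]: "A \<in> sets increments" and K: "0 \<le> K"
  shows "integrable increments (\<lambda>h. indicator A h * (\<Sum>i<n. - ln (measure \<mu> {h i})))"
    and "(\<integral> h. indicator A h * (\<Sum>i<n. - ln (measure \<mu> {h i})) \<partial>increments)
      \<le> real n * (K * measure increments A + information_tail K)"
proof -
  let ?I = "\<lambda>i h. - ln (measure \<mu> {h i}) :: real"
  have int: "integrable increments (\<lambda>h. indicator A h * ?I i h)" for i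
    using integrable_real_mult_indicator[OF assms(1) integrable_information_increment[of i]]
    by (simp add: mult.commute)
  then have int_sum: "integrable increments (\<lambda>h. \<Sum>i<n. indicator A h * ?I i h)"
    by (intro Bochner_Integration.integrable_sum) auto
  then show "integrable increments (\<lambda>h. indicator A h * (\<Sum>i<n. ?I i h))"
    by (simp add: sum_distrib_left)
  have tail: "integrable increments (\<lambda>h. max 0 (?I i h - K))"
    "(\<integral> h. max 0 (?I i h - K) \<partial>increments) = information_tail K" for i
  proof -
    have m: "(\<lambda>h. h i) \<in> increments \<rightarrow>\<^sub>M \<mu>" by (simp add: measurable_into_step)
    show "integrable increments (\<lambda>h. max 0 (?I i h - K))"
      by (rule integrable_distr[OF m]) (simp only: distr_increment integrable_information_tail[OF K])
    show "(\<integral> h. max 0 (?I i h - K) \<partial>increments) = information_tail K"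
      unfolding information_tail_def
      by (subst (2) distr_increment[of i, symmetric], subst integral_distr[OF m]) auto
  qed
  have "(\<integral> h. indicator A h * (\<Sum>i<n. ?I i h) \<partial>increments) = (\<Sum>i<n. \<integral> h. indicator A h * ?I i h \<partial>increments)"
    by (simp only: sum_distrib_left) (rule Bochner_Integration.integral_sum, rule int)
  also have "\<dots> \<le> (\<Sum>i<n. \<integral> h. K * indicator A h + max 0 (?I i h - K) \<partial>increments)"
  proof (intro sum_mono integral_mono int Bochner_Integration.integrable_add tail)
    fix i h show "indicator A h * ?I i h \<le> K * indicator A h + max 0 (?I i h - K)"
      by (auto simp: indicator_def)
  qed (simp add: incr.emeasure_eq_measure)
  also have "\<dots> = (\<Sum>i<n. K * measure increments A + information_tail K)"
    by (intro sum.cong refl, subst Bochner_Integration.integral_add)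
       (auto simp: tail incr.emeasure_eq_measure)
  finally show "(\<integral> h. indicator A h * (\<Sum>i<n. ?I i h) \<partial>increments)
      \<le> real n * (K * measure increments A + information_tail K)" by simp
qed

lemma miss_event_sets:
  assumes [measurable]: "f \<in> N \<rightarrow>\<^sub>M count_space (carrier G)"
    and A: "A \<subseteq> carrier G"
  shows "{h \<in> space increments. inv (f (p (\<beta> h))) \<otimes> position n h \<notin> A} \<in> sets increments"
proof -
  have [measurable]: "A \<in> sets (count_space (carrier G))" using A by simp
  show ?thesis by measurable
qed

text \<open>
  The kernel is half the uniform distribution on the elements \<open>g\<close> with \<open>inv (f c) \<otimes> g \<in> A\<close> plus half
  the law of the position. The first half makes the cost \<open>ln 2 + ln (card A)\<close> when the prediction
  succeeds, the second half bounds the cost by the information of the steps when it fails.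
\<close>

lemma entropy_gap_le_card:
  assumes f [measurable]: "f \<in> N \<rightarrow>\<^sub>M count_space (carrier G)"
    and A: "finite A" "A \<subseteq> carrier G"
    and n: "0 < n" and K: "0 \<le> K"
  shows "real n * entropy_gap \<le> ln 2 + ln (real (card A)) + real n *
    (K * measure increments {h \<in> space increments. inv (f (p (\<beta> h))) \<otimes> position n h \<notin> A} + information_tail K)"
proof -
  define bad where "bad = {h \<in> space increments. inv (f (p (\<beta> h))) \<otimes> position n h \<notin> A}"
  \<comment> \<open>The density, with respect to the law of the position, of the uniform distribution on the translated set.\<close>
  define X where "X g c = (if inv (f c) \<otimes> g \<in> A then 1 / (real (card A) * step_power n g) else 0)" for g c
  define W where "W g c = 1 / 2 + 1 / 2 * X g c" for g c
  have f_in: "f c \<in> carrier G" if "c \<in> space N" for c using measurable_space[OF f that] by simp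
  have bad [measurable]: "bad \<in> sets increments"
    unfolding bad_def using f A(2) by (rule miss_event_sets)
  have X_nonneg: "0 \<le> X g c" for g c by (simp add: X_def step_power_def)
  have X_meas [measurable]: "case_prod X \<in> borel_measurable (count_space (carrier G) \<Otimes>\<^sub>M N)"
  proof (rule measurable_pair_measure_countable1[OF countable_carrier])
    fix g
    have "(\<lambda>x. if inv x \<otimes> g \<in> A then 1 / (real (card A) * step_power n g) else 0)
        \<in> borel_measurable (count_space (carrier G))"
      unfolding measurable_count_space_eq1 by (rule Pi_I) (simp only: space_borel UNIV_I)
    from measurable_compose[OF f this]
    show "(\<lambda>c. case_prod X (g, c)) \<in> borel_measurable N"
      by (simp only: X_def prod.case)
  qed
  have W_meas: "case_prod W \<in> borel_measurable (count_space (carrier G) \<Otimes>\<^sub>M N)"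
    unfolding W_def by measurable
  have X_le: "(\<integral>\<^sup>+ h. ennreal (X (position n h) c) \<partial>increments) \<le> 1" if c: "c \<in> space N" for c
  proof -
    let ?A' = "{g \<in> carrier G. inv (f c) \<otimes> g \<in> A}"
    have inj: "inj_on (\<lambda>g. inv (f c) \<otimes> g) ?A'" using f_in[OF c] by (auto intro!: inj_onI)
    have "finite ?A'" by (rule finite_imageD[OF _ inj]) (rule finite_subset[OF _ A(1)], auto)
    have "card ?A' \<le> card A" by (rule card_inj_on_le[OF inj _ A(1)]) auto
    have "(\<integral>\<^sup>+ h. ennreal (X (position n h) c) \<partial>increments)
      = (\<integral>\<^sup>+ h. ennreal (1 / real (card A)) * ennreal (indicator ?A' (position n h) / step_power n (position n h)) \<partial>increments)"
      by (intro nn_integral_cong) (auto simp: X_def step_power_def simp flip: ennreal_mult')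
    also have "\<dots> = ennreal (1 / real (card A)) *
        (\<integral>\<^sup>+ h. ennreal (indicator ?A' (position n h) / step_power n (position n h)) \<partial>increments)"
    proof (rule nn_integral_cmult)
      have "(\<lambda>g. ennreal (indicator ?A' g / step_power n g)) \<in> borel_measurable (count_space (carrier G))"
        unfolding measurable_count_space_eq1 by (rule Pi_I) (simp only: space_borel UNIV_I)
      from measurable_compose[OF measurable_position this]
      show "(\<lambda>h. ennreal (indicator ?A' (position n h) / step_power n (position n h))) \<in> borel_measurable increments" .
    qed
    also have "\<dots> \<le> ennreal (1 / real (card A)) * of_nat (card ?A')"
      by (intro mult_left_mono nn_integral_inverse_step_power_le \<open>finite ?A'\<close>) auto
    also have "\<dots> \<le> ennreal (1 / real (card A)) * of_nat (card A)"
      using \<open>card ?A' \<le> card A\<close> by (intro mult_left_mono) auto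
    also have "\<dots> \<le> 1"
      by (simp add: ennreal_of_nat_eq_real_of_nat flip: ennreal_mult')
    finally show ?thesis .
  qed
  interpret pair: pair_sigma_finite factor.harmonic increments ..
  have "(\<integral>\<^sup>+ h. \<integral>\<^sup>+ c. ennreal (X (position n h) c) \<partial>factor.harmonic \<partial>increments)
    = (\<integral>\<^sup>+ c. \<integral>\<^sup>+ h. ennreal (X (position n h) c) \<partial>increments \<partial>factor.harmonic)"
    by (rule pair.Fubini') measurable
  also have "\<dots> \<le> (\<integral>\<^sup>+ c. 1 \<partial>factor.harmonic)"
    by (intro nn_integral_mono X_le) simp
  finally have X_le_1: "(\<integral>\<^sup>+ h. \<integral>\<^sup>+ c. ennreal (X (position n h) c) \<partial>factor.harmonic \<partial>increments) \<le> 1"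
    by (simp add: factor.harm.emeasure_space_1[simplified])
  have W_eq: "ennreal (W g c) = ennreal (1/2) + ennreal (1/2) * ennreal (X g c)" for g c
  proof -
    have "ennreal (1/2 + 1/2 * X g c) = ennreal (1/2) + ennreal (1/2 * X g c)"
      by (rule ennreal_plus) (simp_all add: X_nonneg)
    also have "ennreal (1/2 * X g c) = ennreal (1/2) * ennreal (X g c)"
      by (rule ennreal_mult) (simp_all add: X_nonneg)
    finally show ?thesis by (simp only: W_def)
  qed
  have W_le: "(\<integral>\<^sup>+ h. \<integral>\<^sup>+ c. ennreal (W (position n h) c) \<partial>factor.harmonic \<partial>increments) \<le> 1"
  proof -
    have "(\<integral>\<^sup>+ h. \<integral>\<^sup>+ c. ennreal (W (position n h) c) \<partial>factor.harmonic \<partial>increments)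
      = (\<integral>\<^sup>+ h. \<integral>\<^sup>+ c. ennreal (1/2) + ennreal (1/2) * ennreal (X (position n h) c) \<partial>factor.harmonic \<partial>increments)"
      by (simp only: W_eq)
    also have "\<dots> = (\<integral>\<^sup>+ h. ennreal (1/2) + ennreal (1/2) * (\<integral>\<^sup>+ c. ennreal (X (position n h) c) \<partial>factor.harmonic) \<partial>increments)"
    proof (intro nn_integral_cong)
      fix h assume "h \<in> space increments"
      then have "position n h \<in> space (count_space (carrier G))" by simp
      then have [measurable]: "X (position n h) \<in> borel_measurable N"
        using measurable_Pair2[OF X_meas] by simp
      show "(\<integral>\<^sup>+ c. ennreal (1/2) + ennreal (1/2) * ennreal (X (position n h) c) \<partial>factor.harmonic)
        = ennreal (1/2) + ennreal (1/2) * (\<integral>\<^sup>+ c. ennreal (X (position n h) c) \<partial>factor.harmonic)"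
        by (simp add: nn_integral_add nn_integral_cmult factor.harm.emeasure_space_1[simplified])
    qed
    also have "\<dots> = ennreal (1/2) + ennreal (1/2) * (\<integral>\<^sup>+ h. \<integral>\<^sup>+ c. ennreal (X (position n h) c) \<partial>factor.harmonic \<partial>increments)"
      by (simp add: nn_integral_add nn_integral_cmult incr.emeasure_space_1)
    also have "\<dots> \<le> ennreal (1/2) + ennreal (1/2) * 1"
      using X_le_1 by (intro add_left_mono mult_left_mono) auto
    also have "\<dots> = ennreal (1/2 + 1/2)"
      by (simp only: mult_1_right) (rule ennreal_plus[symmetric], simp_all)
    finally show ?thesis by simp
  qed
  have W_pos: "0 < W g c" for g c using X_nonneg[of g c] by (simp add: W_def)
  let ?b = "\<lambda>h. ln 2 + ln (real (card A)) + indicator bad h * (\<Sum>i<n. - ln (measure \<mu> {h i}))"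
  have b: "integrable increments ?b"
    using integral_information_on_event_le(1)[OF bad K] by simp
  have "AE h in increments. - ln (W (position n h) (p (\<beta> h)) * step_power n (position n h)) \<le> ?b h"
    using AE_increment_positive AE_step_power_positive[of n] AE_space
  proof eventually_elim
    case (elim h)
    let ?m = "step_power n (position n h)"
    have ln_card: "0 \<le> ln (real (card A))" by (cases "card A = 0") auto
    show ?case
    proof (cases "h \<in> bad")
      case True
      have "1 / 2 * ?m \<le> W (position n h) (p (\<beta> h)) * ?m"
        using elim X_nonneg[of "position n h" "p (\<beta> h)"]
        by (intro mult_right_mono) (simp_all add: W_def)
      then have "ln (?m / 2) \<le> ln (W (position n h) (p (\<beta> h)) * ?m)"
        using elim W_pos by (subst ln_le_cancel_iff) auto
      then have "- ln (W (position n h) (p (\<beta> h)) * ?m) \<le> ln 2 + - ln ?m"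
        using elim by (simp add: ln_div)
      with minus_ln_step_power_le[of h n] elim True ln_card show ?thesis by simp
    next
      case False
      then have mem: "inv (f (p (\<beta> h))) \<otimes> position n h \<in> A" using elim by (simp add: bad_def)
      then have card: "0 < card A" using A(1) by (auto simp: card_gt_0_iff)
      have "1 / (2 * real (card A)) \<le> W (position n h) (p (\<beta> h)) * ?m"
        using elim mem card by (simp add: W_def X_def field_simps)
      then have "ln (1 / (2 * real (card A))) \<le> ln (W (position n h) (p (\<beta> h)) * ?m)"
        using elim W_pos card by (subst ln_le_cancel_iff) auto
      then show ?thesis using card False by (simp add: ln_div ln_mult)
    qed
  qed
  from entropy_gap_le[OF W_meas W_pos W_le n b this]
  have "real n * entropy_gap \<le> (\<integral> h. ?b h \<partial>increments)" .
  also have "\<dots> = ln 2 + ln (real (card A)) + (\<integral> h. indicator bad h * (\<Sum>i<n. - ln (measure \<mu> {h i})) \<partial>increments)"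
    using integral_information_on_event_le(1)[OF bad K] by (subst Bochner_Integration.integral_add) (auto simp: incr.prob_space)
  also have "\<dots> \<le> ln 2 + ln (real (card A)) + real n * (K * measure increments bad + information_tail K)"
    using integral_information_on_event_le(2)[OF bad K, of n] by simp
  finally show ?thesis by (simp add: bad_def)
qed

text \<open>
  With \<open>A\<close> the gauge ball of radius \<open>\<epsilon>n\<close>, dividing by \<open>n\<close> and letting \<open>n\<close>, then \<open>K\<close>, tend to infinity
  leaves a multiple of \<open>\<epsilon>\<close>. Gauges start at \<open>1\<close>, whence the maximum in the radius.
\<close>

theorem entropy_gap_nonpos:
  assumes gauge: "temperate_gauge G \<G>"
    and f: "\<And>n. f n \<in> N \<rightarrow>\<^sub>M count_space (carrier G)"
    and conv: "AE h in increments.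
      (\<lambda>n. 1 / real n * real (gauge_function \<G> (inv (f n (p (\<beta> h))) \<otimes> position n h))) \<longlonglongrightarrow> 0"
  shows "entropy_gap \<le> 0"
proof -
  note f [measurable]
  have on: "gauge_on G \<G>" and fin: "\<And>k. 1 \<le> k \<Longrightarrow> finite (\<G> k)"
    and bdd: "bdd_above ((\<lambda>k. ln (real (card (\<G> k))) / real k) ` {1..})"
    using gauge by (auto simp: temperate_gauge_def finite_gauge_def)
  have sub: "\<G> k \<subseteq> carrier G" if "1 \<le> k" for k using on that by (auto simp: gauge_on_def)
  obtain C0 where C0: "\<And>k. 1 \<le> k \<Longrightarrow> ln (real (card (\<G> k))) / real k \<le> C0"
    using bdd unfolding bdd_above_def by auto
  define C where "C = max 0 C0"
  have C: "ln (real (card (\<G> k))) \<le> C * real k" if "1 \<le> k" for k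
  proof -
    have "ln (real (card (\<G> k))) \<le> C0 * real k" using C0[OF that] that by (simp add: field_simps)
    also have "\<dots> \<le> C * real k" by (intro mult_right_mono) (auto simp: C_def)
    finally show ?thesis .
  qed
  have C_nonneg: "0 \<le> C" by (simp add: C_def)
  have step1: "entropy_gap \<le> C * \<epsilon> + information_tail (real K)" if eps: "0 < \<epsilon>" for \<epsilon> and K :: nat
  proof -
    define k where "k n = max 1 (nat \<lceil>\<epsilon> * real n\<rceil>)" for n
    define bad where "bad n = {h \<in> space increments. inv (f n (p (\<beta> h))) \<otimes> position n h \<notin> \<G> (k n)}" for n
    have k1: "1 \<le> k n" for n by (simp add: k_def)
    have [measurable]: "bad n \<in> sets increments" for n
      unfolding bad_def by (intro miss_event_sets f sub k1)
    have k_le: "real (k n) \<le> \<epsilon> * real n + 1" for n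
    proof -
      have "0 \<le> \<epsilon> * real n" using eps by simp
      then show ?thesis
        using of_int_ceiling_le_add_one[of "\<epsilon> * real n"] by (auto simp: k_def max_def)
    qed
    have "(\<lambda>n. \<integral> h. indicator (bad n) h \<partial>increments) \<longlonglongrightarrow> (\<integral> h. (0::real) \<partial>increments)"
    proof (rule integral_dominated_convergence[where w = "\<lambda>_. 1"])
      show "AE h in increments. (\<lambda>n. indicator (bad n) h :: real) \<longlonglongrightarrow> 0"
        using conv AE_space
      proof eventually_elim
        case (elim h)
        let ?g = "\<lambda>n. inv (f n (p (\<beta> h))) \<otimes> position n h"
        have g: "?g n \<in> carrier G" for n
        proof -
          have "p (\<beta> h) \<in> space N" using elim(2) by (rule factor.boundary_in_space)
          then have "f n (p (\<beta> h)) \<in> carrier G" using measurable_space[OF f] by auto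
          then show ?thesis using elim by simp
        qed
        have "eventually (\<lambda>n. 1 / real n * real (gauge_function \<G> (?g n)) < \<epsilon>) sequentially"
          using elim(1) eps by (rule order_tendstoD(2))
        then have "eventually (\<lambda>n. indicator (bad n) h = (0::real)) sequentially"
          using eventually_gt_at_top[of 0]
        proof eventually_elim
          case (elim n)
          then have "real (gauge_function \<G> (?g n)) \<le> \<epsilon> * real n" by (simp add: field_simps)
          also have "\<dots> \<le> real (k n)"
            using real_nat_ceiling_ge[of "\<epsilon> * real n"] by (simp add: k_def)
          finally have "?g n \<in> \<G> (k n)"
            using k1[of n] by (intro gauge_function_le_imp_mem[OF on g]) auto
          then show ?case by (simp add: bad_def)
        qed
        then show ?case by (rule tendsto_eventually)
      qed
    qed auto
    then have bad_tendsto: "(\<lambda>n. measure increments (bad n)) \<longlonglongrightarrow> 0"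
      by (simp add: incr.emeasure_eq_measure)
    have "eventually (\<lambda>n. entropy_gap \<le> (ln 2 + C) / real n + C * \<epsilon> +
        (real K * measure increments (bad n) + information_tail (real K))) sequentially"
      using eventually_gt_at_top[of 0]
    proof eventually_elim
      case (elim n)
      have "real n * entropy_gap \<le> ln 2 + ln (real (card (\<G> (k n)))) +
          real n * (real K * measure increments (bad n) + information_tail (real K))"
        unfolding bad_def using k1[of n] by (intro entropy_gap_le_card f fin sub elim) auto
      also have "ln (real (card (\<G> (k n)))) \<le> C * (\<epsilon> * real n + 1)"
        using C[OF k1[of n]] mult_left_mono[OF k_le C_nonneg, of n] by linarith
      also have "ln 2 + C * (\<epsilon> * real n + 1) + real n * (real K * measure increments (bad n) + information_tail (real K))
        = real n * ((ln 2 + C) / real n + C * \<epsilon> +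
          (real K * measure increments (bad n) + information_tail (real K)))"
        using elim by (simp add: field_simps)
      finally have "real n * entropy_gap \<le> real n * ((ln 2 + C) / real n + C * \<epsilon> +
          (real K * measure increments (bad n) + information_tail (real K)))"
        by simp
      then show ?case using elim by (simp only: mult_le_cancel_left_pos of_nat_0_less_iff)
    qed
    moreover have "(\<lambda>n. (ln 2 + C) / real n + C * \<epsilon> +
        (real K * measure increments (bad n) + information_tail (real K)))
        \<longlonglongrightarrow> 0 + C * \<epsilon> + (real K * 0 + information_tail (real K))"
      by (intro tendsto_intros bad_tendsto lim_const_over_n)
    ultimately show ?thesis
      using tendsto_lowerbound by fastforce
  qed
  have step2: "entropy_gap \<le> C * \<epsilon>" if "0 < \<epsilon>" for \<epsilon>
  proof (rule tendsto_lowerbound)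
    show "(\<lambda>K. C * \<epsilon> + information_tail (real K)) \<longlonglongrightarrow> C * \<epsilon>"
      using tendsto_add[OF tendsto_const information_tail_tendsto, of "C * \<epsilon>"] by simp
  qed (use step1[OF that] in auto)
  show ?thesis
  proof (rule field_le_epsilon)
    fix e :: real assume e: "0 < e"
    have "entropy_gap \<le> C * (e / (C + 1))" using e C_nonneg by (intro step2) simp
    also have "\<dots> \<le> e" using e C_nonneg by (simp add: field_simps)
    finally show "entropy_gap \<le> 0 + e" by simp
  qed
qed

end

section \<open>Factors without entropy gap\<close>

lemma (in prob_space) AE_le_1_if_nn_integral_le:
  assumes [measurable]: "f \<in> borel_measurable M"
    and le: "\<And>A. A \<in> sets M \<Longrightarrow> (\<integral>\<^sup>+ x. f x * indicator A x \<partial>M) \<le> emeasure M A"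
  shows "AE x in M. f x \<le> 1"
proof -
  \<comment> \<open>The excess of \<open>f\<close> over \<open>1\<close> has integral \<open>0\<close> on the set where it is positive.\<close>
  define A where "A = {x \<in> space M. 1 < f x}"
  have [measurable]: "A \<in> sets M" unfolding A_def by measurable
  have "(\<integral>\<^sup>+ x. (f x - 1) * indicator A x \<partial>M) + emeasure M A = (\<integral>\<^sup>+ x. (f x - 1) * indicator A x + indicator A x \<partial>M)"
    by (subst nn_integral_add) auto
  also have "\<dots> = (\<integral>\<^sup>+ x. f x * indicator A x \<partial>M)"
    by (intro nn_integral_cong) (auto simp: A_def indicator_def diff_add_cancel_ennreal)
  also have "\<dots> \<le> 0 + emeasure M A" using le[of A] by simp
  finally have "(\<integral>\<^sup>+ x. (f x - 1) * indicator A x \<partial>M) \<le> 0"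
    by (simp add: emeasure_eq_measure)
  then have "AE x in M. (f x - 1) * indicator A x = 0"
    by (subst nn_integral_0_iff_AE[symmetric]) auto
  then show ?thesis using AE_space
  proof eventually_elim
    case (elim x)
    show ?case
    proof (rule ccontr)
      assume "\<not> f x \<le> 1"
      then have "f x - 1 = 0" using elim by (auto simp: A_def indicator_def not_le split: if_splits)
      with \<open>\<not> f x \<le> 1\<close> show False by (simp add: ennreal_minus_eq_0)
    qed
  qed
qed

context boundary_factor begin

text \<open>
  The function \<open>r - 1 - ln r\<close> is nonnegative and vanishes only at \<open>r = 1\<close>. For the ratio \<open>r\<close> of the
  two likelihoods its mean is at most a multiple of the entropy gap, since \<open>r\<close> has mean at most \<open>1\<close>.
\<close>

lemma likelihood_eq:
  assumes gap: "entropy_gap \<le> 0"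
  shows "AE h in increments. whole.likelihood (Suc n) h = factor.likelihood (Suc n) h"
proof -
  let ?r = "\<lambda>h. factor.likelihood (Suc n) h / whole.likelihood (Suc n) h"
  note r_int = integrable_likelihood_ratio[of "Suc n"] integral_likelihood_ratio_le[of "Suc n"]
  have L: "integrable increments (log_ratio (Suc n))"
    "(\<integral> h. log_ratio (Suc n) h \<partial>increments) = real (Suc n) * entropy_gap"
    using log_ratio_integral by auto
  have int: "integrable increments (\<lambda>h. ?r h - 1 + log_ratio (Suc n) h)"
    using r_int L by simp
  have pos: "AE h in increments. 0 \<le> ?r h - 1 + log_ratio (Suc n) h \<and>
     (?r h - 1 + log_ratio (Suc n) h = 0 \<longrightarrow> whole.likelihood (Suc n) h = factor.likelihood (Suc n) h)"
    using whole.AE_likelihood_positive[of "Suc n"] factor.AE_likelihood_positive[of "Suc n"]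
  proof eventually_elim
    case (elim h)
    have r: "0 < ?r h" using elim by simp
    have log: "log_ratio (Suc n) h = - ln (?r h)" using elim by (simp add: log_ratio_def ln_div)
    have "ln (?r h) \<le> ?r h - 1" using r by (rule ln_le_minus_one)
    moreover have "whole.likelihood (Suc n) h = factor.likelihood (Suc n) h" if "?r h - 1 + log_ratio (Suc n) h = 0"
    proof -
      have "?r h = 1" using that log r by (intro ln_eq_minus_one) auto
      then show ?thesis using elim by simp
    qed
    ultimately show ?case using log by simp
  qed
  have "(\<integral> h. ?r h - 1 + log_ratio (Suc n) h \<partial>increments)
      = (\<integral> h. ?r h \<partial>increments) - 1 + real (Suc n) * entropy_gap"
    using r_int L by (simp add: incr.prob_space)
  also have "\<dots> \<le> 0"
    using r_int(2) mult_nonneg_nonpos[OF _ gap, of "real (Suc n)"] by simp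
  finally have "(\<integral> h. ?r h - 1 + log_ratio (Suc n) h \<partial>increments) = 0"
    using integral_nonneg_AE[of "\<lambda>h. ?r h - 1 + log_ratio (Suc n) h" increments] pos by fastforce
  then have "AE h in increments. ?r h - 1 + log_ratio (Suc n) h = 0"
    using pos by (subst (asm) integral_nonneg_eq_0_iff_AE[OF int]) auto
  with pos show ?thesis by eventually_elim auto
qed

text \<open>
  Equality of the likelihoods is equality of the densities where the first one is positive. Since
  both integrate to \<open>1\<close>, the second one vanishes where the first one does.
\<close>

lemma translate_density_eq:
  assumes gap: "entropy_gap \<le> 0"
  shows "AE h in increments. AE c in whole.harmonic.
     whole.translate_density (position (Suc n) h) c = factor.translate_density (position (Suc n) h) (p c)"
proof -
  let ?u = whole.translate_density and ?v = "\<lambda>g c. factor.translate_density g (p c)"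
  have "(\<integral>\<^sup>+ h. (if ?u (position (Suc n) h) (\<beta> h) = ?v (position (Suc n) h) (\<beta> h) then 0 else 1) \<partial>increments) = 0"
  proof (subst nn_integral_0_iff_AE)
    show "AE h in increments. (if ?u (position (Suc n) h) (\<beta> h) = ?v (position (Suc n) h) (\<beta> h) then 0 else 1) = (0::ennreal)"
      using likelihood_eq[OF gap, of n]
      by eventually_elim (simp add: whole.likelihood_def factor.likelihood_def)
  qed measurable
  then have "(\<integral>\<^sup>+ h. \<integral>\<^sup>+ c. ennreal (?u (position (Suc n) h) c) *
      (if ?u (position (Suc n) h) c = ?v (position (Suc n) h) c then 0 else 1) \<partial>whole.harmonic \<partial>increments) = 0"
    by (subst (asm) whole.nn_integral_position_boundary[where F = "\<lambda>g c. if ?u g c = ?v g c then 0 else 1"])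
       measurable
  then have "AE h in increments. (\<integral>\<^sup>+ c. ennreal (?u (position (Suc n) h) c) *
      (if ?u (position (Suc n) h) c = ?v (position (Suc n) h) c then 0 else 1) \<partial>whole.harmonic) = 0"
    by (subst (asm) nn_integral_0_iff_AE) measurable
  then show ?thesis
    using whole.AE_quasi_invariant_position factor.AE_quasi_invariant_position AE_space
  proof eventually_elim
    case (elim h)
    define g where "g = position (Suc n) h"
    have "(\<integral>\<^sup>+ c. ennreal (?u g c) * (if ?u g c = ?v g c then 0 else 1) \<partial>whole.harmonic) = 0"
      using elim(1) by (simp add: g_def)
    then have "AE c in whole.harmonic. ennreal (?u g c) * (if ?u g c = ?v g c then 0 else 1) = 0"
      by (subst (asm) nn_integral_0_iff_AE) measurable
    then have le: "AE c in whole.harmonic. ?u g c \<le> ?v g c"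
    proof eventually_elim
      case (elim c)
      then show ?case using whole.translate_density_nonneg[of g c] factor.translate_density_nonneg[of g "p c"]
        by (cases "?u g c = ?v g c") (auto simp: ennreal_eq_0_iff)
    qed
    have u: "(\<integral>\<^sup>+ c. ennreal (?u g c) \<partial>whole.harmonic) = 1"
      unfolding g_def using elim by (intro whole.nn_integral_translate_density) auto
    have "(\<integral>\<^sup>+ c. ennreal (?v g c) \<partial>whole.harmonic) = (\<integral>\<^sup>+ c. ennreal (factor.translate_density g c) \<partial>factor.harmonic)"
      unfolding factor_harmonic by (subst nn_integral_distr) auto
    also have "\<dots> = 1"
      unfolding g_def using elim by (intro factor.nn_integral_translate_density) auto
    finally have v: "(\<integral>\<^sup>+ c. ennreal (?v g c) \<partial>whole.harmonic) = 1" .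
    have int: "integrable whole.harmonic (?u g)" "integrable whole.harmonic (?v g)"
      using u v by (auto intro!: integrableI_nonneg)
    have "(\<integral> c. ?u g c \<partial>whole.harmonic) = 1" "(\<integral> c. ?v g c \<partial>whole.harmonic) = 1"
      using u v by (simp_all add: integral_eq_nn_integral)
    then show ?case
      using integral_ineq_eq_0_then_AE[OF le int] by (simp add: g_def)
  qed
qed

text \<open>
  The conditional probability of \<open>E\<close> given the limit point depends only on the image of the latter in
  the factor.
\<close>

definition factor_conditioned :: "(nat \<Rightarrow> 'a) set \<Rightarrow> bool" where
  "factor_conditioned E \<longleftrightarrow> (\<exists>\<phi>\<in>borel_measurable N. \<forall>C\<in>sets M.
     emeasure increments (E \<inter> {h \<in> space increments. \<beta> h \<in> C}) =
     (\<integral>\<^sup>+ c. \<phi> (p c) * indicator C c \<partial>whole.harmonic))"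

lemma emeasure_boundary_event:
  "C \<in> sets M \<Longrightarrow> emeasure increments {h \<in> space increments. \<beta> h \<in> C} = emeasure whole.harmonic C"
  unfolding whole.harmonic_def
  by (subst emeasure_distr) (auto intro!: arg_cong[where f = "emeasure increments"])

text \<open>
  For an event determined by the first increments the conditional probability is the integral, over
  the event, of the density of the translate by the position, and this density comes from the factor.
\<close>

lemma factor_conditioned_past:
  assumes gap: "entropy_gap \<le> 0"
    and P [measurable]: "Measurable.pred increments P"
    and past: "\<And>h h'. (\<And>i. i < Suc n \<Longrightarrow> h i = h' i) \<Longrightarrow> P h \<longleftrightarrow> P h'"
  shows "factor_conditioned {h \<in> space increments. P h}"
  unfolding factor_conditioned_def
proof (intro bexI ballI)
  let ?g = "position (Suc n)" and ?v = factor.translate_density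
  let ?\<phi> = "\<lambda>d. \<integral>\<^sup>+ h. (if P h then ennreal (?v (?g h) d) else 0) \<partial>increments"
  show "?\<phi> \<in> borel_measurable N" by measurable
  fix C assume [measurable]: "C \<in> sets M"
  have "emeasure increments ({h \<in> space increments. P h} \<inter> {h \<in> space increments. \<beta> h \<in> C})
     = (\<integral>\<^sup>+ h. indicator ({h \<in> space increments. P h} \<inter> {h \<in> space increments. \<beta> h \<in> C}) h \<partial>increments)"
    by simp
  also have "\<dots> = (\<integral>\<^sup>+ h. (if P h then indicator C (\<beta> h) else 0) \<partial>increments)"
    by (intro nn_integral_cong) (auto simp: indicator_def)
  also have "\<dots> = (\<integral>\<^sup>+ h. \<integral>\<^sup>+ c. (if P h then indicator C (act (?g h) c) else 0) \<partial>whole.harmonic \<partial>increments)"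
  proof (rule whole.nn_integral_past_boundary[where F = "\<lambda>h c. if P h then indicator C c else 0"])
    show "(\<lambda>(h, c). if P h then indicator C c else 0 :: ennreal) \<in> borel_measurable (increments \<Otimes>\<^sub>M M)"
      by measurable
    fix h h' :: "nat \<Rightarrow> 'a" and c assume "\<And>i. i < Suc n \<Longrightarrow> h i = h' i"
    then have "P h \<longleftrightarrow> P h'" by (rule past)
    then show "(if P h then indicator C c else 0) = (if P h' then indicator C c else 0 :: ennreal)" by simp
  qed
  also have "\<dots> = (\<integral>\<^sup>+ h. \<integral>\<^sup>+ c. (if P h then ennreal (?v (?g h) (p c)) else 0) * indicator C c \<partial>whole.harmonic \<partial>increments)"
  proof (rule nn_integral_cong_AE)
    show "AE h in increments. (\<integral>\<^sup>+ c. (if P h then indicator C (act (?g h) c) else 0) \<partial>whole.harmonic)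
      = (\<integral>\<^sup>+ c. (if P h then ennreal (?v (?g h) (p c)) else 0) * indicator C c \<partial>whole.harmonic)"
      using translate_density_eq[OF gap, of n] whole.AE_quasi_invariant_position
    proof eventually_elim
      case (elim h)
      have "(\<integral>\<^sup>+ c. indicator C (act (?g h) c) \<partial>whole.harmonic)
        = (\<integral>\<^sup>+ c. ennreal (whole.translate_density (?g h) c) * indicator C c \<partial>whole.harmonic)"
        using elim by (intro whole.nn_integral_act) auto
      also have "\<dots> = (\<integral>\<^sup>+ c. ennreal (?v (?g h) (p c)) * indicator C c \<partial>whole.harmonic)"
        by (rule nn_integral_cong_AE) (use elim(1) in eventually_elim, simp)
      finally show ?case by (cases "P h") simp_all
    qed
  qed
  also have "\<dots> = (\<integral>\<^sup>+ c. \<integral>\<^sup>+ h. (if P h then ennreal (?v (?g h) (p c)) else 0) * indicator C c \<partial>increments \<partial>whole.harmonic)"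
  proof -
    interpret pair: pair_sigma_finite whole.harmonic increments ..
    show ?thesis by (rule pair.Fubini') measurable
  qed
  also have "\<dots> = (\<integral>\<^sup>+ c. ?\<phi> (p c) * indicator C c \<partial>whole.harmonic)"
  proof (rule nn_integral_cong)
    fix c assume "c \<in> space whole.harmonic"
    then have [measurable]: "p c \<in> space N" using measurable_space[OF measurable_factor_map] by simp
    show "(\<integral>\<^sup>+ h. (if P h then ennreal (?v (?g h) (p c)) else 0) * indicator C c \<partial>increments) = ?\<phi> (p c) * indicator C c"
      by (rule nn_integral_multc) measurable
  qed
  finally show "emeasure increments ({h \<in> space increments. P h} \<inter> {h \<in> space increments. \<beta> h \<in> C})
     = (\<integral>\<^sup>+ c. ?\<phi> (p c) * indicator C c \<partial>whole.harmonic)" .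
qed

lemma factor_conditioned_sets:
  assumes gap: "entropy_gap \<le> 0" and E: "E \<in> sets increments"
  shows "factor_conditioned E"
proof -
  have sets_eq: "sets increments = sigma_sets (space increments) (prod_algebra UNIV (\<lambda>_. \<mu>))"
    by (simp add: increments_def sets_PiM space_PiM)
  have sub: "prod_algebra UNIV (\<lambda>_. \<mu>) \<subseteq> Pow (space increments)"
    using prod_algebra_sets_into_space[of UNIV "\<lambda>_. \<mu>"] by (simp add: increments_def space_PiM)
  have "E \<in> sigma_sets (space increments) (prod_algebra UNIV (\<lambda>_. \<mu>))" using E sets_eq by simp
  then show ?thesis
  proof (induction rule: sigma_sets_induct_disjoint[OF Int_stable_prod_algebra sub, consumes 1, case_names basic empty compl union])
    case (basic A)
    obtain J X where A: "A = prod_emb UNIV (\<lambda>_. \<mu>) J (Pi\<^sub>E J X)" and J: "finite J"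
      and X: "\<And>i. i \<in> J \<Longrightarrow> X i \<in> sets \<mu>"
      using prod_algebraE[OF basic] by metis
    obtain n where n: "\<And>j. j \<in> J \<Longrightarrow> j < Suc n"
      using finite_nat_set_iff_bounded_le J by (auto simp: less_Suc_eq_le)
    have A_eq: "A = {h \<in> space increments. \<forall>j\<in>J. h j \<in> X j}"
      unfolding A prod_emb_def
      by (auto simp: increments_def space_PiM PiE_iff simp del: increment_in_carrier)
    have "A \<in> sets increments" using basic sets_eq by auto
    then have "Measurable.pred increments (\<lambda>h. \<forall>j\<in>J. h j \<in> X j)"
      by (simp only: A_eq pred_def)
    then show ?case
      unfolding A_eq
    proof (rule factor_conditioned_past[OF gap])
      fix h h' :: "nat \<Rightarrow> 'a" assume "\<And>i. i < Suc n \<Longrightarrow> h i = h' i"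
      then show "(\<forall>j\<in>J. h j \<in> X j) \<longleftrightarrow> (\<forall>j\<in>J. h' j \<in> X j)" using n by metis
    qed
  next
    case empty
    show ?case unfolding factor_conditioned_def by (rule bexI[of _ "\<lambda>_. 0"]) auto
  next
    case (compl A)
    then have A [measurable]: "A \<in> sets increments" using sets_eq by simp
    obtain \<phi> where \<phi> [measurable]: "\<phi> \<in> borel_measurable N"
      and eq: "\<And>C. C \<in> sets M \<Longrightarrow> emeasure increments (A \<inter> {h \<in> space increments. \<beta> h \<in> C}) =
         (\<integral>\<^sup>+ c. \<phi> (p c) * indicator C c \<partial>whole.harmonic)"
      using compl.IH unfolding factor_conditioned_def by auto
    have le: "(\<integral>\<^sup>+ c. \<phi> (p c) * indicator C c \<partial>whole.harmonic) \<le> emeasure whole.harmonic C" if "C \<in> sets M" for C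
    proof -
      note that [measurable]
      have "emeasure increments (A \<inter> {h \<in> space increments. \<beta> h \<in> C}) \<le> emeasure increments {h \<in> space increments. \<beta> h \<in> C}"
        by (rule emeasure_mono) auto
      then show ?thesis using that by (simp add: eq emeasure_boundary_event)
    qed
    \<comment> \<open>Without this bound the truncated difference \<open>1 - \<phi>\<close> would not have the right integrals.\<close>
    have le_1: "AE c in whole.harmonic. \<phi> (p c) \<le> 1"
      by (rule whole.harm.AE_le_1_if_nn_integral_le) (simp_all add: le)
    show ?case unfolding factor_conditioned_def
    proof (intro bexI ballI)
      show "(\<lambda>d. 1 - \<phi> d) \<in> borel_measurable N" by measurable
      fix C assume C [measurable]: "C \<in> sets M"
      let ?B = "{h \<in> space increments. \<beta> h \<in> C}"
      have "(space increments - A) \<inter> ?B = ?B - A \<inter> ?B" by auto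
      then have "emeasure increments ((space increments - A) \<inter> ?B) = emeasure increments ?B - emeasure increments (A \<inter> ?B)"
      proof (simp only:, intro emeasure_Diff)
        show "emeasure increments (A \<inter> ?B) \<noteq> \<infinity>" by (simp add: incr.emeasure_eq_measure)
      qed auto
      also have "\<dots> = (\<integral>\<^sup>+ c. indicator C c \<partial>whole.harmonic) - (\<integral>\<^sup>+ c. \<phi> (p c) * indicator C c \<partial>whole.harmonic)"
        using C by (simp add: eq emeasure_boundary_event)
      also have "\<dots> = (\<integral>\<^sup>+ c. indicator C c - \<phi> (p c) * indicator C c \<partial>whole.harmonic)"
      proof (rule nn_integral_diff[symmetric])
        show "(\<integral>\<^sup>+ c. \<phi> (p c) * indicator C c \<partial>whole.harmonic) \<noteq> \<infinity>"
          using le[OF C] by (auto simp: whole.harm.emeasure_eq_measure top_unique)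
        show "AE c in whole.harmonic. \<phi> (p c) * indicator C c \<le> indicator C c"
          using le_1 by eventually_elim (auto simp: indicator_def)
      qed measurable
      also have "\<dots> = (\<integral>\<^sup>+ c. (1 - \<phi> (p c)) * indicator C c \<partial>whole.harmonic)"
        by (intro nn_integral_cong) (auto simp: indicator_def)
      finally show "emeasure increments ((space increments - A) \<inter> ?B) =
        (\<integral>\<^sup>+ c. (1 - \<phi> (p c)) * indicator C c \<partial>whole.harmonic)" .
    qed
  next
    case (union A)
    have A [measurable]: "A i \<in> sets increments" for i using union.hyps sets_eq by auto
    have "\<exists>\<phi>. \<forall>i. \<phi> i \<in> borel_measurable N \<and> (\<forall>C\<in>sets M.
       emeasure increments (A i \<inter> {h \<in> space increments. \<beta> h \<in> C}) =
         (\<integral>\<^sup>+ c. \<phi> i (p c) * indicator C c \<partial>whole.harmonic))"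
      using union.IH unfolding factor_conditioned_def by (intro choice allI) auto
    then obtain \<phi> where \<phi> [measurable]: "\<And>i. \<phi> i \<in> borel_measurable N"
      and eq: "\<And>i C. C \<in> sets M \<Longrightarrow> emeasure increments (A i \<inter> {h \<in> space increments. \<beta> h \<in> C}) =
         (\<integral>\<^sup>+ c. \<phi> i (p c) * indicator C c \<partial>whole.harmonic)"
      by auto
    show ?case unfolding factor_conditioned_def
    proof (intro bexI ballI)
      show "(\<lambda>d. \<Sum>i. \<phi> i d) \<in> borel_measurable N" by measurable
      fix C assume C [measurable]: "C \<in> sets M"
      let ?B = "{h \<in> space increments. \<beta> h \<in> C}"
      have "emeasure increments ((\<Union>i. A i) \<inter> ?B) = emeasure increments (\<Union>i. A i \<inter> ?B)"
        by (simp add: Int_UN_distrib2)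
      also have "\<dots> = (\<Sum>i. emeasure increments (A i \<inter> ?B))"
      proof (rule suminf_emeasure[symmetric])
        show "disjoint_family (\<lambda>i. A i \<inter> ?B)"
          using union.hyps by (auto simp: disjoint_family_on_def)
      qed auto
      also have "\<dots> = (\<Sum>i. \<integral>\<^sup>+ c. \<phi> i (p c) * indicator C c \<partial>whole.harmonic)"
        by (simp add: eq C)
      also have "\<dots> = (\<integral>\<^sup>+ c. (\<Sum>i. \<phi> i (p c) * indicator C c) \<partial>whole.harmonic)"
        by (rule nn_integral_suminf[symmetric]) measurable
      also have "\<dots> = (\<integral>\<^sup>+ c. (\<Sum>i. \<phi> i (p c)) * indicator C c \<partial>whole.harmonic)"
        by simp
      finally show "emeasure increments ((\<Union>i. A i) \<inter> ?B) =
        (\<integral>\<^sup>+ c. (\<Sum>i. \<phi> i (p c)) * indicator C c \<partial>whole.harmonic)" .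
    qed
  qed
qed

text \<open>
  The event that the limit point lies in \<open>C0\<close> has the indicator of \<open>C0\<close> as its conditional probability given
  the limit point. By the above this indicator is a function on the factor.
\<close>

theorem boundary_event_is_factor_event:
  assumes gap: "entropy_gap \<le> 0" and C0 [measurable]: "C0 \<in> sets M"
  shows "\<exists>U\<in>sets N. AE c in whole.harmonic. c \<in> C0 \<longleftrightarrow> p c \<in> U"
proof -
  let ?E = "{h \<in> space increments. \<beta> h \<in> C0}"
  have "factor_conditioned ?E"
    by (rule factor_conditioned_sets[OF gap]) measurable
  then obtain \<phi> where \<phi> [measurable]: "\<phi> \<in> borel_measurable N"
    and eq: "\<And>C. C \<in> sets M \<Longrightarrow> emeasure increments (?E \<inter> {h \<in> space increments. \<beta> h \<in> C}) =
     (\<integral>\<^sup>+ c. \<phi> (p c) * indicator C c \<partial>whole.harmonic)"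
    unfolding factor_conditioned_def by auto
  have "density whole.harmonic (indicator C0) = density whole.harmonic (\<lambda>c. \<phi> (p c))"
  proof (rule measure_eqI)
    fix C assume "C \<in> sets (density whole.harmonic (indicator C0))"
    then have [measurable]: "C \<in> sets M" by simp
    have "?E \<inter> {h \<in> space increments. \<beta> h \<in> C} = {h \<in> space increments. \<beta> h \<in> C0 \<inter> C}" by auto
    then have "emeasure whole.harmonic (C0 \<inter> C) = (\<integral>\<^sup>+ c. \<phi> (p c) * indicator C c \<partial>whole.harmonic)"
      using eq[of C] emeasure_boundary_event[of "C0 \<inter> C"] by simp
    then show "emeasure (density whole.harmonic (indicator C0)) C = emeasure (density whole.harmonic (\<lambda>c. \<phi> (p c))) C"
      by (simp add: emeasure_density indicator_inter_arith[symmetric])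
  qed simp
  then have "AE c in whole.harmonic. indicator C0 c = \<phi> (p c)"
    by (subst (asm) whole.harm.density_unique_iff) auto
  then have "AE c in whole.harmonic. c \<in> C0 \<longleftrightarrow> p c \<in> {d \<in> space N. \<phi> d = 1}"
    using AE_space
  proof eventually_elim
    case (elim c)
    then show ?case using measurable_space[OF measurable_factor_map, of c]
      by (auto simp: indicator_def split: if_splits)
  qed
  moreover have "{d \<in> space N. \<phi> d = 1} \<in> sets N" by measurable
  ultimately show ?thesis by blast
qed

end

section \<open>Isomorphisms mod 0 and quotients by measurable partitions\<close>

lemma conull_sets_completion:
  assumes "M\<^sub>0 \<subseteq> space M" "space M - M\<^sub>0 \<in> null_sets (completion M)"
  shows "M\<^sub>0 \<in> sets (completion M)"
proof -
  have "M\<^sub>0 = space (completion M) - (space M - M\<^sub>0)" using assms(1) by auto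
  also have "\<dots> \<in> sets (completion M)" using assms(2) by (intro sets.compl_sets null_setsD2)
  finally show ?thesis .
qed

lemma sets_restrict_conull:
  assumes "M\<^sub>0 \<subseteq> space M" "space M - M\<^sub>0 \<in> null_sets (completion M)"
  shows "A \<in> sets (restrict_space (completion M) M\<^sub>0) \<longleftrightarrow> A \<subseteq> M\<^sub>0 \<and> A \<in> sets (completion M)"
  using conull_sets_completion[OF assms] assms(1)
  by (subst sets_restrict_space_iff) (auto simp: Int_absorb2)

lemma space_restrict_conull:
  "M\<^sub>0 \<subseteq> space M \<Longrightarrow> space (restrict_space (completion M) M\<^sub>0) = M\<^sub>0"
  by (auto simp: space_restrict_space)

lemma emeasure_restrict_conull:
  assumes "M\<^sub>0 \<subseteq> space M" "space M - M\<^sub>0 \<in> null_sets (completion M)" "A \<subseteq> M\<^sub>0"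
  shows "emeasure (restrict_space (completion M) M\<^sub>0) A = emeasure (completion M) A"
  using conull_sets_completion[OF assms(1,2)] assms
  by (subst emeasure_restrict_space) (auto simp: Int_absorb2)

lemma inv_into_vimage_eq_image:
  assumes "bij_betw f X Y" "A \<subseteq> X"
  shows "inv_into X f -` A \<inter> Y = f ` A"
  using assms by (auto simp: bij_betw_def inv_into_into f_inv_into_f image_iff)

text \<open>
  In this form isomorphisms mod 0 can be composed without handling restricted \<open>\<sigma>\<close>-algebras and
  inverse maps.
\<close>

lemma iso_mod0_iff:
  "iso_mod0 M N f \<longleftrightarrow> (\<exists>M\<^sub>0 N\<^sub>0.
     M\<^sub>0 \<subseteq> space M \<and> space M - M\<^sub>0 \<in> null_sets (completion M) \<and>
     N\<^sub>0 \<subseteq> space N \<and> space N - N\<^sub>0 \<in> null_sets (completion N) \<and> bij_betw f M\<^sub>0 N\<^sub>0 \<and>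
     (\<forall>A\<in>sets (completion M). A \<subseteq> M\<^sub>0 \<longrightarrow>
        f ` A \<in> sets (completion N) \<and> emeasure (completion N) (f ` A) = emeasure (completion M) A) \<and>
     (\<forall>B\<in>sets (completion N). B \<subseteq> N\<^sub>0 \<longrightarrow> f -` B \<inter> M\<^sub>0 \<in> sets (completion M)))"
  unfolding iso_mod0_def
proof (intro ex_cong1 iffI; elim conjE)
  fix M\<^sub>0 N\<^sub>0
  assume M0: "M\<^sub>0 \<subseteq> space M" "space M - M\<^sub>0 \<in> null_sets (completion M)"
    and N0: "N\<^sub>0 \<subseteq> space N" "space N - N\<^sub>0 \<in> null_sets (completion N)"
    and bij: "bij_betw f M\<^sub>0 N\<^sub>0"
    and f: "f \<in> restrict_space (completion M) M\<^sub>0 \<rightarrow>\<^sub>M restrict_space (completion N) N\<^sub>0"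
    and inv: "inv_into M\<^sub>0 f \<in> restrict_space (completion N) N\<^sub>0 \<rightarrow>\<^sub>M restrict_space (completion M) M\<^sub>0"
    and distr: "distr (restrict_space (completion M) M\<^sub>0) (restrict_space (completion N) N\<^sub>0) f
      = restrict_space (completion N) N\<^sub>0"
  note sM = sets_restrict_conull[OF M0] space_restrict_conull[OF M0(1)]
  note sN = sets_restrict_conull[OF N0] space_restrict_conull[OF N0(1)]
  have image: "f ` A \<in> sets (completion N) \<and> emeasure (completion N) (f ` A) = emeasure (completion M) A"
    if A: "A \<in> sets (completion M)" "A \<subseteq> M\<^sub>0" for A
  proof -
    have "f ` A \<in> sets (restrict_space (completion N) N\<^sub>0)"
      using measurable_sets[OF inv, of A] A inv_into_vimage_eq_image[OF bij A(2)] by (simp add: sM sN)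
    then have fA: "f ` A \<in> sets (completion N)" "f ` A \<subseteq> N\<^sub>0"
      "f ` A \<in> sets (restrict_space (completion N) N\<^sub>0)" by (auto simp: sN)
    have "emeasure (completion N) (f ` A) =
        emeasure (distr (restrict_space (completion M) M\<^sub>0) (restrict_space (completion N) N\<^sub>0) f) (f ` A)"
      unfolding distr using fA by (simp add: emeasure_restrict_conull[OF N0])
    also have "\<dots> = emeasure (restrict_space (completion M) M\<^sub>0) (f -` f ` A \<inter> M\<^sub>0)"
      using fA by (subst emeasure_distr[OF f]) (auto simp: sM)
    also have "f -` f ` A \<inter> M\<^sub>0 = A"
      using bij A(2) by (auto simp: bij_betw_def inj_on_def)
    finally show ?thesis using fA A by (simp add: emeasure_restrict_conull[OF M0])
  qed
  have "f -` B \<inter> M\<^sub>0 \<in> sets (completion M)" if "B \<in> sets (completion N)" "B \<subseteq> N\<^sub>0" for B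
    using measurable_sets[OF f, of B] that by (simp add: sM sN)
  with image M0 N0 bij show "M\<^sub>0 \<subseteq> space M \<and> space M - M\<^sub>0 \<in> null_sets (completion M) \<and>
     N\<^sub>0 \<subseteq> space N \<and> space N - N\<^sub>0 \<in> null_sets (completion N) \<and> bij_betw f M\<^sub>0 N\<^sub>0 \<and>
     (\<forall>A\<in>sets (completion M). A \<subseteq> M\<^sub>0 \<longrightarrow>
        f ` A \<in> sets (completion N) \<and> emeasure (completion N) (f ` A) = emeasure (completion M) A) \<and>
     (\<forall>B\<in>sets (completion N). B \<subseteq> N\<^sub>0 \<longrightarrow> f -` B \<inter> M\<^sub>0 \<in> sets (completion M))"
    by blast
next
  fix M\<^sub>0 N\<^sub>0
  assume M0: "M\<^sub>0 \<subseteq> space M" "space M - M\<^sub>0 \<in> null_sets (completion M)"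
    and N0: "N\<^sub>0 \<subseteq> space N" "space N - N\<^sub>0 \<in> null_sets (completion N)"
    and bij: "bij_betw f M\<^sub>0 N\<^sub>0"
    and image: "\<forall>A\<in>sets (completion M). A \<subseteq> M\<^sub>0 \<longrightarrow>
        f ` A \<in> sets (completion N) \<and> emeasure (completion N) (f ` A) = emeasure (completion M) A"
    and vimage: "\<forall>B\<in>sets (completion N). B \<subseteq> N\<^sub>0 \<longrightarrow> f -` B \<inter> M\<^sub>0 \<in> sets (completion M)"
  note sM = sets_restrict_conull[OF M0] space_restrict_conull[OF M0(1)]
  note sN = sets_restrict_conull[OF N0] space_restrict_conull[OF N0(1)]
  have f: "f \<in> restrict_space (completion M) M\<^sub>0 \<rightarrow>\<^sub>M restrict_space (completion N) N\<^sub>0"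
  proof (rule measurableI)
    show "x \<in> space (restrict_space (completion M) M\<^sub>0) \<Longrightarrow> f x \<in> space (restrict_space (completion N) N\<^sub>0)" for x
      using bij unfolding sM sN by (auto simp: bij_betw_def)
    show "B \<in> sets (restrict_space (completion N) N\<^sub>0) \<Longrightarrow>
        f -` B \<inter> space (restrict_space (completion M) M\<^sub>0) \<in> sets (restrict_space (completion M) M\<^sub>0)" for B
      using vimage unfolding sM sN by auto
  qed
  have inv: "inv_into M\<^sub>0 f \<in> restrict_space (completion N) N\<^sub>0 \<rightarrow>\<^sub>M restrict_space (completion M) M\<^sub>0"
  proof (rule measurableI)
    show "y \<in> space (restrict_space (completion N) N\<^sub>0) \<Longrightarrow> inv_into M\<^sub>0 f y \<in> space (restrict_space (completion M) M\<^sub>0)" for y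
      using bij unfolding sM sN by (auto simp: bij_betw_def inv_into_into)
    show "inv_into M\<^sub>0 f -` A \<inter> space (restrict_space (completion N) N\<^sub>0) \<in> sets (restrict_space (completion N) N\<^sub>0)"
      if "A \<in> sets (restrict_space (completion M) M\<^sub>0)" for A
    proof -
      have A: "A \<subseteq> M\<^sub>0" "A \<in> sets (completion M)" using that unfolding sM by auto
      then have "f ` A \<subseteq> N\<^sub>0" using bij by (auto simp: bij_betw_def)
      then show ?thesis using image A unfolding sN inv_into_vimage_eq_image[OF bij A(1)] by auto
    qed
  qed
  have "distr (restrict_space (completion M) M\<^sub>0) (restrict_space (completion N) N\<^sub>0) f
      = restrict_space (completion N) N\<^sub>0"
  proof (rule measure_eqI)
    fix B assume "B \<in> sets (distr (restrict_space (completion M) M\<^sub>0) (restrict_space (completion N) N\<^sub>0) f)"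
    then have B': "B \<in> sets (restrict_space (completion N) N\<^sub>0)" by simp
    then have B: "B \<subseteq> N\<^sub>0" "B \<in> sets (completion N)" unfolding sN by auto
    have im: "f ` (f -` B \<inter> M\<^sub>0) = B" using bij B(1) unfolding bij_betw_def by blast
    have "emeasure (distr (restrict_space (completion M) M\<^sub>0) (restrict_space (completion N) N\<^sub>0) f) B
      = emeasure (restrict_space (completion M) M\<^sub>0) (f -` B \<inter> M\<^sub>0)"
      using B' by (subst emeasure_distr[OF f]) (auto simp: sM)
    also have "\<dots> = emeasure (completion M) (f -` B \<inter> M\<^sub>0)"
      by (rule emeasure_restrict_conull[OF M0]) auto
    also have "\<dots> = emeasure (completion N) B"
      using image[rule_format, of "f -` B \<inter> M\<^sub>0"] vimage B im by auto
    also have "\<dots> = emeasure (restrict_space (completion N) N\<^sub>0) B"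
      by (rule emeasure_restrict_conull[OF N0 B(1), symmetric])
    finally show "emeasure (distr (restrict_space (completion M) M\<^sub>0) (restrict_space (completion N) N\<^sub>0) f) B
      = emeasure (restrict_space (completion N) N\<^sub>0) B" .
  qed simp
  with M0 N0 bij f inv show "M\<^sub>0 \<subseteq> space M \<and> space M - M\<^sub>0 \<in> null_sets (completion M) \<and>
       N\<^sub>0 \<subseteq> space N \<and> space N - N\<^sub>0 \<in> null_sets (completion N) \<and> bij_betw f M\<^sub>0 N\<^sub>0 \<and>
       f \<in> restrict_space (completion M) M\<^sub>0 \<rightarrow>\<^sub>M restrict_space (completion N) N\<^sub>0 \<and>
       inv_into M\<^sub>0 f \<in> restrict_space (completion N) N\<^sub>0 \<rightarrow>\<^sub>M restrict_space (completion M) M\<^sub>0 \<and>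
       distr (restrict_space (completion M) M\<^sub>0) (restrict_space (completion N) N\<^sub>0) f
         = restrict_space (completion N) N\<^sub>0"
    by blast
qed

lemma null_sets_completion_mono:
  "B \<in> null_sets (completion M) \<Longrightarrow> A \<subseteq> B \<Longrightarrow> A \<in> null_sets (completion M)"
  using completion.complete2 by blast

lemma iso_mod0_trans:
  assumes "iso_mod0 M N f" "iso_mod0 N P g"
  shows "iso_mod0 M P (g \<circ> f)"
proof -
  obtain M\<^sub>0 N\<^sub>0 where M0: "M\<^sub>0 \<subseteq> space M" "space M - M\<^sub>0 \<in> null_sets (completion M)"
    and N0: "N\<^sub>0 \<subseteq> space N" "space N - N\<^sub>0 \<in> null_sets (completion N)"
    and f: "bij_betw f M\<^sub>0 N\<^sub>0"
    and f_image': "\<forall>A\<in>sets (completion M). A \<subseteq> M\<^sub>0 \<longrightarrow>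
        f ` A \<in> sets (completion N) \<and> emeasure (completion N) (f ` A) = emeasure (completion M) A"
    and f_vimage': "\<forall>B\<in>sets (completion N). B \<subseteq> N\<^sub>0 \<longrightarrow> f -` B \<inter> M\<^sub>0 \<in> sets (completion M)"
    using assms(1) unfolding iso_mod0_iff by (elim exE conjE)
  note f_image = f_image'[rule_format] and f_vimage = f_vimage'[rule_format]
  obtain N\<^sub>1 P\<^sub>1 where N1: "N\<^sub>1 \<subseteq> space N" "space N - N\<^sub>1 \<in> null_sets (completion N)"
    and P1: "P\<^sub>1 \<subseteq> space P" "space P - P\<^sub>1 \<in> null_sets (completion P)"
    and g: "bij_betw g N\<^sub>1 P\<^sub>1"
    and g_image': "\<forall>A\<in>sets (completion N). A \<subseteq> N\<^sub>1 \<longrightarrow>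
        g ` A \<in> sets (completion P) \<and> emeasure (completion P) (g ` A) = emeasure (completion N) A"
    and g_vimage': "\<forall>B\<in>sets (completion P). B \<subseteq> P\<^sub>1 \<longrightarrow> g -` B \<inter> N\<^sub>1 \<in> sets (completion N)"
    using assms(2) unfolding iso_mod0_iff by (elim exE conjE)
  note g_image = g_image'[rule_format] and g_vimage = g_vimage'[rule_format]
  define N\<^sub>2 where "N\<^sub>2 = N\<^sub>0 \<inter> N\<^sub>1"
  define M\<^sub>2 where "M\<^sub>2 = f -` N\<^sub>2 \<inter> M\<^sub>0"
  define P\<^sub>2 where "P\<^sub>2 = g ` N\<^sub>2"
  have inj_f: "inj_on f M\<^sub>0" and im_f: "f ` M\<^sub>0 = N\<^sub>0" using f by (auto simp: bij_betw_def)
  have inj_g: "inj_on g N\<^sub>1" and im_g: "g ` N\<^sub>1 = P\<^sub>1" using g by (auto simp: bij_betw_def)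
  have im_f2: "f ` M\<^sub>2 = N\<^sub>2" using im_f unfolding M\<^sub>2_def N\<^sub>2_def by blast
  have M2: "M\<^sub>2 \<subseteq> space M" using M0 by (auto simp: M\<^sub>2_def)
  have P2: "P\<^sub>2 \<subseteq> space P" using P1 im_g by (auto simp: P\<^sub>2_def N\<^sub>2_def)
  have M2_null: "space M - M\<^sub>2 \<in> null_sets (completion M)"
  proof -
    have Z: "N\<^sub>0 - N\<^sub>2 \<in> null_sets (completion N)"
      using N0(1) by (intro null_sets_completion_mono[OF N1(2)]) (auto simp: N\<^sub>2_def)
    have A: "f -` (N\<^sub>0 - N\<^sub>2) \<inter> M\<^sub>0 \<in> sets (completion M)" using Z by (intro f_vimage) auto
    have "f ` (f -` (N\<^sub>0 - N\<^sub>2) \<inter> M\<^sub>0) = N\<^sub>0 - N\<^sub>2" using im_f by blast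
    then have "f -` (N\<^sub>0 - N\<^sub>2) \<inter> M\<^sub>0 \<in> null_sets (completion M)"
      using f_image[OF A] Z A by (auto simp: null_sets_def)
    moreover have "space M - M\<^sub>2 \<subseteq> (space M - M\<^sub>0) \<union> (f -` (N\<^sub>0 - N\<^sub>2) \<inter> M\<^sub>0)"
      using im_f by (auto simp: M\<^sub>2_def)
    ultimately show ?thesis by (rule null_sets_completion_mono[OF null_sets.Un[OF M0(2)]])
  qed
  have P2_null: "space P - P\<^sub>2 \<in> null_sets (completion P)"
  proof -
    have Z: "N\<^sub>1 - N\<^sub>2 \<in> null_sets (completion N)"
      using N1(1) by (intro null_sets_completion_mono[OF N0(2)]) (auto simp: N\<^sub>2_def)
    then have "g ` (N\<^sub>1 - N\<^sub>2) \<in> null_sets (completion P)"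
      using g_image[of "N\<^sub>1 - N\<^sub>2"] by (auto simp: null_sets_def)
    moreover have "space P - P\<^sub>2 \<subseteq> (space P - P\<^sub>1) \<union> g ` (N\<^sub>1 - N\<^sub>2)"
      using im_g by (auto simp: P\<^sub>2_def)
    ultimately show ?thesis by (rule null_sets_completion_mono[OF null_sets.Un[OF P1(2)]])
  qed
  have bij: "bij_betw (g \<circ> f) M\<^sub>2 P\<^sub>2"
    unfolding bij_betw_def
  proof
    show "inj_on (g \<circ> f) M\<^sub>2"
      using im_f2 by (intro comp_inj_on inj_on_subset[OF inj_f] inj_on_subset[OF inj_g])
        (auto simp: M\<^sub>2_def N\<^sub>2_def)
    show "(g \<circ> f) ` M\<^sub>2 = P\<^sub>2" by (simp only: image_comp[symmetric] im_f2 P\<^sub>2_def)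
  qed
  have image: "(g \<circ> f) ` A \<in> sets (completion P) \<and> emeasure (completion P) ((g \<circ> f) ` A) = emeasure (completion M) A"
    if "A \<in> sets (completion M)" "A \<subseteq> M\<^sub>2" for A
  proof -
    have "A \<subseteq> M\<^sub>0" "f ` A \<subseteq> N\<^sub>1" using that by (auto simp: M\<^sub>2_def N\<^sub>2_def)
    then show ?thesis using f_image[OF that(1)] g_image[of "f ` A"] by (simp only: image_comp[symmetric])
  qed
  have vimage: "(g \<circ> f) -` B \<inter> M\<^sub>2 \<in> sets (completion M)"
    if B: "B \<in> sets (completion P)" "B \<subseteq> P\<^sub>2" for B
  proof -
    have "P\<^sub>2 \<subseteq> P\<^sub>1" using im_g by (auto simp: P\<^sub>2_def N\<^sub>2_def)
    then have g_B: "g -` B \<inter> N\<^sub>1 \<in> sets (completion N)" using B by (intro g_vimage) auto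
    have "g -` B \<inter> N\<^sub>1 \<subseteq> N\<^sub>2"
    proof
      fix y assume y: "y \<in> g -` B \<inter> N\<^sub>1"
      then obtain z where "z \<in> N\<^sub>2" "g y = g z" using B(2) by (auto simp: P\<^sub>2_def)
      then show "y \<in> N\<^sub>2" using inj_onD[OF inj_g, of y z] y by (auto simp: N\<^sub>2_def)
    qed
    then have "f -` (g -` B \<inter> N\<^sub>1) \<inter> M\<^sub>0 \<in> sets (completion M)"
      using g_B by (intro f_vimage) (auto simp: N\<^sub>2_def)
    moreover have "f -` (g -` B \<inter> N\<^sub>1) \<inter> M\<^sub>0 = (g \<circ> f) -` B \<inter> M\<^sub>2"
      using \<open>g -` B \<inter> N\<^sub>1 \<subseteq> N\<^sub>2\<close> by (auto simp: M\<^sub>2_def N\<^sub>2_def)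
    ultimately show ?thesis by simp
  qed
  show ?thesis unfolding iso_mod0_iff
    using M2 M2_null P2 P2_null bij image vimage by blast
qed

text \<open>
  The measurability of the images replaces that of the inverse map. Only sets of the \<open>\<sigma>\<close>-algebra itself,
  not of its completion, have to be considered, because the image of a subset of a null set is covered by the image
  of the null set.
\<close>

lemma iso_mod0_distrI:
  assumes f [measurable]: "f \<in> M \<rightarrow>\<^sub>M N"
    and M0: "M\<^sub>0 \<in> sets M" "AE x in M. x \<in> M\<^sub>0"
    and inj: "inj_on f M\<^sub>0"
    and image: "\<And>A. A \<in> sets M \<Longrightarrow> A \<subseteq> M\<^sub>0 \<Longrightarrow> f ` A \<in> sets N"
  shows "iso_mod0 M (distr M N f) f"
proof -
  have null: "space M - M\<^sub>0 \<in> null_sets M"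
    using M0 by (subst AE_iff_null_sets) auto
  have emeasure_image: "emeasure (distr M N f) (f ` A) = emeasure M A"
    if A: "A \<in> sets M" "A \<subseteq> M\<^sub>0" for A
  proof -
    have "emeasure (distr M N f) (f ` A) = emeasure M (f -` f ` A \<inter> space M)"
      by (rule emeasure_distr[OF f image[OF A]])
    also have "\<dots> = emeasure M A"
    proof (rule emeasure_eq_AE)
      show "AE x in M. x \<in> f -` f ` A \<inter> space M \<longleftrightarrow> x \<in> A"
        using M0(2) AE_space
        by eventually_elim (use A inj in \<open>auto simp: inj_on_def\<close>)
    qed (use A image[OF A] in auto)
    finally show ?thesis .
  qed
  show ?thesis unfolding iso_mod0_iff
  proof (intro exI conjI ballI impI)
    show M0_sub: "M\<^sub>0 \<subseteq> space M" using M0(1) by (rule sets.sets_into_space)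
    show "space M - M\<^sub>0 \<in> null_sets (completion M)" using null by (rule null_sets_completionI)
    show "f ` M\<^sub>0 \<subseteq> space (distr M N f)"
      using M0_sub measurable_space[OF f] by auto
    have fM0: "f ` M\<^sub>0 \<in> sets N" using M0 by (intro image) auto
    have "emeasure (distr M N f) (space N - f ` M\<^sub>0) \<le> emeasure M (space M - M\<^sub>0)"
      using fM0 by (subst emeasure_distr) (auto intro!: emeasure_mono M0)
    then have "space N - f ` M\<^sub>0 \<in> null_sets (distr M N f)"
      using fM0 null by (auto simp: null_sets_def)
    then show "space (distr M N f) - f ` M\<^sub>0 \<in> null_sets (completion (distr M N f))"
      by (simp add: null_sets_completionI)
    show "bij_betw f M\<^sub>0 (f ` M\<^sub>0)" using inj by (simp add: bij_betw_def)
  next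
    fix A assume "A \<in> sets (completion M)" and sub: "A \<subseteq> M\<^sub>0"
    then obtain S Z Z' where A: "A = S \<union> Z" "S \<in> sets M" "Z \<subseteq> Z'" "Z' \<in> null_sets M"
      by (auto elim: sets_completionE)
    have S: "S \<in> sets M" "S \<subseteq> M\<^sub>0" using A sub by auto
    have Z'': "Z' \<inter> M\<^sub>0 \<in> sets M" "Z' \<inter> M\<^sub>0 \<subseteq> M\<^sub>0" using A M0 by auto
    have "emeasure M (Z' \<inter> M\<^sub>0) = 0"
      using null_set_Int2[OF A(4) M0(1)] by (rule null_setsD1)
    then have nullZ: "f ` (Z' \<inter> M\<^sub>0) \<in> null_sets (distr M N f)"
      using image[OF Z''] emeasure_image[OF Z''] by (auto simp: null_sets_def)
    have fZ: "f ` Z \<subseteq> f ` (Z' \<inter> M\<^sub>0)" using A sub by auto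
    have fA: "f ` A = f ` S \<union> f ` Z" using A by auto
    show "f ` A \<in> sets (completion (distr M N f))"
      using image[OF S] nullZ fZ by (intro sets_completionI[OF fA]) auto
    have "emeasure (completion (distr M N f)) (f ` A) = emeasure (completion (distr M N f)) (f ` S)"
      unfolding fA
    proof (rule emeasure_Un_null_set)
      show "f ` S \<in> sets (completion (distr M N f))" using image[OF S] by simp
      show "f ` Z \<in> null_sets (completion (distr M N f))"
        by (rule null_sets_completion_mono[OF null_sets_completionI[OF nullZ] fZ])
    qed
    also have "\<dots> = emeasure M S" using image[OF S] emeasure_image[OF S] by simp
    also have "\<dots> = emeasure (completion M) (S \<union> Z)"
    proof (subst emeasure_Un_null_set)
      show "S \<in> sets (completion M)" using S by simp
      show "Z \<in> null_sets (completion M)"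
        by (rule null_sets_completion_mono[OF null_sets_completionI[OF A(4)] A(3)])
    qed (use S in simp)
    finally show "emeasure (completion (distr M N f)) (f ` A) = emeasure (completion M) A" using A by simp
  next
    fix B assume "B \<in> sets (completion (distr M N f))"
    then obtain S Z Z' where B: "B = S \<union> Z" "S \<in> sets N" "Z \<subseteq> Z'" "Z' \<in> null_sets (distr M N f)"
      by (auto elim: sets_completionE)
    have "f -` Z' \<inter> space M \<in> null_sets M"
      using B(4) f by (auto simp: null_sets_def emeasure_distr)
    moreover have "f -` B \<inter> M\<^sub>0 = (f -` S \<inter> M\<^sub>0) \<union> (f -` Z \<inter> M\<^sub>0)" using B by auto
    moreover have "f -` Z \<inter> M\<^sub>0 \<subseteq> f -` Z' \<inter> space M" using B M0 sets.sets_into_space by blast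
    moreover have "f -` S \<inter> M\<^sub>0 \<in> sets M"
    proof -
      have "f -` S \<inter> M\<^sub>0 = (f -` S \<inter> space M) \<inter> M\<^sub>0" using M0(1) sets.sets_into_space by blast
      then show ?thesis using B(2) M0(1) by simp
    qed
    ultimately show "f -` B \<inter> M\<^sub>0 \<in> sets (completion M)"
      by (intro sets_completionI) auto
  qed
qed

lemma quotient_map_eq:
  assumes "partition_on X \<xi>" "D \<in> \<xi>" "x \<in> D"
  shows "quotient_map \<xi> x = D"
  unfolding quotient_map_def
  using assms by (intro the_equality) (auto simp: partition_on_def disjoint_def)

lemma quotient_map_mem:
  assumes "partition_on X \<xi>" "x \<in> X"
  shows "quotient_map \<xi> x \<in> \<xi>" "x \<in> quotient_map \<xi> x"
proof -
  obtain D where "D \<in> \<xi>" "x \<in> D" using assms by (auto simp: partition_on_def)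
  then show "quotient_map \<xi> x \<in> \<xi>" "x \<in> quotient_map \<xi> x"
    using quotient_map_eq[OF assms(1)] by auto
qed

lemma quotient_map_mem_iff:
  assumes "partition_on X \<xi>" "U \<subseteq> \<xi>" "x \<in> X"
  shows "quotient_map \<xi> x \<in> U \<longleftrightarrow> x \<in> \<Union>U"
proof
  assume "quotient_map \<xi> x \<in> U"
  then show "x \<in> \<Union>U" using quotient_map_mem(2)[OF assms(1,3)] by (rule UnionI)
next
  assume "x \<in> \<Union>U"
  then obtain D where D: "D \<in> U" "x \<in> D" by (rule UnionE)
  then show "quotient_map \<xi> x \<in> U"
    using quotient_map_eq[OF assms(1), of D x] assms(2) by (simp add: subsetD)
qed

definition quotient_algebra :: "'a measure \<Rightarrow> 'a set set \<Rightarrow> 'a set measure" where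
  "quotient_algebra M \<xi> = sigma \<xi> {U. U \<subseteq> \<xi> \<and> \<Union>U \<in> sets M}"

lemma space_quotient_algebra [simp]: "space (quotient_algebra M \<xi>) = \<xi>"
  unfolding quotient_algebra_def by (rule space_measure_of) auto

lemma sets_quotient_algebra:
  assumes part: "partition_on (space M) \<xi>"
  shows "sets (quotient_algebra M \<xi>) = {U. U \<subseteq> \<xi> \<and> \<Union>U \<in> sets M}"
proof -
  have "sigma_algebra \<xi> {U. U \<subseteq> \<xi> \<and> \<Union>U \<in> sets M}"
    unfolding sigma_algebra_iff2
  proof (intro conjI ballI allI impI)
    fix U assume U: "U \<in> {U. U \<subseteq> \<xi> \<and> \<Union>U \<in> sets M}"
    have "\<Union>(\<xi> - U) = space M - \<Union>U"
    proof (rule Set.set_eqI)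
      fix x
      have "x \<in> \<Union>(\<xi> - U) \<Longrightarrow> x \<in> space M"
        using partition_onD1[OF part] by auto
      moreover have "x \<in> \<Union>(\<xi> - U) \<longleftrightarrow> x \<notin> \<Union>U" if x: "x \<in> space M"
      proof -
        have "x \<in> \<Union>(\<xi> - U) \<longleftrightarrow> quotient_map \<xi> x \<in> \<xi> - U"
          by (rule quotient_map_mem_iff[OF part _ x, symmetric]) auto
        also have "\<dots> \<longleftrightarrow> quotient_map \<xi> x \<notin> U"
          using quotient_map_mem(1)[OF part x] by simp
        also have "\<dots> \<longleftrightarrow> x \<notin> \<Union>U"
          using quotient_map_mem_iff[OF part _ x, of U] U by simp
        finally show ?thesis .
      qed
      ultimately show "x \<in> \<Union>(\<xi> - U) \<longleftrightarrow> x \<in> space M - \<Union>U" by blast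
    qed
    then show "\<xi> - U \<in> {U. U \<subseteq> \<xi> \<and> \<Union>U \<in> sets M}" using U by auto
  next
    fix U :: "nat \<Rightarrow> 'a set set" assume U: "range U \<subseteq> {U. U \<subseteq> \<xi> \<and> \<Union>U \<in> sets M}"
    have "\<Union>(\<Union>i. U i) = (\<Union>i. \<Union>(U i))" by auto
    also have "\<dots> \<in> sets M" using U by (intro sets.countable_UN) auto
    finally have "\<Union>(\<Union>i. U i) \<in> sets M" .
    then show "(\<Union>i. U i) \<in> {U. U \<subseteq> \<xi> \<and> \<Union>U \<in> sets M}" using U by auto
  qed auto
  then show ?thesis
    unfolding quotient_algebra_def by (rule sigma_algebra.sets_measure_of_eq)
qed

lemma measurable_quotient_map:
  assumes part: "partition_on (space M) \<xi>"
  shows "quotient_map \<xi> \<in> M \<rightarrow>\<^sub>M quotient_algebra M \<xi>"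
proof (rule measurableI)
  show "x \<in> space M \<Longrightarrow> quotient_map \<xi> x \<in> space (quotient_algebra M \<xi>)" for x
    using quotient_map_mem[OF part] by simp
  fix U assume "U \<in> sets (quotient_algebra M \<xi>)"
  then have U: "U \<subseteq> \<xi>" "\<Union>U \<in> sets M" by (auto simp: sets_quotient_algebra[OF part])
  have "x \<in> quotient_map \<xi> -` U \<inter> space M \<longleftrightarrow> x \<in> \<Union>U" for x
  proof (cases "x \<in> space M")
    case True
    then show ?thesis using quotient_map_mem_iff[OF part U(1) True] by simp
  next
    case False
    then have "x \<notin> \<Union>U" using sets.sets_into_space[OF U(2)] by (metis subsetD)
    with False show ?thesis by simp
  qed
  then have "quotient_map \<xi> -` U \<inter> space M = \<Union>U" by (rule Set.set_eqI)
  then show "quotient_map \<xi> -` U \<inter> space M \<in> sets M" using U by simp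
qed

lemma quotient_measure_eq:
  "sets \<nu> = sets M \<Longrightarrow> quotient_measure \<nu> \<xi> = distr \<nu> (quotient_algebra M \<xi>) (quotient_map \<xi>)"
  by (simp add: quotient_measure_def quotient_algebra_def)

text \<open>
  A function is recovered from its sublevel sets at rational levels, hence from the
  sets of the factor which agree with them.
\<close>

lemma factor_real_function_AE:
  fixes f :: "'a \<Rightarrow> real"
  assumes f [measurable]: "f \<in> borel_measurable M" and q [measurable]: "q \<in> M \<rightarrow>\<^sub>M N"
    and approx: "\<And>C. C \<in> sets M \<Longrightarrow> \<exists>U\<in>sets N. AE x in M. x \<in> C \<longleftrightarrow> q x \<in> U"
  shows "\<exists>F\<in>borel_measurable N. AE x in M. F (q x) = f x"
proof -
  have "\<forall>r::rat. \<exists>U. U \<in> sets N \<and> (AE x in M. x \<in> {x\<in>space M. f x < of_rat r} \<longleftrightarrow> q x \<in> U)"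
  proof
    fix r :: rat
    have "{x\<in>space M. f x < of_rat r} \<in> sets M" by measurable
    from approx[OF this] show "\<exists>U. U \<in> sets N \<and> (AE x in M. x \<in> {x\<in>space M. f x < of_rat r} \<longleftrightarrow> q x \<in> U)"
      by (simp only: Bex_def)
  qed
  from choice[OF this] obtain U where U_all: "\<forall>r::rat. U r \<in> sets N \<and>
      (AE x in M. x \<in> {x\<in>space M. f x < of_rat r} \<longleftrightarrow> q x \<in> U r)" ..
  then have U [measurable]: "U r \<in> sets N"
    and U_eq: "AE x in M. x \<in> {x\<in>space M. f x < of_rat r} \<longleftrightarrow> q x \<in> U r" for r
    by simp_all
  \<comment> \<open>The infimum of the rational levels above \<open>f\<close>; the extended reals allow for points of the factor without such a level.\<close>
  define F where "F d = (INF r::rat. if d \<in> U r then ereal (of_rat r) else \<infinity>)" for d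
  have F [measurable]: "F \<in> borel_measurable N"
    unfolding F_def by measurable
  have "AE x in M. \<forall>r. x \<in> {x\<in>space M. f x < of_rat r} \<longleftrightarrow> q x \<in> U r"
    using U_eq by (subst AE_all_countable) auto
  then have "AE x in M. F (q x) = ereal (f x)"
    using AE_space
  proof eventually_elim
    case (elim x)
    have "F (q x) = (INF r::rat. if f x < of_rat r then ereal (of_rat r) else \<infinity>)"
      using elim by (auto simp: F_def)
    also have "\<dots> = ereal (f x)"
    proof (rule antisym)
      show "ereal (f x) \<le> (INF r::rat. if f x < of_rat r then ereal (of_rat r) else \<infinity>)"
        by (intro INF_greatest) auto
      show "(INF r::rat. if f x < of_rat r then ereal (of_rat r) else \<infinity>) \<le> ereal (f x)"
      proof (rule dense_ge)
        fix y assume "ereal (f x) < y"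
        then obtain z where z: "ereal (f x) < ereal z" "ereal z < y" using ereal_dense2 by blast
        then obtain r where r: "f x < of_rat r" "of_rat r < z" using of_rat_dense by auto
        have "(INF r::rat. if f x < of_rat r then ereal (of_rat r) else \<infinity>) \<le> ereal (of_rat r)"
          using r by (intro INF_lower2[of r]) auto
        also have "\<dots> \<le> y" using r z by (metis ereal_less_eq(3) less_imp_le order_trans)
        finally show "(INF r::rat. if f x < of_rat r then ereal (of_rat r) else \<infinity>) \<le> y" .
      qed
    qed
    finally show ?case .
  qed
  then have "AE x in M. real_of_ereal (F (q x)) = f x" by eventually_elim simp
  then show ?thesis by (intro bexI[of _ "\<lambda>d. real_of_ereal (F d)"]) auto
qed

text \<open>
  Code \<open>\<Gamma>\<close> as a Borel set of reals by \<open>f\<close>, with inverse \<open>g\<close>, and let \<open>F\<close> be a function on the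
  quotient that agrees with \<open>f\<close> almost everywhere. Then \<open>g \<circ> F\<close> recovers a point from its class, so \<open>q\<close> is
  injective on the conull set where the two functions agree. The classes which contain the point chosen
  by \<open>g \<circ> F\<close> form a measurable set because the partition has a countable basis; this gives the measurability of the
  image of the conull set, which fails for images of Borel sets in general.
\<close>

theorem iso_mod0_quotient_map:
  fixes \<Gamma> :: "'c measure"
  assumes std: "standard_borel \<Gamma>" and part: "measurable_partition \<Gamma> \<xi>" and sets: "sets \<nu> = sets \<Gamma>"
    and approx: "\<And>C. C \<in> sets \<Gamma> \<Longrightarrow>
      \<exists>U\<in>sets (quotient_algebra \<Gamma> \<xi>). AE c in \<nu>. c \<in> C \<longleftrightarrow> quotient_map \<xi> c \<in> U"
  shows "iso_mod0 \<nu> (quotient_measure \<nu> \<xi>) (quotient_map \<xi>)"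
proof -
  let ?Q = "quotient_algebra \<Gamma> \<xi>" and ?q = "quotient_map \<xi>"
  note sets [measurable_cong]
  have space: "space \<nu> = space \<Gamma>" by (rule sets_eq_imp_space_eq[OF sets])
  have p: "partition_on (space \<Gamma>) \<xi>" using part by (simp add: measurable_partition_def)
  have q [measurable]: "?q \<in> \<Gamma> \<rightarrow>\<^sub>M ?Q" by (rule measurable_quotient_map[OF p])
  obtain A f g where A: "A \<in> sets (borel :: real measure)"
    and f: "f \<in> \<Gamma> \<rightarrow>\<^sub>M restrict_space borel A" and g: "g \<in> restrict_space borel A \<rightarrow>\<^sub>M \<Gamma>"
    and gf: "\<And>x. x \<in> space \<Gamma> \<Longrightarrow> g (f x) = x" and fg: "\<And>y. y \<in> A \<Longrightarrow> f (g y) = y"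
    using std unfolding standard_borel_def by blast
  have f_A: "f x \<in> A" if "x \<in> space \<Gamma>" for x
    using measurable_space[OF f that] by (simp add: space_restrict_space)
  have [measurable]: "f \<in> borel_measurable \<Gamma>"
    using f by (rule measurable_restrict_space2_iff[THEN iffD1, THEN conjunct1])
  obtain F where F [measurable]: "F \<in> borel_measurable ?Q" and Ff: "AE x in \<nu>. F (?q x) = f x"
    using factor_real_function_AE[of f \<nu> ?q ?Q] approx by (auto simp: sets)
  obtain S where S: "\<And>i::nat. S i \<in> sets \<Gamma>" "\<And>i. \<exists>U\<subseteq>\<xi>. S i = \<Union>U"
    and sep: "\<And>C D. C \<in> \<xi> \<Longrightarrow> D \<in> \<xi> \<Longrightarrow> C \<noteq> D \<Longrightarrow>
      \<exists>i. (C \<subseteq> S i \<and> \<not> D \<subseteq> S i) \<or> (\<not> C \<subseteq> S i \<and> D \<subseteq> S i)"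
    using part unfolding measurable_partition_def by metis
  obtain U where U: "\<And>i. U i \<subseteq> \<xi>" "\<And>i. S i = \<Union>(U i)" using S(2) by metis
  have U_sets [measurable]: "U i \<in> sets ?Q" for i
    using U S(1)[of i] by (simp add: sets_quotient_algebra[OF p])
  have sub_iff: "D \<subseteq> S i \<longleftrightarrow> D \<in> U i" if "D \<in> \<xi>" for D i
  proof -
    have "D \<noteq> {}" using that p unfolding partition_on_def by metis
    then obtain x where x: "x \<in> D" by auto
    have xs: "x \<in> space \<Gamma>" using that x partition_onD1[OF p] by auto
    have "?q x = D" by (rule quotient_map_eq[OF p that x])
    then have "D \<in> U i \<longleftrightarrow> x \<in> S i"
      using quotient_map_mem_iff[OF p U(1)[of i] xs] U(2)[of i] by simp
    moreover have "D \<in> U i \<Longrightarrow> D \<subseteq> S i" using U(2)[of i] by (simp add: Union_upper)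
    ultimately show ?thesis using x by (metis subsetD)
  qed
  define E where "E = {D \<in> \<xi>. F D \<in> A}"
  have E [measurable]: "E \<in> sets ?Q"
    using measurable_sets[OF F A] by (simp add: E_def vimage_def Int_def conj_commute)
  have gF [measurable]: "(\<lambda>D. g (F D)) \<in> restrict_space ?Q E \<rightarrow>\<^sub>M \<Gamma>"
  proof (rule measurable_compose[OF _ g], rule measurable_restrict_space2)
    show "F \<in> space (restrict_space ?Q E) \<rightarrow> A" by (auto simp: space_restrict_space E_def)
    show "F \<in> borel_measurable (restrict_space ?Q E)" by (rule measurable_restrict_space1[OF F])
  qed
  have gF_sets: "{D \<in> E. g (F D) \<in> X} \<in> sets ?Q" if "X \<in> sets \<Gamma>" for X
  proof -
    have "(\<lambda>D. g (F D)) -` X \<inter> space (restrict_space ?Q E) \<in> sets (restrict_space ?Q E)"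
      using that by (rule measurable_sets[OF gF])
    moreover have "(\<lambda>D. g (F D)) -` X \<inter> space (restrict_space ?Q E) = {D \<in> E. g (F D) \<in> X}"
      by (auto simp: space_restrict_space E_def)
    moreover have "E \<inter> space ?Q \<in> sets ?Q" using E by (intro sets.Int sets.top)
    ultimately show ?thesis by (simp only: sets_restrict_space_iff)
  qed
  define M\<^sub>0 where "M\<^sub>0 = {x \<in> space \<Gamma>. F (?q x) = f x}"
  \<comment> \<open>The classes that contain the point chosen for them; they are the classes of the points of \<open>M\<^sub>0\<close>.\<close>
  define N\<^sub>0 where "N\<^sub>0 = {D \<in> E. ?q (g (F D)) = D}"
  have g_space: "g (F D) \<in> space \<Gamma>" if "D \<in> E" for D
    using measurable_space[OF g, of "F D"] that by (simp add: E_def space_restrict_space)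
  have N0: "N\<^sub>0 \<in> sets ?Q"
  proof -
    have "N\<^sub>0 = E \<inter> (\<Inter>i. ({D \<in> E. g (F D) \<in> S i} \<inter> U i) \<union> ((\<xi> - {D \<in> E. g (F D) \<in> S i}) \<inter> (\<xi> - U i)))"
      (is "_ = ?R")
    proof (intro Set.set_eqI iffI)
      fix D assume D: "D \<in> N\<^sub>0"
      then have DE: "D \<in> E" "D \<in> \<xi>" by (auto simp: N\<^sub>0_def E_def)
      have "g (F D) \<in> S i \<longleftrightarrow> D \<in> U i" for i
        using quotient_map_mem_iff[OF p U(1)[of i] g_space[OF DE(1)]] D U(2)[of i] by (simp add: N\<^sub>0_def)
      then show "D \<in> ?R" using DE by auto
    next
      fix D assume D: "D \<in> ?R"
      then have DE: "D \<in> E" "D \<in> \<xi>" by (auto simp: E_def)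
      have iff: "g (F D) \<in> S i \<longleftrightarrow> D \<in> U i" for i using D DE by auto
      have "?q (g (F D)) = D"
      proof (rule ccontr)
        assume ne: "?q (g (F D)) \<noteq> D"
        have mem: "?q (g (F D)) \<in> \<xi>" by (rule quotient_map_mem[OF p g_space[OF DE(1)]])
        have "?q (g (F D)) \<in> U i \<longleftrightarrow> D \<in> U i" for i
          using quotient_map_mem_iff[OF p U(1)[of i] g_space[OF DE(1)]] iff[of i] U(2)[of i] by simp
        then show False using sep[OF mem DE(2) ne] sub_iff mem DE(2) by auto
      qed
      then show "D \<in> N\<^sub>0" using DE by (simp add: N\<^sub>0_def)
    qed
    moreover have "?R \<in> sets ?Q"
    proof -
      have "{D \<in> E. g (F D) \<in> S i} \<in> sets ?Q" for i by (rule gF_sets[OF S(1)])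
      moreover have "\<xi> - X \<in> sets ?Q" if "X \<in> sets ?Q" for X
        using sets.compl_sets[OF that] by simp
      ultimately have "({D \<in> E. g (F D) \<in> S i} \<inter> U i) \<union> ((\<xi> - {D \<in> E. g (F D) \<in> S i}) \<inter> (\<xi> - U i)) \<in> sets ?Q" for i
        using U_sets by (intro sets.Un sets.Int) auto
      then show ?thesis by (intro sets.Int[OF E] sets.countable_INT) auto
    qed
    ultimately show ?thesis by simp
  qed
  have M0: "M\<^sub>0 \<in> sets \<nu>" unfolding sets M\<^sub>0_def by measurable
  have recover: "g (F (?q x)) = x" if "x \<in> M\<^sub>0" for x
    using that gf by (simp add: M\<^sub>0_def)
  have "iso_mod0 \<nu> (distr \<nu> ?Q ?q) ?q"
  proof (rule iso_mod0_distrI)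
    show "?q \<in> \<nu> \<rightarrow>\<^sub>M ?Q" by measurable
    show "M\<^sub>0 \<in> sets \<nu>" by (rule M0)
    show "AE x in \<nu>. x \<in> M\<^sub>0" using Ff AE_space by eventually_elim (simp add: M\<^sub>0_def space)
    show "inj_on ?q M\<^sub>0" using recover by (metis inj_onI)
    fix X assume X: "X \<in> sets \<nu>" "X \<subseteq> M\<^sub>0"
    have "?q ` X = N\<^sub>0 \<inter> {D \<in> E. g (F D) \<in> X}"
    proof (intro Set.set_eqI iffI)
      fix D assume "D \<in> ?q ` X"
      then obtain x where x: "x \<in> X" "D = ?q x" by auto
      then have "x \<in> M\<^sub>0" using X by auto
      then have "D \<in> E" using x f_A[of x] quotient_map_mem[OF p, of x] by (auto simp: M\<^sub>0_def E_def)
      then show "D \<in> N\<^sub>0 \<inter> {D \<in> E. g (F D) \<in> X}"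
        using recover[OF \<open>x \<in> M\<^sub>0\<close>] x by (auto simp: N\<^sub>0_def)
    next
      fix D assume "D \<in> N\<^sub>0 \<inter> {D \<in> E. g (F D) \<in> X}"
      then show "D \<in> ?q ` X" by (auto simp: N\<^sub>0_def image_iff intro!: bexI[of _ "g (F D)"])
    qed
    then show "?q ` X \<in> sets ?Q" using N0 gF_sets[of X] X(1) sets by auto
  qed
  then show ?thesis by (simp add: quotient_measure_eq[OF sets])
qed

section \<open>The Poisson boundary and its quotients\<close>

text \<open>
  The composition with \<open>\<phi>\<close> is only defined and measurable mod 0; changing it on a null set makes it
  measurable for the given \<open>\<sigma>\<close>-algebra. Coding the countable set by numbers reduces this to real functions.
\<close>

lemma iso_mod0_countable_pullback:
  assumes iso: "iso_mod0 Q B \<phi>" and A: "countable A" "A \<noteq> {}"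
    and \<pi>: "\<pi> \<in> completion B \<rightarrow>\<^sub>M count_space A"
  shows "\<exists>f\<in>Q \<rightarrow>\<^sub>M count_space A. AE D in Q. f D = \<pi> (\<phi> D)"
proof -
  obtain Q\<^sub>0 B\<^sub>0 where Q0: "Q\<^sub>0 \<subseteq> space Q" "space Q - Q\<^sub>0 \<in> null_sets (completion Q)"
    and B0: "B\<^sub>0 \<subseteq> space B" "space B - B\<^sub>0 \<in> null_sets (completion B)"
    and bij: "bij_betw \<phi> Q\<^sub>0 B\<^sub>0"
    and "\<forall>X\<in>sets (completion Q). X \<subseteq> Q\<^sub>0 \<longrightarrow>
        \<phi> ` X \<in> sets (completion B) \<and> emeasure (completion B) (\<phi> ` X) = emeasure (completion Q) X"
    and vimage: "\<forall>X\<in>sets (completion B). X \<subseteq> B\<^sub>0 \<longrightarrow> \<phi> -` X \<inter> Q\<^sub>0 \<in> sets (completion Q)"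
    using iso unfolding iso_mod0_iff by (elim exE conjE)
  obtain a\<^sub>0 where a0: "a\<^sub>0 \<in> A" using A by auto
  define \<psi> where "\<psi> D = (if D \<in> Q\<^sub>0 then \<pi> (\<phi> D) else a\<^sub>0)" for D
  have \<phi>_B0: "\<phi> D \<in> B\<^sub>0" if "D \<in> Q\<^sub>0" for D using bij that by (auto simp: bij_betw_def)
  have \<phi>_space: "\<phi> D \<in> space B" if "D \<in> Q\<^sub>0" for D using \<phi>_B0[OF that] B0(1) by auto
  have \<psi>_A: "\<psi> D \<in> A" for D
  proof (cases "D \<in> Q\<^sub>0")
    case True
    then have "\<phi> D \<in> space (completion B)" using \<phi>_space by simp
    then show ?thesis using measurable_space[OF \<pi>] True by (simp add: \<psi>_def)
  qed (simp add: \<psi>_def a0)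
  have Q0_sets: "Q\<^sub>0 \<in> sets (completion Q)" by (rule conull_sets_completion[OF Q0])
  have B0_sets: "B\<^sub>0 \<in> sets (completion B)" by (rule conull_sets_completion[OF B0])
  have "\<psi> \<in> completion Q \<rightarrow>\<^sub>M count_space A"
    unfolding measurable_count_space_eq_countable[OF A(1)]
  proof (intro conjI ballI)
    show "\<psi> \<in> space (completion Q) \<rightarrow> A" using \<psi>_A by auto
    fix a assume a: "a \<in> A"
    have "\<pi> -` {a} \<inter> space (completion B) \<in> sets (completion B)"
      using \<pi> a by (intro measurable_sets) auto
    then have "(\<pi> -` {a} \<inter> space (completion B)) \<inter> B\<^sub>0 \<in> sets (completion B)"
      using B0_sets by (rule sets.Int)
    then have "\<phi> -` ((\<pi> -` {a} \<inter> space (completion B)) \<inter> B\<^sub>0) \<inter> Q\<^sub>0 \<in> sets (completion Q)"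
      by (rule vimage[rule_format]) (rule Int_lower2)
    moreover have "\<psi> -` {a} \<inter> space (completion Q) =
        (\<phi> -` ((\<pi> -` {a} \<inter> space (completion B)) \<inter> B\<^sub>0) \<inter> Q\<^sub>0) \<union> (if a = a\<^sub>0 then space (completion Q) - Q\<^sub>0 else {})"
      using \<phi>_B0 \<phi>_space Q0(1) by (auto simp: \<psi>_def split: if_splits)
    ultimately show "\<psi> -` {a} \<inter> space (completion Q) \<in> sets (completion Q)"
      using Q0_sets by auto
  qed
  from measurable_compose[OF this, of "\<lambda>a. real (to_nat_on A a)" borel]
  have "(\<lambda>D. real (to_nat_on A (\<psi> D))) \<in> borel_measurable (completion Q)" by simp
  then obtain g where g [measurable]: "g \<in> borel_measurable Q"
    and g_eq: "AE D in Q. real (to_nat_on A (\<psi> D)) = g D"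
    using completion_ex_borel_measurable_real by blast
  define f where "f D = from_nat_into A (nat \<lfloor>g D\<rfloor>)" for D
  have "(\<lambda>D. nat \<lfloor>g D\<rfloor>) \<in> Q \<rightarrow>\<^sub>M count_space UNIV" by measurable
  moreover have "from_nat_into A \<in> count_space UNIV \<rightarrow>\<^sub>M count_space A"
    using from_nat_into[OF A(2)] by simp
  ultimately have f: "f \<in> Q \<rightarrow>\<^sub>M count_space A"
    unfolding f_def by (rule measurable_compose)
  have "AE D in completion Q. D \<notin> space Q - Q\<^sub>0" using Q0(2) by (rule AE_not_in)
  then have "AE D in Q. D \<notin> space Q - Q\<^sub>0" by (simp only: AE_completion_iff)
  with g_eq have "AE D in Q. f D = \<pi> (\<phi> D)"
    using AE_space
  proof eventually_elim
    case (elim D)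
    then have "\<psi> D = \<pi> (\<phi> D)" by (simp add: \<psi>_def)
    moreover have "f D = from_nat_into A (nat \<lfloor>real (to_nat_on A (\<psi> D))\<rfloor>)"
      unfolding f_def elim(1) ..
    moreover have "\<dots> = \<psi> D" using A(1) \<psi>_A by simp
    ultimately show ?case by simp
  qed
  with f show ?thesis by blast
qed

context random_walk begin

lemma measurable_walk: "x \<in> carrier G \<Longrightarrow> walk G x \<in> increments \<rightarrow>\<^sub>M path_space G"
proof -
  assume x: "x \<in> carrier G"
  show ?thesis unfolding path_space_def
  proof (rule measurable_PiM_single')
    fix n
    have "(\<lambda>y. x \<otimes> y) \<in> count_space (carrier G) \<rightarrow>\<^sub>M count_space (carrier G)"
      using x by simp
    then have "(\<lambda>h. x \<otimes> position n h) \<in> increments \<rightarrow>\<^sub>M count_space (carrier G)"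
      by (rule measurable_compose[OF measurable_position])
    then show "(\<lambda>h. walk G x h n) \<in> increments \<rightarrow>\<^sub>M count_space (carrier G)"
      using walk_eq_position[OF x] by (subst measurable_cong) auto
  qed (use x walk_in_carrier in auto)
qed

lemma measurable_walk_pair:
  "(\<lambda>(x, h). walk G x h) \<in> count_space (carrier G) \<Otimes>\<^sub>M increments \<rightarrow>\<^sub>M path_space G"
  by (rule measurable_pair_measure_countable1[OF countable_carrier]) (simp add: measurable_walk)

lemma walk_in_path_space: "x \<in> carrier G \<Longrightarrow> h \<in> space increments \<Longrightarrow> walk G x h \<in> space (path_space G)"
  using measurable_space[OF measurable_walk] .

lemma path_measure_eq: "path_measure G \<mu> = distr increments (path_space G) (walk G \<one>)"
proof (rule measure_eqI)
  let ?R = "return (count_space (carrier G)) \<one>"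
  have eq: "path_measure G \<mu> = distr (?R \<Otimes>\<^sub>M increments) (path_space G) (\<lambda>(x, h). walk G x h)"
    by (simp add: path_measure_def markov_measure_def increments_def)
  show "sets (path_measure G \<mu>) = sets (distr increments (path_space G) (walk G \<one>))"
    by (simp add: eq)
  fix A assume "A \<in> sets (path_measure G \<mu>)"
  then have A: "A \<in> sets (path_space G)" by (simp add: eq)
  have m: "(\<lambda>(x, h). walk G x h) \<in> ?R \<Otimes>\<^sub>M increments \<rightarrow>\<^sub>M path_space G"
    by (subst measurable_cong_sets[OF sets_pair_measure_cong[OF sets_return refl] refl])
       (rule measurable_walk_pair)
  let ?A = "(\<lambda>(x, h). walk G x h) -` A \<inter> space (?R \<Otimes>\<^sub>M increments)"
  have "emeasure (path_measure G \<mu>) A = emeasure (?R \<Otimes>\<^sub>M increments) ?A"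
    unfolding eq by (rule emeasure_distr[OF m A])
  also have "\<dots> = (\<integral>\<^sup>+ x. emeasure increments (Pair x -` ?A) \<partial>?R)"
    by (rule incr.emeasure_pair_measure_alt) (rule measurable_sets[OF m A])
  also have "\<dots> = emeasure increments (Pair \<one> -` ?A)"
    by (rule nn_integral_return) simp_all
  also have "Pair \<one> -` ?A = walk G \<one> -` A \<inter> space increments"
    by (auto simp: space_pair_measure)
  also have "emeasure increments \<dots> = emeasure (distr increments (path_space G) (walk G \<one>)) A"
    by (rule emeasure_distr[symmetric]) (simp_all add: measurable_walk A)
  finally show "emeasure (path_measure G \<mu>) A = emeasure (distr increments (path_space G) (walk G \<one>)) A" .
qed

text \<open>
  The counting measure has no nonempty null sets, so a null event for the walk with counting initial
  distribution is null for every starting point.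
\<close>

lemma AE_path_measure_counting:
  assumes "AE x in path_measure_counting G \<mu>. P x" "g \<in> carrier G"
  shows "AE h in increments. P (walk G g h)"
proof -
  interpret count: sigma_finite_measure "count_space (carrier G)"
    by (rule sigma_finite_measure_count_space_countable[OF countable_carrier])
  interpret pair: pair_sigma_finite "count_space (carrier G)" increments ..
  have "AE x in distr (count_space (carrier G) \<Otimes>\<^sub>M increments) (path_space G) (\<lambda>(x, h). walk G x h). P x"
    using assms(1) unfolding path_measure_counting_def markov_measure_def increments_def .
  from AE_distrD[OF measurable_walk_pair this]
  have "AE y in count_space (carrier G) \<Otimes>\<^sub>M increments. P ((\<lambda>(x, h). walk G x h) y)" .
  from pair.AE_pair[OF this] show ?thesis
    using assms(2) by (simp add: AE_count_space)
qed

text \<open>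
  Preimages of measurable sets under the limit map agree mod 0 with shift-invariant sets, and countably many of
  them determine the limit.
\<close>

lemma boundary_shift_invariant:
  assumes pb: "poisson_boundary G \<mu> \<Gamma> act bnd"
  shows "AE h in increments. bnd (walk G \<one> h) = bnd (walk G (h 0) (time_shift h))"
proof -
  have bnd: "bnd \<in> path_space G \<rightarrow>\<^sub>M \<Gamma>" using pb by (simp add: poisson_boundary_def)
  have step: "AE h in increments. bnd (walk G \<one> h) \<in> C \<longleftrightarrow> bnd (walk G (h 0) (time_shift h)) \<in> C"
    if C: "C \<in> sets \<Gamma>" for C
  proof -
    obtain A where A: "A \<in> shift_invariant_sets G"
      and null: "sym_diff A (bnd -` C \<inter> space (path_space G)) \<in> null_sets (path_measure_counting G \<mu>)"
      using pb C unfolding poisson_boundary_def by blast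
    note ae = AE_path_measure_counting[OF AE_not_in[OF null]]
    have "AE h in increments. \<forall>g\<in>carrier G. walk G g h \<notin> sym_diff A (bnd -` C \<inter> space (path_space G))"
      using ae countable_carrier by (intro AE_ball_countable')
    from AE_time_shift[OF this] ae[OF one_closed] AE_space show ?thesis
    proof eventually_elim
      case (elim h)
      have in_space: "walk G \<one> h \<in> space (path_space G)" "walk G (h 0) (time_shift h) \<in> space (path_space G)"
        using elim(3) by (simp_all add: walk_in_path_space)
      have shift: "time_shift (walk G \<one> h) = walk G (h 0) (time_shift h)"
      proof
        fix n
        have "time_shift (walk G \<one> h) n = walk G \<one> h (Suc n)" by (simp add: time_shift_def)
        also have "\<dots> = walk G (h 0) (time_shift h) n" using elim(3) by (subst walk_Suc_shift) simp
        finally show "time_shift (walk G \<one> h) n = walk G (h 0) (time_shift h) n" .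
      qed
      have "A = time_shift -` A \<inter> space (path_space G)"
        using A by (simp add: shift_invariant_sets_def)
      then have "walk G \<one> h \<in> A \<longleftrightarrow> walk G (h 0) (time_shift h) \<in> A"
        using in_space(1) shift by (metis (no_types, lifting) IntD1 IntI vimage_eq)
      moreover have "walk G (h 0) (time_shift h) \<notin> sym_diff A (bnd -` C \<inter> space (path_space G))"
        using elim(1,3) by simp
      ultimately show ?case
        using elim(2) in_space by blast
    qed
  qed
  obtain A f g where f: "f \<in> \<Gamma> \<rightarrow>\<^sub>M restrict_space (borel :: real measure) A"
    and gf: "\<And>x. x \<in> space \<Gamma> \<Longrightarrow> g (f x) = x"
    using pb unfolding poisson_boundary_def standard_borel_def by blast
  have [measurable]: "f \<in> borel_measurable \<Gamma>"
    using f by (rule measurable_restrict_space2_iff[THEN iffD1, THEN conjunct1])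
  have "AE h in increments. \<forall>r::rat. bnd (walk G \<one> h) \<in> {c \<in> space \<Gamma>. f c < of_rat r} \<longleftrightarrow>
      bnd (walk G (h 0) (time_shift h)) \<in> {c \<in> space \<Gamma>. f c < of_rat r}"
    by (subst AE_all_countable, intro allI step) measurable
  then show ?thesis using AE_space
  proof eventually_elim
    case (elim h)
    have in_space: "bnd (walk G \<one> h) \<in> space \<Gamma>" "bnd (walk G (h 0) (time_shift h)) \<in> space \<Gamma>"
      using elim(2) measurable_space[OF bnd] by (simp_all add: walk_in_path_space)
    have iff: "f (bnd (walk G \<one> h)) < of_rat r \<longleftrightarrow> f (bnd (walk G (h 0) (time_shift h))) < of_rat r" for r
      using elim(1)[rule_format, of r] in_space by simp
    have "f (bnd (walk G \<one> h)) = f (bnd (walk G (h 0) (time_shift h)))"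
    proof (rule ccontr)
      assume "f (bnd (walk G \<one> h)) \<noteq> f (bnd (walk G (h 0) (time_shift h)))"
      then show False using iff of_rat_dense by (metis linorder_neqE_linordered_idom not_less_iff_gr_or_eq)
    qed
    then show ?case using gf in_space by metis
  qed
qed

lemma walk_boundary_poisson:
  assumes pb: "poisson_boundary G \<mu> \<Gamma> act bnd"
  shows "walk_boundary G \<mu> \<Gamma> act (\<lambda>h. bnd (walk G \<one> h))"
proof
  have bnd: "bnd \<in> path_space G \<rightarrow>\<^sub>M \<Gamma>" using pb by (simp add: poisson_boundary_def)
  interpret action: group_action G "space \<Gamma>" act using pb by (simp add: poisson_boundary_def)
  show "(\<lambda>h. bnd (walk G \<one> h)) \<in> increments \<rightarrow>\<^sub>M \<Gamma>"
    by (rule measurable_compose[OF measurable_walk bnd]) simp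
  show "act g \<in> \<Gamma> \<rightarrow>\<^sub>M \<Gamma>" if "g \<in> carrier G" for g
    using pb that by (simp add: poisson_boundary_def)
  show "act \<one> c = c" if "c \<in> space \<Gamma>" for c
    using action.id_eq_one that by (metis restrict_apply')
  show "act (g \<otimes> k) c = act g (act k c)" if "g \<in> carrier G" "k \<in> carrier G" "c \<in> space \<Gamma>" for g k c
    using action.composition_rule that by simp
  have "AE h in increments. bnd (walk G g h) = act g (bnd (walk G \<one> h))" if g: "g \<in> carrier G" for g
  proof -
    have "AE x in path_measure_counting G \<mu>. bnd (translate G g x) = act g (bnd x)"
      using pb g by (simp add: poisson_boundary_def)
    from AE_path_measure_counting[OF this one_closed] AE_space
    show ?thesis
    proof eventually_elim
      case (elim h)
      have "walk G g h = translate G g (walk G \<one> h)"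
        using elim(2) g walk_eq_position[of g h] by (auto simp: translate_def position_def)
      then show ?case using elim(1) by simp
    qed
  qed
  then have "AE h in increments. \<forall>g\<in>carrier G. bnd (walk G g h) = act g (bnd (walk G \<one> h))"
    using countable_carrier by (intro AE_ball_countable')
  from AE_time_shift[OF this] boundary_shift_invariant[OF pb] AE_space
  show "AE h in increments. bnd (walk G \<one> h) = act (h 0) (bnd (walk G \<one> (time_shift h)))"
  proof eventually_elim
    case (elim h)
    have "h 0 \<in> carrier G" using elim(3) by (rule increment_in_carrier)
    with elim(1) have "bnd (walk G (h 0) (time_shift h)) = act (h 0) (bnd (walk G \<one> (time_shift h)))"
      by (rule bspec)
    with elim(2) show ?case by (rule trans)
  qed
qed

text \<open>
  The elements of an invariant partition are permuted by the action, and taking classes commutes with it.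
\<close>

lemma walk_boundary_quotient:
  assumes wb: "walk_boundary G \<mu> \<Gamma> act \<beta>"
    and part: "partition_on (space \<Gamma>) \<xi>" and inv: "invariant_partition G act \<xi>"
  shows "walk_boundary G \<mu> (quotient_algebra \<Gamma> \<xi>) (\<lambda>g D. act g ` D) (\<lambda>h. quotient_map \<xi> (\<beta> h))"
proof
  interpret walk_boundary G \<mu> \<Gamma> act \<beta> by (rule wb)
  have sub: "D \<subseteq> space \<Gamma>" if "D \<in> \<xi>" for D using part that by (auto simp: partition_on_def)
  have act_D: "act g ` D \<in> \<xi>" if "g \<in> carrier G" "D \<in> \<xi>" for g D
    using inv that by (simp add: invariant_partition_def)
  have q_act: "quotient_map \<xi> (act g c) = act g ` quotient_map \<xi> c" if "g \<in> carrier G" "c \<in> space \<Gamma>" for g c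
    using quotient_map_mem[OF part that(2)] that(1)
    by (intro quotient_map_eq[OF part]) (auto simp: act_D)
  show "(\<lambda>h. quotient_map \<xi> (\<beta> h)) \<in> increments \<rightarrow>\<^sub>M quotient_algebra \<Gamma> \<xi>"
    by (rule measurable_compose[OF measurable_boundary measurable_quotient_map[OF part]])
  show "(\<lambda>D. act g ` D) \<in> quotient_algebra \<Gamma> \<xi> \<rightarrow>\<^sub>M quotient_algebra \<Gamma> \<xi>" if g: "g \<in> carrier G" for g
  proof (rule measurableI)
    show "D \<in> space (quotient_algebra \<Gamma> \<xi>) \<Longrightarrow> act g ` D \<in> space (quotient_algebra \<Gamma> \<xi>)" for D
      using act_D[OF g] by simp
    fix U assume "U \<in> sets (quotient_algebra \<Gamma> \<xi>)"
    then have U: "U \<subseteq> \<xi>" "\<Union>U \<in> sets \<Gamma>" by (auto simp: sets_quotient_algebra[OF part])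
    let ?V = "(\<lambda>D. act g ` D) -` U \<inter> \<xi>"
    have "c \<in> \<Union>?V \<longleftrightarrow> c \<in> act g -` \<Union>U \<inter> space \<Gamma>" for c
    proof (cases "c \<in> space \<Gamma>")
      case True
      have "c \<in> \<Union>?V \<longleftrightarrow> quotient_map \<xi> c \<in> ?V"
        by (rule quotient_map_mem_iff[OF part _ True, symmetric]) auto
      also have "\<dots> \<longleftrightarrow> quotient_map \<xi> (act g c) \<in> U"
        using quotient_map_mem(1)[OF part True] q_act[OF g True] by simp
      also have "\<dots> \<longleftrightarrow> act g c \<in> \<Union>U"
        by (rule quotient_map_mem_iff[OF part U(1) act_in_space[OF g True]])
      finally show ?thesis using True by simp
    next
      case False
      then show ?thesis using sub by blast
    qed
    then have "\<Union>?V = act g -` \<Union>U \<inter> space \<Gamma>" by (rule Set.set_eqI)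
    also have "\<dots> \<in> sets \<Gamma>" by (rule measurable_sets[OF measurable_act[OF g] U(2)])
    finally show "(\<lambda>D. act g ` D) -` U \<inter> space (quotient_algebra \<Gamma> \<xi>) \<in> sets (quotient_algebra \<Gamma> \<xi>)"
      by (simp add: sets_quotient_algebra[OF part])
  qed
  show "act \<one> ` D = D" if "D \<in> space (quotient_algebra \<Gamma> \<xi>)" for D
  proof -
    have "act \<one> ` D = (\<lambda>c. c) ` D" using that sub act_one by (intro image_cong) auto
    then show ?thesis by simp
  qed
  show "act (g \<otimes> k) ` D = act g ` act k ` D"
    if "g \<in> carrier G" "k \<in> carrier G" "D \<in> space (quotient_algebra \<Gamma> \<xi>)" for g k D
    unfolding image_image using that sub[of D] by (intro image_cong refl act_mult) auto
  show "AE h in increments. quotient_map \<xi> (\<beta> h) = act (h 0) ` quotient_map \<xi> (\<beta> (time_shift h))"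
    using boundary_shift AE_space
  proof eventually_elim
    case (elim h)
    show ?case by (subst elim(1)) (use elim(2) in \<open>simp add: q_act\<close>)
  qed
qed

lemma integrable_information_of_finite_entropy:
  assumes "finite_entropy \<mu>"
  shows "integrable \<mu> (\<lambda>g. - ln (measure \<mu> {g}))"
proof -
  have "\<mu> = density (count_space (carrier G)) (\<lambda>g. ennreal (measure \<mu> {g}))"
  proof (rule measure_eqI_countable[OF sets_step _ countable_carrier])
    show "sets (density (count_space (carrier G)) (\<lambda>g. ennreal (measure \<mu> {g}))) = Pow (carrier G)" by simp
    fix a assume a: "a \<in> carrier G"
    have "emeasure (density (count_space (carrier G)) (\<lambda>g. ennreal (measure \<mu> {g}))) {a}
      = (\<integral>\<^sup>+ g. ennreal (measure \<mu> {a}) * indicator {a} g \<partial>count_space (carrier G))"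
      using a by (subst emeasure_density) (auto intro!: nn_integral_cong simp: indicator_def)
    then show "emeasure \<mu> {a} = emeasure (density (count_space (carrier G)) (\<lambda>g. ennreal (measure \<mu> {g}))) {a}"
      using a by (simp add: nn_integral_cmult_indicator step.emeasure_eq_measure)
  qed
  moreover have "integrable (density (count_space (carrier G)) (\<lambda>g. ennreal (measure \<mu> {g}))) (\<lambda>g. - ln (measure \<mu> {g}))"
  proof (subst integrable_density)
    have "integrable (count_space (carrier G)) (\<lambda>g. - (measure \<mu> {g} * ln (measure \<mu> {g})))"
      using assms unfolding finite_entropy_def space_step
      by (simp only: summable_on_iff_abs_summable_on_real[THEN iffD1, THEN abs_summable_equivalent[THEN iffD1]]
          flip: Infinite_Set_Sum.abs_summable_on_def)
    then show "integrable (count_space (carrier G)) (\<lambda>g. measure \<mu> {g} *\<^sub>R - ln (measure \<mu> {g}))" by simp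
  qed auto
  ultimately show ?thesis by metis
qed

end

theorem theorem5p5:
  fixes G :: "('a, 'm) monoid_scheme"
    and \<mu> :: "'a measure"
    and \<Gamma> :: "'c measure"
    and act :: "'a \<Rightarrow> 'c \<Rightarrow> 'c"
    and bnd :: "(nat \<Rightarrow> 'a) \<Rightarrow> 'c"
    and \<xi> :: "'c set set"
    and \<phi> :: "'c set \<Rightarrow> 'b"
    and B :: "'b measure"
    and \<G> :: "nat \<Rightarrow> 'a set"
    and \<pi> :: "nat \<Rightarrow> 'b \<Rightarrow> 'a"
  assumes "group G" and "countable (carrier G)"
    and "prob_space \<mu>" and "sets \<mu> = Pow (carrier G)"
    and "finite_entropy \<mu>"
    and "poisson_boundary G \<mu> \<Gamma> act bnd"
    and "mu_boundary G \<mu> \<Gamma> act bnd \<xi> \<phi> B"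
    and "temperate_gauge G \<G>"
    and "\<And>n. \<pi> n \<in> completion B \<rightarrow>\<^sub>M count_space (carrier G)"
    and "AE x in path_measure G \<mu>.
           (\<lambda>n. 1 / real n * real (gauge_function \<G>
              (inv\<^bsub>G\<^esub> (\<pi> n (boundary_projection bnd \<xi> \<phi> x)) \<otimes>\<^bsub>G\<^esub> x n))) \<longlonglongrightarrow> 0"
  shows "is_the_poisson_boundary G \<mu> \<Gamma> bnd \<xi> \<phi> B"
proof -
  interpret random_walk G \<mu>
    using assms(1-4) by (simp add: random_walk_def random_walk_axioms_def)
  let ?\<nu> = "harmonic_measure G \<mu> \<Gamma> bnd" and ?q = "quotient_map \<xi>"
  let ?\<beta> = "\<lambda>h. bnd (walk G \<one>\<^bsub>G\<^esub> h)" and ?Q = "quotient_algebra \<Gamma> \<xi>"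
  have part: "measurable_partition \<Gamma> \<xi>" and inv: "invariant_partition G act \<xi>"
    and iso: "iso_mod0 (quotient_measure ?\<nu> \<xi>) B \<phi>"
    using assms(7) by (simp_all add: mu_boundary_def)
  have p: "partition_on (space \<Gamma>) \<xi>" using part by (simp add: measurable_partition_def)
  interpret whole: walk_boundary G \<mu> \<Gamma> act ?\<beta> by (rule walk_boundary_poisson[OF assms(6)])
  interpret factor: walk_boundary G \<mu> ?Q "\<lambda>g D. act g ` D" "\<lambda>h. ?q (?\<beta> h)"
    by (rule walk_boundary_quotient[OF whole.walk_boundary_axioms p inv])
  interpret boundary_factor G \<mu> \<Gamma> act ?\<beta> ?Q "\<lambda>g D. act g ` D" ?q
    by unfold_locales
      (rule measurable_quotient_map[OF p], rule integrable_information_of_finite_entropy[OF assms(5)])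
  have bnd: "bnd \<in> path_space G \<rightarrow>\<^sub>M \<Gamma>" using assms(6) by (simp add: poisson_boundary_def)
  have \<nu>: "?\<nu> = whole.harmonic"
    unfolding harmonic_measure_def whole.harmonic_def path_measure_eq
    by (subst distr_distr[OF bnd measurable_walk]) (simp_all add: o_def)
  have Q: "quotient_measure ?\<nu> \<xi> = factor.harmonic"
    unfolding \<nu> factor_harmonic by (rule quotient_measure_eq) simp
  have "\<forall>n. \<exists>f. f \<in> factor.harmonic \<rightarrow>\<^sub>M count_space (carrier G) \<and> (AE D in factor.harmonic. f D = \<pi> n (\<phi> D))"
  proof
    fix n
    have "carrier G \<noteq> {}" using one_closed by auto
    from iso_mod0_countable_pullback[OF iso countable_carrier this assms(9)[of n]]
    show "\<exists>f. f \<in> factor.harmonic \<rightarrow>\<^sub>M count_space (carrier G) \<and> (AE D in factor.harmonic. f D = \<pi> n (\<phi> D))"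
      unfolding Q by blast
  qed
  from choice[OF this] obtain f where f: "\<And>n. f n \<in> factor.harmonic \<rightarrow>\<^sub>M count_space (carrier G)"
    and f_eq: "\<And>n. AE D in factor.harmonic. f n D = \<pi> n (\<phi> D)" by blast
  have f_meas: "f n \<in> ?Q \<rightarrow>\<^sub>M count_space (carrier G)" for n
    using f[of n] by simp
  have conv: "AE h in increments.
      (\<lambda>n. 1 / real n * real (gauge_function \<G> (inv\<^bsub>G\<^esub> (f n (?q (?\<beta> h))) \<otimes>\<^bsub>G\<^esub> position n h))) \<longlonglongrightarrow> 0"
  proof -
    have "AE h in increments. \<forall>n. f n (?q (?\<beta> h)) = \<pi> n (\<phi> (?q (?\<beta> h)))"
      by (subst AE_all_countable, rule allI, rule factor.AE_boundary, rule f_eq)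
    moreover have "AE h in increments. (\<lambda>n. 1 / real n * real (gauge_function \<G>
        (inv\<^bsub>G\<^esub> (\<pi> n (boundary_projection bnd \<xi> \<phi> (walk G \<one>\<^bsub>G\<^esub> h))) \<otimes>\<^bsub>G\<^esub> walk G \<one>\<^bsub>G\<^esub> h n))) \<longlonglongrightarrow> 0"
      by (rule AE_distrD[OF measurable_walk[OF one_closed]]) (rule assms(10)[unfolded path_measure_eq])
    ultimately show ?thesis
      by eventually_elim (simp add: boundary_projection_def boundary_quotient_def position_def)
  qed
  have gap: "entropy_gap \<le> 0"
    by (rule entropy_gap_nonpos[OF assms(8) f_meas conv])
  have "iso_mod0 ?\<nu> (quotient_measure ?\<nu> \<xi>) ?q"
  proof (rule iso_mod0_quotient_map)
    show "standard_borel \<Gamma>" using assms(6) by (simp add: poisson_boundary_def)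
    show "sets ?\<nu> = sets \<Gamma>" by (simp add: harmonic_measure_def)
    show "\<exists>U\<in>sets ?Q. AE c in ?\<nu>. c \<in> C \<longleftrightarrow> ?q c \<in> U" if "C \<in> sets \<Gamma>" for C
      unfolding \<nu> by (rule boundary_event_is_factor_event[OF gap that])
  qed (rule part)
  from iso_mod0_trans[OF this iso] show ?thesis
    by (simp add: is_the_poisson_boundary_def boundary_quotient_def)
qed

end
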